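(* Let $N,m\ge1$ and $l\ge0$ be integers. Let $\mathscr{A}=(-1)^m\sum_{|\alpha|=|\beta|=m}a_{\alpha,\beta}\,\partial^\beta\partial^\alpha$ be an operator of order $2m$ on $\mathbb{R}^N$ with constant real symmetric coefficients satisfying the ellipticity condition (see context). Let $u\in H^m(B(0,1))$ be a weak solution of $\mathscr{A}u=f$ in $B(0,1)$ with $f\in H^l(B(0,1))$. Then $u\in H^{2m+l}(B(0,1/2))$ and $$\|u\|_{H^{2m+l}(B(0,\frac12))}\le C\left(\|u\|_{H^m(B(0,1))}+\|f\|_{H^l(B(0,1))}\right),$$ where $C>0$ is a constant that depends on $N$, $\max_{\alpha,\beta}|a_{\alpha,\beta}|$, $l$ and $m$.
   Context: $B(0,r)$ is the open ball in $\mathbb{R}^N$ centered at $0$ of radius $r$. $H^k(U)$ is the Sobolev space with norm $\|u\|_{H^k(U)}^2=\sum_{|\alpha|\le k}\|\partial^\alpha u\|_{L^2(U)}^2$, and $H^k_0(U)$ is the closure in $H^k(U)$ of the $C^\infty$ functions with compact support in $U$. Operator: the coefficients $a_{\alpha,\beta}\in\mathbb{R}$ are indexed by multi-indices of length $m$, are symmetric ($a_{\alpha,\beta}=a_{\beta,\alpha}$), and satisfy the ellipticity condition: there is a constant $c>0$ such that $\sum_{|\alpha|=|\beta|=m}a_{\alpha,\beta}\xi_\alpha\xi_\beta\ge c\sum_{|\alpha|=m}|\xi_\alpha|^2$ for all real vectors $\xi=(\xi_\alpha)_{|\alpha|=m}$. Weak solution of $\mathscr{A}u=f$ in $B(0,1)$: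 $\int_{B(0,1)}\sum_{|\alpha|=|\beta|=m}a_{\alpha,\beta}\,\partial^\alpha u\,\partial^\beta\varphi\,dx=\int_{B(0,1)}f\varphi\,dx$ for every $\varphi\in H^m_0(B(0,1))$.
   Formalization: The constant C is also allowed to depend on the ellipticity constant c; with dependence only on N, max|a|, l and m the estimate fails for N ≥ 2 (e.g. m=1, l=0, a=diag(1,1/k²), u=f=sin(ky), k→∞). *)

theory Defs
  imports "HOL-Analysis.Analysis"
begin

section \<open>Multi-indices and classical partial derivatives\<close>

definition mi_order :: "nat ^ 'n \<Rightarrow> nat" where
  "mi_order \<alpha> = (\<Sum>i\<in>UNIV. \<alpha> $ i)"

definition partial_deriv :: "'n \<Rightarrow> (real ^ 'n \<Rightarrow> real) \<Rightarrow> real ^ 'n \<Rightarrow> real" where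
  "partial_deriv i \<phi> = (\<lambda>x. frechet_derivative \<phi> (at x) (axis i 1))"

text \<open>
  A function is smooth iff all its iterated partial derivatives exist and are (Frechet)
  differentiable; continuity of all of them is then automatic.
\<close>

definition smooth :: "(real ^ 'n \<Rightarrow> real) \<Rightarrow> bool" where
  "smooth \<phi> \<longleftrightarrow> (\<forall>is x. foldr partial_deriv is \<phi> differentiable (at x))"

text \<open>
  The order in which the partial derivatives are taken is left unspecified. The operator is
  only applied to smooth functions, for which the order is irrelevant.
\<close>

definition mi_deriv :: "nat ^ 'n \<Rightarrow> (real ^ 'n \<Rightarrow> real) \<Rightarrow> real ^ 'n \<Rightarrow> real" where
  "mi_deriv \<alpha> \<phi> = foldr partial_deriv (SOME is. \<forall>i. count_list is i = \<alpha> $ i) \<phi>"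

definition test_functions :: "(real ^ 'n) set \<Rightarrow> (real ^ 'n \<Rightarrow> real) set" where
  "test_functions U =
     {\<phi>. smooth \<phi> \<and> compact (closure {x. \<phi> x \<noteq> 0}) \<and> closure {x. \<phi> x \<noteq> 0} \<subseteq> U}"


section \<open>Sobolev spaces\<close>

text \<open>
  Elements of the function spaces are represented by functions on the whole space whose values
  outside \<open>U\<close> play no role; no quotient modulo equality almost everywhere is formed.
\<close>

definition L2_space :: "(real ^ 'n) set \<Rightarrow> (real ^ 'n \<Rightarrow> real) set" where
  "L2_space U =
     {f \<in> borel_measurable (lebesgue_on U). integrable (lebesgue_on U) (\<lambda>x. (f x)\<^sup>2)}"

definition L2_norm_on :: "(real ^ 'n) set \<Rightarrow> (real ^ 'n \<Rightarrow> real) \<Rightarrow> real" where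
  "L2_norm_on U f = sqrt (integral\<^sup>L (lebesgue_on U) (\<lambda>x. (f x)\<^sup>2))"

definition locally_integrable :: "(real ^ 'n) set \<Rightarrow> (real ^ 'n \<Rightarrow> real) \<Rightarrow> bool" where
  "locally_integrable U f \<longleftrightarrow>
     (\<forall>K. compact K \<and> K \<subseteq> U \<longrightarrow> integrable (lebesgue_on K) f)"

definition has_weak_deriv ::
    "(real ^ 'n) set \<Rightarrow> nat ^ 'n \<Rightarrow> (real ^ 'n \<Rightarrow> real) \<Rightarrow> (real ^ 'n \<Rightarrow> real) \<Rightarrow> bool" where
  "has_weak_deriv U \<alpha> u g \<longleftrightarrow>
     locally_integrable U u \<and> locally_integrable U g \<and>
     (\<forall>\<phi>\<in>test_functions U.
        integral\<^sup>L (lebesgue_on U) (\<lambda>x. u x * mi_deriv \<alpha> \<phi> x) =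
        (-1) ^ mi_order \<alpha> * integral\<^sup>L (lebesgue_on U) (\<lambda>x. g x * \<phi> x))"

text \<open>Unique up to equality almost everywhere on \<open>U\<close>, for \<open>U\<close> open.\<close>

definition weak_deriv ::
    "(real ^ 'n) set \<Rightarrow> nat ^ 'n \<Rightarrow> (real ^ 'n \<Rightarrow> real) \<Rightarrow> real ^ 'n \<Rightarrow> real" where
  "weak_deriv U \<alpha> u = (SOME g. has_weak_deriv U \<alpha> u g)"

definition sobolev :: "nat \<Rightarrow> (real ^ 'n) set \<Rightarrow> (real ^ 'n \<Rightarrow> real) set" where
  "sobolev k U =
     {u \<in> L2_space U. \<forall>\<alpha>. mi_order \<alpha> \<le> k \<longrightarrow> (\<exists>g\<in>L2_space U. has_weak_deriv U \<alpha> u g)}"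

definition sobolev_norm :: "nat \<Rightarrow> (real ^ 'n) set \<Rightarrow> (real ^ 'n \<Rightarrow> real) \<Rightarrow> real" where
  "sobolev_norm k U u =
     sqrt (\<Sum>\<alpha> | mi_order \<alpha> \<le> k. (L2_norm_on U (weak_deriv U \<alpha> u))\<^sup>2)"

text \<open>The closure of the test functions in the Sobolev norm.\<close>

definition sobolev0 :: "nat \<Rightarrow> (real ^ 'n) set \<Rightarrow> (real ^ 'n \<Rightarrow> real) set" where
  "sobolev0 k U =
     {u \<in> sobolev k U.
        \<forall>\<epsilon>>0. \<exists>\<phi>\<in>test_functions U. sobolev_norm k U (\<lambda>x. u x - \<phi> x) < \<epsilon>}"


section \<open>The operator\<close>

text \<open>
  The operator is given by its coefficients \<open>a \<alpha> \<beta>\<close>; only those with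
  \<open>mi_order \<alpha> = mi_order \<beta> = m\<close> are relevant.
\<close>

definition symmetric_coeffs :: "nat \<Rightarrow> (nat ^ 'n \<Rightarrow> nat ^ 'n \<Rightarrow> real) \<Rightarrow> bool" where
  "symmetric_coeffs m a \<longleftrightarrow>
     (\<forall>\<alpha> \<beta>. mi_order \<alpha> = m \<and> mi_order \<beta> = m \<longrightarrow> a \<alpha> \<beta> = a \<beta> \<alpha>)"

definition elliptic_coeffs :: "nat \<Rightarrow> real \<Rightarrow> (nat ^ 'n \<Rightarrow> nat ^ 'n \<Rightarrow> real) \<Rightarrow> bool" where
  "elliptic_coeffs m c a \<longleftrightarrow>
     (\<forall>\<xi> :: nat ^ 'n \<Rightarrow> real.
        (\<Sum>\<alpha> | mi_order \<alpha> = m. \<Sum>\<beta> | mi_order \<beta> = m. a \<alpha> \<beta> * \<xi> \<alpha> * \<xi> \<beta>)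
          \<ge> c * (\<Sum>\<alpha> | mi_order \<alpha> = m. \<bar>\<xi> \<alpha>\<bar>\<^sup>2))"

definition max_coeff :: "nat \<Rightarrow> (nat ^ 'n \<Rightarrow> nat ^ 'n \<Rightarrow> real) \<Rightarrow> real" where
  "max_coeff m a = Max {\<bar>a \<alpha> \<beta>\<bar> | \<alpha> \<beta>. mi_order \<alpha> = m \<and> mi_order \<beta> = m}"

text \<open>
  Weak solutions \<open>u\<close> of \<open>(-1)^m \<Sum> a \<alpha> \<beta> \<partial>^\<beta> \<partial>^\<alpha> u = f\<close> in \<open>U\<close>: the sign
  is absorbed by integrating by parts \<open>m\<close> times.
\<close>

definition weak_solution ::
    "nat \<Rightarrow> (nat ^ 'n \<Rightarrow> nat ^ 'n \<Rightarrow> real) \<Rightarrow> (real ^ 'n) set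
      \<Rightarrow> (real ^ 'n \<Rightarrow> real) \<Rightarrow> (real ^ 'n \<Rightarrow> real) \<Rightarrow> bool" where
  "weak_solution m a U f u \<longleftrightarrow>
     (\<forall>\<phi>\<in>sobolev0 m U.
        integral\<^sup>L (lebesgue_on U)
          (\<lambda>x. \<Sum>\<alpha> | mi_order \<alpha> = m. \<Sum>\<beta> | mi_order \<beta> = m.
                 a \<alpha> \<beta> * weak_deriv U \<alpha> u x * weak_deriv U \<beta> \<phi> x) =
        integral\<^sup>L (lebesgue_on U) (\<lambda>x. f x * \<phi> x))"

end

theory Submission
  imports Defs
begin

text \<open>
  Because the coefficients are constant, the equation is preserved by mollification, and for the
  smooth mollified solutions the estimate follows from ellipticity and integration by parts.

  The heart of the matter is an estimate for smooth functions \<open>w\<close> that solve the equation weakly with a smooth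
  right-hand side \<open>g\<close> on a ball (\<open>gain_one_derivative\<close>): on a smaller ball, the derivatives of order
  \<open>m + k\<close> of \<open>w\<close> are bounded in the square norm by those of lower order and by the derivatives of
  \<open>g\<close> up to order \<open>l\<close>, as long as \<open>k \<le> m + l\<close>. To obtain it, differentiate \<open>w\<close> along a list \<open>\<gamma>\<close> of
  \<open>k\<close> directions, multiply with a cutoff function \<open>\<eta>\<close> and insert the result \<open>\<phi> = \<eta> D\<^sub>\<gamma> w\<close> into the
  elliptic quadratic form. The commutators of derivatives and cutoff are of lower order, up to one
  integration by parts, and in the remaining term the equation moves \<open>\<gamma>\<close> to \<open>g\<close> and to \<open>\<eta> \<phi>\<close>.
  Iterating over a shrinking family of balls leads from order \<open>m\<close> to order \<open>2 m + l\<close>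
  (\<open>interior_estimate\<close>), with a constant that depends on the coefficients only through the bounds
  \<open>c\<close> and \<open>M\<close>.

  Mollification contracts the square norm, so the derivatives of the mollified solutions up to order
  \<open>2 m + l\<close> are bounded on the ball of radius 1/2, uniformly in the scale. Consequently the
  distributional derivatives of \<open>u\<close> are functionals that are bounded in the square norm
  (\<open>distributional_derivative_bound\<close>). A Riesz representation theorem for functionals on test functions
  (\<open>Riesz_representation_test_functions\<close>) turns them into square integrable weak derivatives with the
  required bound.

  Weak derivatives are given by a choice operator, so they have to be shown unique almost everywhere.
  This is the fundamental lemma of the calculus of variations (\<open>fundamental_lemma\<close>), which also shows
  that for test functions weak and classical derivatives agree.
\<close>

section \<open>Iterated partial derivatives of smooth functions\<close>

text \<open>
  Derivatives are indexed by lists of directions instead of multi-indices, so that statements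
  about them can be proved by induction on the list, from either end. The order of the
  directions turns out to be irrelevant (\<open>pderivs_mset_cong\<close>).
\<close>

definition pderivs :: "'n list \<Rightarrow> (real ^ 'n \<Rightarrow> real) \<Rightarrow> real ^ 'n \<Rightarrow> real" where
  "pderivs is f = foldr partial_deriv is f"

lemma pderivs_Nil [simp]: "pderivs [] f = f"
  by (simp add: pderivs_def)

lemma pderivs_Cons [simp]: "pderivs (i # is) f = partial_deriv i (pderivs is f)"
  by (simp add: pderivs_def)

lemma pderivs_append [simp]: "pderivs (is @ js) f = pderivs is (pderivs js f)"
  by (simp add: pderivs_def)

lemma smooth_iff: "smooth f \<longleftrightarrow> (\<forall>is x. pderivs is f differentiable (at x))"
  by (simp add: smooth_def pderivs_def)

lemma smooth_differentiable: "smooth f \<Longrightarrow> f differentiable (at x)"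
  unfolding smooth_iff by (metis pderivs_Nil)

lemma smooth_pderivs: "smooth f \<Longrightarrow> smooth (pderivs is f)"
  unfolding smooth_iff pderivs_append[symmetric] by blast

lemma smooth_partial_deriv: "smooth f \<Longrightarrow> smooth (partial_deriv i f)"
  using smooth_pderivs[of f "[i]"] by simp

lemma smooth_continuous_on: "smooth f \<Longrightarrow> continuous_on S f"
  by (meson continuous_at_imp_continuous_on differentiable_imp_continuous_within smooth_differentiable)

lemma smooth_borel_measurable [measurable_dest]: "smooth f \<Longrightarrow> f \<in> borel_measurable borel"
  by (simp add: borel_measurable_continuous_onI smooth_continuous_on)

lemma partial_deriv_eqI: "(f has_derivative f') (at x) \<Longrightarrow> partial_deriv i f x = f' (axis i 1)"
  unfolding partial_deriv_def by (metis frechet_derivative_at)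

lemma smooth_has_derivative:
  "smooth f \<Longrightarrow> (f has_derivative (\<lambda>h. \<Sum>i\<in>UNIV. h $ i * partial_deriv i f x)) (at x)"
proof -
  assume "smooth f"
  then have d: "(f has_derivative frechet_derivative f (at x)) (at x)"
    using frechet_derivative_works smooth_differentiable by blast
  then have l: "linear (frechet_derivative f (at x))"
    by (rule has_derivative_linear)
  have "frechet_derivative f (at x) h = (\<Sum>i\<in>UNIV. h $ i * partial_deriv i f x)" for h
  proof -
    have "h = (\<Sum>i\<in>UNIV. h $ i *\<^sub>R axis i 1)"
      by (simp add: basis_expansion flip: scalar_mult_eq_scaleR)
    then have "frechet_derivative f (at x) h
        = frechet_derivative f (at x) (\<Sum>i\<in>UNIV. h $ i *\<^sub>R axis i 1)" by simp
    also have "\<dots> = (\<Sum>i\<in>UNIV. h $ i * partial_deriv i f x)"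
      using l by (simp add: linear_sum linear_scale partial_deriv_def)
    finally show ?thesis .
  qed
  with d show ?thesis by (metis (no_types, lifting) ext)
qed

text \<open>
  Smoothness quantifies over all iterated derivatives. Hence it is enough to exhibit a class of
  differentiable functions that is closed under partial derivatives.
\<close>

lemma smooth_coinduct:
  assumes "f \<in> X" and "\<And>f x. f \<in> X \<Longrightarrow> f differentiable (at x)"
    and "\<And>f i. f \<in> X \<Longrightarrow> partial_deriv i f \<in> X"
  shows "smooth f"
proof -
  have "pderivs is f \<in> X" for "is" using assms(1,3) by (induction "is") auto
  with assms(2) show ?thesis by (auto simp: smooth_iff)
qed

lemma partial_deriv_const [simp]: "partial_deriv i (\<lambda>x. c) = (\<lambda>x. 0)"
  by (simp add: partial_deriv_def)

lemma partial_deriv_component [simp]: "partial_deriv i (\<lambda>x. x $ j) = (\<lambda>x. if i = j then 1 else 0)"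
proof
  fix x :: "real ^ 'a"
  have "((\<lambda>x::real^'a. x $ j) has_derivative (\<lambda>x. x $ j)) (at x)"
    by (rule bounded_linear_imp_has_derivative) (rule bounded_linear_vec_nth)
  from partial_deriv_eqI[OF this] show "partial_deriv i (\<lambda>x. x $ j) x = (if i = j then 1 else 0)"
    by (simp add: axis_def)
qed

lemma partial_deriv_add:
  assumes "\<And>x. f differentiable (at x)" "\<And>x. g differentiable (at x)"
  shows "partial_deriv i (\<lambda>x. f x + g x) = (\<lambda>x. partial_deriv i f x + partial_deriv i g x)"
proof
  fix x
  have "((\<lambda>x. f x + g x) has_derivative
      (\<lambda>h. frechet_derivative f (at x) h + frechet_derivative g (at x) h)) (at x)"
    using assms frechet_derivative_works by (intro has_derivative_add) blast+
  from partial_deriv_eqI[OF this]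
  show "partial_deriv i (\<lambda>x. f x + g x) x = partial_deriv i f x + partial_deriv i g x"
    by (simp add: partial_deriv_def)
qed

lemma partial_deriv_mult:
  assumes "\<And>x. f differentiable (at x)" "\<And>x. g differentiable (at x)"
  shows "partial_deriv i (\<lambda>x. f x * g x) = (\<lambda>x. partial_deriv i f x * g x + f x * partial_deriv i g x)"
proof
  fix x
  have "((\<lambda>x. f x * g x) has_derivative
      (\<lambda>h. f x * frechet_derivative g (at x) h + frechet_derivative f (at x) h * g x)) (at x)"
    using assms frechet_derivative_works by (intro has_derivative_mult) blast+
  from partial_deriv_eqI[OF this]
  show "partial_deriv i (\<lambda>x. f x * g x) x = partial_deriv i f x * g x + f x * partial_deriv i g x"
    by (simp add: partial_deriv_def)
qed

text \<open>
  The algebra generated by \<open>S\<close>. By the product rule, closure under partial derivatives passes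
  from the generators to the whole algebra. Both the stability of smoothness under products and
  the smoothness of the bump function are instances of this.
\<close>

inductive_set smooth_algebra :: "(real ^ 'n \<Rightarrow> real) set \<Rightarrow> (real ^ 'n \<Rightarrow> real) set"
  for S where
    base: "f \<in> S \<Longrightarrow> f \<in> smooth_algebra S"
  | const: "(\<lambda>x. c) \<in> smooth_algebra S"
  | add: "f \<in> smooth_algebra S \<Longrightarrow> g \<in> smooth_algebra S \<Longrightarrow> (\<lambda>x. f x + g x) \<in> smooth_algebra S"
  | mult: "f \<in> smooth_algebra S \<Longrightarrow> g \<in> smooth_algebra S \<Longrightarrow> (\<lambda>x. f x * g x) \<in> smooth_algebra S"

lemma smooth_algebra_smooth:
  assumes "f \<in> smooth_algebra S" and d: "\<And>f x. f \<in> S \<Longrightarrow> f differentiable (at x)"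
    and p: "\<And>f i. f \<in> S \<Longrightarrow> partial_deriv i f \<in> smooth_algebra S"
  shows "smooth f"
proof (rule smooth_coinduct[OF assms(1)])
  show dd: "f differentiable (at x)" if "f \<in> smooth_algebra S" for f x
    using that by induction (auto simp: d)
  show "partial_deriv i f \<in> smooth_algebra S" if "f \<in> smooth_algebra S" for f i
    using that
    by induction (auto simp: p dd partial_deriv_add partial_deriv_mult intro: smooth_algebra.intros)
qed

lemma smooth_algebra_of_smooth: "f \<in> smooth_algebra {f. smooth f} \<Longrightarrow> smooth f"
  by (erule smooth_algebra_smooth)
     (auto simp: smooth_differentiable intro!: smooth_algebra.base smooth_partial_deriv)

lemma smooth_const [simp]: "smooth (\<lambda>x. c)"
  by (rule smooth_algebra_of_smooth) (rule smooth_algebra.const)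

lemma smooth_add: "smooth f \<Longrightarrow> smooth g \<Longrightarrow> smooth (\<lambda>x. f x + g x)"
  by (rule smooth_algebra_of_smooth) (auto intro: smooth_algebra.intros)

lemma smooth_mult: "smooth f \<Longrightarrow> smooth g \<Longrightarrow> smooth (\<lambda>x. f x * g x)"
  by (rule smooth_algebra_of_smooth) (auto intro: smooth_algebra.intros)

lemma smooth_cmult: "smooth f \<Longrightarrow> smooth (\<lambda>x. c * f x)"
  by (intro smooth_mult smooth_const)

lemma smooth_diff: "smooth f \<Longrightarrow> smooth g \<Longrightarrow> smooth (\<lambda>x. f x - g x)"
  using smooth_add[of f "\<lambda>x. -1 * g x"] smooth_cmult[of g "-1"] by simp

lemma pderivs_zero [simp]: "pderivs is (\<lambda>x. 0) = (\<lambda>x. 0)"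
  by (induction "is") auto

lemma pderivs_add:
  "smooth f \<Longrightarrow> smooth g \<Longrightarrow> pderivs is (\<lambda>x. f x + g x) = (\<lambda>x. pderivs is f x + pderivs is g x)"
  by (induction "is") (auto simp: partial_deriv_add smooth_differentiable smooth_pderivs)

lemma partial_deriv_cmult:
  "smooth f \<Longrightarrow> partial_deriv i (\<lambda>x. c * f x) = (\<lambda>x. c * partial_deriv i f x)"
  by (subst partial_deriv_mult) (auto simp: smooth_differentiable)

lemma pderivs_cmult: "smooth f \<Longrightarrow> pderivs is (\<lambda>x. c * f x) = (\<lambda>x. c * pderivs is f x)"
  by (induction "is") (auto simp: partial_deriv_cmult smooth_pderivs)

lemma pderivs_diff:
  assumes "smooth f" "smooth g"
  shows "pderivs is (\<lambda>x. f x - g x) = (\<lambda>x. pderivs is f x - pderivs is g x)"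
  using pderivs_add[of f "\<lambda>x. -1 * g x" "is"] pderivs_cmult[of g "is" "-1"] smooth_cmult[of g "-1"] assms
  by simp

lemma partial_deriv_mult_smooth:
  "smooth f \<Longrightarrow> smooth g \<Longrightarrow>
   partial_deriv i (\<lambda>x. f x * g x) = (\<lambda>x. partial_deriv i f x * g x + f x * partial_deriv i g x)"
  by (rule partial_deriv_mult) (auto simp: smooth_differentiable)

lemma affine_has_derivative:
  fixes f :: "real ^ 'n \<Rightarrow> real"
  assumes "\<And>x. f differentiable (at x)"
  shows "((\<lambda>x. f (a + s *\<^sub>R x)) has_derivative (\<lambda>h. s * frechet_derivative f (at (a + s *\<^sub>R x)) h)) (at x)"
proof -
  have g: "((\<lambda>x. a + s *\<^sub>R x) has_derivative (\<lambda>h. s *\<^sub>R h)) (at x)"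
    by (auto intro!: derivative_eq_intros)
  have f: "(f has_derivative frechet_derivative f (at (a + s *\<^sub>R x))) (at (a + s *\<^sub>R x))"
    using assms frechet_derivative_works by blast
  from diff_chain_at[OF g f] has_derivative_linear[OF f]
  show ?thesis by (simp add: o_def linear_scale)
qed

lemma smooth_affine:
  assumes "smooth f"
  shows "smooth (\<lambda>x. f (a + s *\<^sub>R x))"
    and "pderivs is (\<lambda>x. f (a + s *\<^sub>R x)) = (\<lambda>x. s ^ length is * pderivs is f (a + s *\<^sub>R x))"
proof -
  have p: "pderivs is (\<lambda>x. f (a + s *\<^sub>R x)) = (\<lambda>x. s ^ length is * pderivs is f (a + s *\<^sub>R x))" for "is"
  proof (induction "is")
    case (Cons i "is")
    have d: "((\<lambda>x. pderivs is f (a + s *\<^sub>R x)) has_derivative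
       (\<lambda>h. s * frechet_derivative (pderivs is f) (at (a + s *\<^sub>R x)) h)) (at x)" for x
      by (rule affine_has_derivative) (simp add: assms smooth_differentiable smooth_pderivs)
    then have "((\<lambda>x. s ^ length is * pderivs is f (a + s *\<^sub>R x)) has_derivative
       (\<lambda>h. s ^ length is * (s * frechet_derivative (pderivs is f) (at (a + s *\<^sub>R x)) h))) (at x)" for x
      by (rule has_derivative_mult_right)
    from partial_deriv_eqI[OF this]
    have "partial_deriv i (\<lambda>x. s ^ length is * pderivs is f (a + s *\<^sub>R x))
        = (\<lambda>x. s ^ length (i # is) * pderivs (i # is) f (a + s *\<^sub>R x))"
      by (simp add: fun_eq_iff partial_deriv_def)
    with Cons show ?case by simp
  qed simp
  then show "pderivs is (\<lambda>x. f (a + s *\<^sub>R x)) = (\<lambda>x. s ^ length is * pderivs is f (a + s *\<^sub>R x))" .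
  have "(\<lambda>x. s ^ length is * pderivs is f (a + s *\<^sub>R x)) differentiable (at x)" for "is" x
    using affine_has_derivative[of "pderivs is f"] assms
    by (intro differentiable_mult differentiable_const)
       (meson Derivative.differentiableI smooth_differentiable smooth_pderivs)
  with p show "smooth (\<lambda>x. f (a + s *\<^sub>R x))" by (simp add: smooth_iff)
qed

text \<open>
  Derivatives are local. This is why derivatives of a function stay inside its support, and why
  multiplication with a cutoff does not affect derivatives where the cutoff is 1.
\<close>

lemma pderivs_cong_open:
  assumes "open U" "\<And>x. x \<in> U \<Longrightarrow> f x = g x" "x \<in> U"
  shows "pderivs is f x = pderivs is g x"
  using assms(3)
proof (induction "is" arbitrary: x)
  case (Cons i "is")
  have "frechet_derivative (pderivs is f) (at x) = frechet_derivative (pderivs is g) (at x)"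
  proof -
    have "(pderivs is f has_derivative F) (at x) \<longleftrightarrow> (pderivs is g has_derivative F) (at x)" for F
      using has_derivative_transform_within_open[OF _ assms(1) Cons.prems] Cons.IH by metis
    then show ?thesis by (simp add: frechet_derivative_def)
  qed
  then show ?case by (simp add: partial_deriv_def)
qed (use assms in auto)

lemma pderivs_eq_0_outside:
  assumes "closed K" "\<And>x. x \<notin> K \<Longrightarrow> f x = 0" "x \<notin> K"
  shows "pderivs is f x = 0"
  using pderivs_cong_open[of "- K" f "\<lambda>x. 0" x "is"] assms by (auto simp: open_Compl)

section \<open>Symmetry of second derivatives\<close>

lemma has_real_derivative_line:
  assumes "smooth f"
  shows "((\<lambda>t. f (x + t *\<^sub>R axis i 1)) has_real_derivative partial_deriv i f (x + t *\<^sub>R axis i 1)) (at t)"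
proof -
  have g: "((\<lambda>t. x + t *\<^sub>R axis i 1) has_derivative (\<lambda>h. h *\<^sub>R axis i (1::real))) (at t)"
    by (auto intro!: derivative_eq_intros)
  have f: "(f has_derivative frechet_derivative f (at (x + t *\<^sub>R axis i 1))) (at (x + t *\<^sub>R axis i 1))"
    using assms frechet_derivative_works smooth_differentiable by blast
  from diff_chain_at[OF g f] has_derivative_linear[OF f]
  show ?thesis
    by (simp add: o_def linear_scale has_field_derivative_def partial_deriv_def mult.commute[of _ "frechet_derivative _ _ _"] lambda_one)
qed

text \<open>
  The mean value theorem in direction \<open>i\<close>, applied to the increment of \<open>f\<close> along \<open>j\<close>, followed by
  the mean value theorem in direction \<open>j\<close>.
\<close>

lemma second_difference_mean_value:
  assumes f: "smooth f" and h: "h > 0"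
  obtains s t where "0 < s" "s < h" "0 < t" "t < h"
    "f (x + h *\<^sub>R axis i 1 + h *\<^sub>R axis j 1) - f (x + h *\<^sub>R axis i 1) - f (x + h *\<^sub>R axis j 1) + f x
      = h * h * partial_deriv j (partial_deriv i f) (x + s *\<^sub>R axis i 1 + t *\<^sub>R axis j 1)"
proof -
  define G where "G = (\<lambda>y. f (y + h *\<^sub>R axis j 1) - f y)"
  define F where "F = (\<lambda>s. G (x + s *\<^sub>R axis i 1))"
  have sG: "smooth G" unfolding G_def
    using smooth_affine(1)[of f "h *\<^sub>R axis j 1" 1] f by (intro smooth_diff) (auto simp: add.commute)
  have pG: "partial_deriv i G y = partial_deriv i f (y + h *\<^sub>R axis j 1) - partial_deriv i f y" for y
    using pderivs_diff[of "\<lambda>x. f (h *\<^sub>R axis j 1 + 1 *\<^sub>R x)" f "[i]"] smooth_affine(1)[of f "h *\<^sub>R axis j 1" 1] f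
      smooth_affine(2)[of f "[i]" "h *\<^sub>R axis j 1" 1]
    by (simp add: G_def add.commute)
  have "(F has_real_derivative partial_deriv i G (x + s *\<^sub>R axis i 1)) (at s)" for s
    unfolding F_def using has_real_derivative_line[OF sG] by simp
  then obtain s where s: "0 < s" "s < h" "F h - F 0 = (h - 0) * partial_deriv i G (x + s *\<^sub>R axis i 1)"
    using MVT2[OF h, of F "\<lambda>s. partial_deriv i G (x + s *\<^sub>R axis i 1)"] by auto
  define H where "H = (\<lambda>t. partial_deriv i f (x + s *\<^sub>R axis i 1 + t *\<^sub>R axis j 1))"
  have "(H has_real_derivative partial_deriv j (partial_deriv i f) (x + s *\<^sub>R axis i 1 + t *\<^sub>R axis j 1)) (at t)" for t
    unfolding H_def using has_real_derivative_line[OF smooth_partial_deriv[OF f]] by simp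
  then obtain t where t: "0 < t" "t < h"
    "H h - H 0 = (h - 0) * partial_deriv j (partial_deriv i f) (x + s *\<^sub>R axis i 1 + t *\<^sub>R axis j 1)"
    using MVT2[OF h, of H "\<lambda>t. partial_deriv j (partial_deriv i f) (x + s *\<^sub>R axis i 1 + t *\<^sub>R axis j 1)"] by auto
  have "partial_deriv i G (x + s *\<^sub>R axis i 1) = H h - H 0"
    unfolding pG H_def by simp
  with s t have "F h - F 0 = h * h * partial_deriv j (partial_deriv i f) (x + s *\<^sub>R axis i 1 + t *\<^sub>R axis j 1)"
    by simp
  then show ?thesis using that[of s t] s(1,2) t(1,2)
    unfolding F_def G_def by (auto simp: algebra_simps)
qed

text \<open>
  The second difference quotient is symmetric in the two directions, and by the preceding lemma
  it converges to either of the two mixed derivatives.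
\<close>

lemma partial_deriv_commute:
  assumes f: "smooth f"
  shows "partial_deriv i (partial_deriv j f) = partial_deriv j (partial_deriv i f)"
proof
  fix x
  define A where "A = (\<lambda>h. (f (x + h *\<^sub>R axis i 1 + h *\<^sub>R axis j 1) - f (x + h *\<^sub>R axis i 1)
                              - f (x + h *\<^sub>R axis j 1) + f x) / (h * h))"
  have lim: "((\<lambda>n. A (1 / Suc n)) \<longlongrightarrow> partial_deriv q (partial_deriv p f) x) sequentially"
    if pq: "\<And>h. h > 0 \<Longrightarrow> \<exists>s t. 0 < s \<and> s < h \<and> 0 < t \<and> t < h \<and>
       A h = partial_deriv q (partial_deriv p f) (x + s *\<^sub>R axis p 1 + t *\<^sub>R axis q 1)" for p q
  proof -
    have "\<forall>n. \<exists>s t. 0 < s \<and> s < 1 / Suc n \<and> 0 < t \<and> t < 1 / Suc n \<and>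
       A (1 / Suc n) = partial_deriv q (partial_deriv p f) (x + s *\<^sub>R axis p 1 + t *\<^sub>R axis q 1)"
      using pq by simp
    then obtain s t where st: "\<And>n. 0 < s n \<and> s n < 1 / Suc n \<and> 0 < t n \<and> t n < 1 / Suc n \<and>
       A (1 / Suc n) = partial_deriv q (partial_deriv p f) (x + s n *\<^sub>R axis p 1 + t n *\<^sub>R axis q 1)"
      by metis
    have "s \<longlonglongrightarrow> 0" "t \<longlonglongrightarrow> 0"
      by (rule tendsto_sandwich[OF _ _ tendsto_const LIMSEQ_inverse_real_of_nat];
          use st in \<open>auto intro!: always_eventually simp: less_imp_le inverse_eq_divide\<close>)+
    then have "(\<lambda>n. x + s n *\<^sub>R axis p 1 + t n *\<^sub>R axis q 1) \<longlonglongrightarrow> x + 0 *\<^sub>R axis p 1 + 0 *\<^sub>R axis q 1"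
      by (intro tendsto_intros)
    moreover have "isCont (partial_deriv q (partial_deriv p f)) x"
      using smooth_continuous_on[of "partial_deriv q (partial_deriv p f)" UNIV] f
      by (simp add: continuous_on_eq_continuous_at smooth_partial_deriv)
    ultimately have "(\<lambda>n. partial_deriv q (partial_deriv p f) (x + s n *\<^sub>R axis p 1 + t n *\<^sub>R axis q 1))
        \<longlonglongrightarrow> partial_deriv q (partial_deriv p f) x"
      using isCont_tendsto_compose by fastforce
    then show ?thesis using st by simp
  qed
  have "((\<lambda>n. A (1 / Suc n)) \<longlongrightarrow> partial_deriv j (partial_deriv i f) x) sequentially"
  proof (rule lim)
    fix h :: real assume h: "h > 0"
    from second_difference_mean_value[OF f h, of x i j] show "\<exists>s t. 0 < s \<and> s < h \<and> 0 < t \<and> t < h \<and>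
       A h = partial_deriv j (partial_deriv i f) (x + s *\<^sub>R axis i 1 + t *\<^sub>R axis j 1)"
      using h unfolding A_def by (metis (no_types, lifting) mult_eq_0_iff nonzero_mult_div_cancel_left order_less_irrefl)
  qed
  moreover have "((\<lambda>n. A (1 / Suc n)) \<longlongrightarrow> partial_deriv i (partial_deriv j f) x) sequentially"
  proof (rule lim)
    fix h :: real assume h: "h > 0"
    have eq: "A h = (f (x + h *\<^sub>R axis j 1 + h *\<^sub>R axis i 1) - f (x + h *\<^sub>R axis j 1)
                              - f (x + h *\<^sub>R axis i 1) + f x) / (h * h)"
      unfolding A_def by (simp add: add.commute add.left_commute)
    from second_difference_mean_value[OF f h, of x j i] show "\<exists>s t. 0 < s \<and> s < h \<and> 0 < t \<and> t < h \<and>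
       A h = partial_deriv i (partial_deriv j f) (x + s *\<^sub>R axis j 1 + t *\<^sub>R axis i 1)"
      using h unfolding eq by (metis (no_types, lifting) mult_eq_0_iff nonzero_mult_div_cancel_left order_less_irrefl)
  qed
  ultimately show "partial_deriv i (partial_deriv j f) x = partial_deriv j (partial_deriv i f) x"
    using LIMSEQ_unique by blast
qed

lemma pderivs_partial_commute:
  "smooth f \<Longrightarrow> pderivs is (partial_deriv i f) = partial_deriv i (pderivs is f)"
  by (induction "is") (simp_all add: partial_deriv_commute smooth_pderivs)

text \<open>
  This reconciles lists of directions with multi-indices, for which the order of the
  derivatives is left open.
\<close>

lemma pderivs_mset_cong:
  assumes "smooth f" "mset is = mset js"
  shows "pderivs is f = pderivs js f"
  using assms
proof (induction "is" arbitrary: js f)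
  case (Cons i "is")
  then have "i \<in> set js" by (metis list.set_intros(1) mset_eq_setD)
  then obtain ks ls where js: "js = ks @ i # ls" by (meson split_list)
  with Cons.prems have "mset is = mset (ks @ ls)" by simp
  then have "pderivs is f = pderivs (ks @ ls) f" using Cons by blast
  then have "pderivs (i # is) f = partial_deriv i (pderivs (ks @ ls) f)" by simp
  also have "\<dots> = pderivs js f"
    using pderivs_partial_commute[of "pderivs ls f" ks i] Cons.prems(1)
    by (simp add: js smooth_pderivs)
  finally show ?case .
qed simp

lemma pderivs_commute:
  "smooth f \<Longrightarrow> pderivs is (pderivs js f) = pderivs js (pderivs is f)"
  using pderivs_mset_cong[of f "is @ js" "js @ is"] by (simp add: union_commute)

section \<open>Test functions\<close>

lemma test_functions_iff:
  "\<phi> \<in> test_functions U \<longleftrightarrow>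
     smooth \<phi> \<and> (\<exists>K. compact K \<and> K \<subseteq> U \<and> (\<forall>x. x \<notin> K \<longrightarrow> \<phi> x = 0))"
proof
  assume "\<phi> \<in> test_functions U"
  then show "smooth \<phi> \<and> (\<exists>K. compact K \<and> K \<subseteq> U \<and> (\<forall>x. x \<notin> K \<longrightarrow> \<phi> x = 0))"
    unfolding test_functions_def using closure_subset[of "{x. \<phi> x \<noteq> 0}"]
    by (auto intro!: exI[of _ "closure {x. \<phi> x \<noteq> 0}"])
next
  assume "smooth \<phi> \<and> (\<exists>K. compact K \<and> K \<subseteq> U \<and> (\<forall>x. x \<notin> K \<longrightarrow> \<phi> x = 0))"
  then obtain K where K: "smooth \<phi>" "compact K" "K \<subseteq> U" "\<And>x. x \<notin> K \<Longrightarrow> \<phi> x = 0" by blast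
  then have s: "closure {x. \<phi> x \<noteq> 0} \<subseteq> K"
    by (metis (mono_tags, lifting) closure_minimal compact_imp_closed mem_Collect_eq subsetI)
  with K show "\<phi> \<in> test_functions U"
    unfolding test_functions_def using compact_Int_closed[of K "closure {x. \<phi> x \<noteq> 0}"]
    by (auto simp: inf.absorb2)
qed

lemma test_functionI:
  "smooth \<phi> \<Longrightarrow> compact K \<Longrightarrow> K \<subseteq> U \<Longrightarrow> (\<And>x. x \<notin> K \<Longrightarrow> \<phi> x = 0) \<Longrightarrow> \<phi> \<in> test_functions U"
  unfolding test_functions_iff by blast

lemma test_functionE:
  assumes "\<phi> \<in> test_functions U"
  obtains K where "smooth \<phi>" "compact K" "K \<subseteq> U" "\<And>x. x \<notin> K \<Longrightarrow> \<phi> x = 0"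
  using assms unfolding test_functions_iff by blast

lemma test_function_smooth: "\<phi> \<in> test_functions U \<Longrightarrow> smooth \<phi>"
  by (simp add: test_functions_iff)

lemma test_functions_mono: "\<phi> \<in> test_functions U \<Longrightarrow> U \<subseteq> V \<Longrightarrow> \<phi> \<in> test_functions V"
  unfolding test_functions_iff by blast

lemma test_function_pderivs: "\<phi> \<in> test_functions U \<Longrightarrow> pderivs is \<phi> \<in> test_functions U"
  by (elim test_functionE, rule test_functionI)
     (auto simp: smooth_pderivs intro: pderivs_eq_0_outside compact_imp_closed)

lemma test_function_partial_deriv: "\<phi> \<in> test_functions U \<Longrightarrow> partial_deriv i \<phi> \<in> test_functions U"
  using test_function_pderivs[of \<phi> U "[i]"] by simp

lemma test_function_mult: "smooth f \<Longrightarrow> \<phi> \<in> test_functions U \<Longrightarrow> (\<lambda>x. f x * \<phi> x) \<in> test_functions U"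
  by (elim test_functionE, rule test_functionI) (auto simp: smooth_mult)

lemma test_function_cmult: "\<phi> \<in> test_functions U \<Longrightarrow> (\<lambda>x. c * \<phi> x) \<in> test_functions U"
  by (rule test_function_mult) auto

lemma test_function_mult_left: "\<phi> \<in> test_functions U \<Longrightarrow> smooth f \<Longrightarrow> (\<lambda>x. \<phi> x * f x) \<in> test_functions U"
  using test_function_mult[of f \<phi> U] by (simp add: mult.commute)

lemma test_function_add:
  assumes "\<phi> \<in> test_functions U" "\<psi> \<in> test_functions U"
  shows "(\<lambda>x. \<phi> x + \<psi> x) \<in> test_functions U"
proof -
  from assms(1) obtain K where K: "smooth \<phi>" "compact K" "K \<subseteq> U" "\<And>x. x \<notin> K \<Longrightarrow> \<phi> x = 0"
    by (rule test_functionE) (rule that)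
  from assms(2) obtain L where L: "smooth \<psi>" "compact L" "L \<subseteq> U" "\<And>x. x \<notin> L \<Longrightarrow> \<psi> x = 0"
    by (rule test_functionE) (rule that)
  show ?thesis
    by (rule test_functionI[of _ "K \<union> L"]) (use K L in \<open>auto simp: smooth_add compact_Un\<close>)
qed

lemma test_function_diff:
  "\<phi> \<in> test_functions U \<Longrightarrow> \<psi> \<in> test_functions U \<Longrightarrow> (\<lambda>x. \<phi> x - \<psi> x) \<in> test_functions U"
  using test_function_add[of \<phi> U "\<lambda>x. -1 * \<psi> x"] test_function_cmult[of \<psi> U "-1"] by simp

lemma test_function_zero [simp]: "(\<lambda>x. 0) \<in> test_functions U"
  by (rule test_functionI[of _ "{}"]) auto

definition thicken :: "'a::metric_space set \<Rightarrow> real \<Rightarrow> 'a set" where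
  "thicken K e = {y. \<exists>x\<in>K. dist x y \<le> e}"

lemma compact_thicken:
  fixes K :: "'a::euclidean_space set"
  assumes "compact K"
  shows "compact (thicken K e)"
proof -
  have "thicken K e = {x + y |x y. x \<in> K \<and> y \<in> cball 0 e}"
  proof (intro set_eqI iffI)
    fix z assume "z \<in> thicken K e"
    then obtain x where "x \<in> K" "dist x z \<le> e" by (auto simp: thicken_def)
    then show "z \<in> {x + y |x y. x \<in> K \<and> y \<in> cball 0 e}"
      unfolding mem_Collect_eq
      by (intro exI[of _ x] exI[of _ "z - x"]) (auto simp: dist_norm norm_minus_commute)
  next
    fix z assume "z \<in> {x + y |x y. x \<in> K \<and> y \<in> cball 0 e}"
    then obtain x y where "z = x + y" "x \<in> K" "norm y \<le> e" by auto
    then show "z \<in> thicken K e" by (auto simp: thicken_def dist_norm intro!: bexI[of _ x])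
  qed
  with compact_sums[OF assms compact_cball[of 0 e]] show ?thesis by (simp only:)
qed

lemma compact_support_integrable:
  fixes f :: "'a::euclidean_space \<Rightarrow> real"
  assumes "continuous_on UNIV f" "compact K" "\<And>x. x \<notin> K \<Longrightarrow> f x = 0"
  shows "integrable lborel f"
proof -
  have "integrable lborel (\<lambda>x. indicator K x *\<^sub>R f x)"
    by (rule borel_integrable_compact) (use assms in \<open>auto intro: continuous_on_subset\<close>)
  moreover have "(\<lambda>x. indicator K x *\<^sub>R f x) = f"
    using assms(3) by (auto simp: fun_eq_iff indicator_def)
  ultimately show ?thesis by simp
qed

lemma test_function_integrable: "\<phi> \<in> test_functions U \<Longrightarrow> integrable lborel \<phi>"
  by (elim test_functionE) (rule compact_support_integrable, auto simp: smooth_continuous_on)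

lemma test_function_bounded:
  assumes "\<phi> \<in> test_functions U"
  obtains B where "B > 0" "\<And>x. \<bar>\<phi> x\<bar> \<le> B"
proof -
  from assms obtain K where K: "smooth \<phi>" "compact K" "K \<subseteq> U" "\<And>x. x \<notin> K \<Longrightarrow> \<phi> x = 0"
    by (rule test_functionE) (rule that)
  have "bounded (\<phi> ` K)"
    by (intro compact_imp_bounded compact_continuous_image smooth_continuous_on K)
  then obtain B where "\<And>x. x \<in> K \<Longrightarrow> \<bar>\<phi> x\<bar> \<le> B" by (auto simp: bounded_iff)
  then have "\<bar>\<phi> x\<bar> \<le> max 1 B" for x using K(4)[of x] by (cases "x \<in> K") (auto simp: le_max_iff_disj)
  then show thesis using that[of "max 1 B"] by simp
qed

lemma onorm_gradient_le:
  fixes c :: "'n::finite \<Rightarrow> real"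
  assumes "\<And>i. \<bar>c i\<bar> \<le> B i"
  shows "onorm (\<lambda>h::real^'n. \<Sum>i\<in>UNIV. h $ i * c i) \<le> (\<Sum>i\<in>UNIV. B i)"
proof (rule onorm_le)
  fix h :: "real^'n"
  have "norm (\<Sum>i\<in>UNIV. h $ i * c i) \<le> (\<Sum>i\<in>UNIV. norm h * B i)"
    using assms component_le_norm_cart[of h]
    by (intro sum_norm_le) (auto simp: abs_mult intro!: mult_mono)
  then show "norm (\<Sum>i\<in>UNIV. h $ i * c i) \<le> (\<Sum>i\<in>UNIV. B i) * norm h"
    by (simp add: sum_distrib_left mult.commute)
qed

lemma test_function_Lipschitz:
  assumes "\<phi> \<in> test_functions U"
  obtains L where "L > 0" "\<And>x y. \<bar>\<phi> x - \<phi> y\<bar> \<le> L * norm (x - y)"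
proof -
  have "\<exists>B. \<forall>x. \<bar>partial_deriv i \<phi> x\<bar> \<le> B" for i
    using test_function_bounded[OF test_function_partial_deriv[OF assms]] by metis
  then obtain B where B: "\<And>i x. \<bar>partial_deriv i \<phi> x\<bar> \<le> B i" by metis
  have "\<bar>\<phi> x - \<phi> y\<bar> \<le> (\<Sum>i\<in>UNIV. B i) * norm (x - y)" for x y
  proof -
    have "norm (\<phi> x - \<phi> y) \<le> (\<Sum>i\<in>UNIV. B i) * norm (x - y)"
      by (rule differentiable_bound[of UNIV \<phi> "\<lambda>x h. \<Sum>i\<in>UNIV. h $ i * partial_deriv i \<phi> x"])
         (auto intro: onorm_gradient_le B smooth_has_derivative test_function_smooth[OF assms])
    then show ?thesis by simp
  qed
  moreover have "(\<Sum>i\<in>UNIV. B i) * norm (x - y) \<le> max 1 (\<Sum>i\<in>UNIV. B i) * norm (x - y)" for x y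
    by (intro mult_right_mono) auto
  ultimately have "\<bar>\<phi> x - \<phi> y\<bar> \<le> max 1 (\<Sum>i\<in>UNIV. B i) * norm (x - y)" for x y
    using order_trans by blast
  then show thesis by (rule that[rotated]) simp
qed

text \<open>
  The remainder is quadratic because the partial derivatives are Lipschitz. What matters is that
  \<open>C\<close> does not depend on the point: this permits integrating the expansion, both for
  integration by parts and for differentiation under the integral sign.
\<close>

lemma test_function_quadratic:
  assumes "\<phi> \<in> test_functions U"
  obtains C where "C > 0"
    "\<And>x h. \<bar>\<phi> (x + h) - \<phi> x - (\<Sum>i\<in>UNIV. h $ i * partial_deriv i \<phi> x)\<bar> \<le> C * (norm h)\<^sup>2"
proof -
  have "\<exists>L. \<forall>x y. \<bar>partial_deriv i \<phi> x - partial_deriv i \<phi> y\<bar> \<le> L * norm (x - y)" for i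
    using test_function_Lipschitz[OF test_function_partial_deriv[OF assms]] by metis
  then obtain L where L: "\<And>i x y. \<bar>partial_deriv i \<phi> x - partial_deriv i \<phi> y\<bar> \<le> L i * norm (x - y)"
    by metis
  have L0: "0 \<le> L i" for i
    using L[of i "axis i 1" 0] abs_ge_zero order_trans by (fastforce simp: norm_axis_1)
  have "\<bar>\<phi> (x + h) - \<phi> x - (\<Sum>i\<in>UNIV. h $ i * partial_deriv i \<phi> x)\<bar> \<le> (\<Sum>i\<in>UNIV. L i) * (norm h)\<^sup>2" for x h
  proof -
    have "norm (\<phi> (x + h) - \<phi> x - (\<Sum>i\<in>UNIV. (x + h - x) $ i * partial_deriv i \<phi> x))
       \<le> norm (x + h - x) * ((\<Sum>i\<in>UNIV. L i) * norm h)"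
    proof (rule differentiable_bound_linearization[where S = "closed_segment x (x + h)" and ?x0.0 = x
          and f' = "\<lambda>y v. \<Sum>i\<in>UNIV. v $ i * partial_deriv i \<phi> y"])
      fix y assume y: "y \<in> closed_segment x (x + h)"
      show "(\<phi> has_derivative (\<lambda>h. \<Sum>i\<in>UNIV. h $ i * partial_deriv i \<phi> y)) (at y within closed_segment x (x + h))"
        using smooth_has_derivative[OF test_function_smooth[OF assms]] has_derivative_at_withinI by blast
      have n: "norm (y - x) \<le> norm h" using y by (auto simp: in_segment algebra_simps mult_left_le_one_le)
      have "\<bar>partial_deriv i \<phi> y - partial_deriv i \<phi> x\<bar> \<le> L i * norm h" for i
        using L[of i y x] mult_left_mono[OF n L0[of i]] by linarith
      then have "onorm (\<lambda>v::real^'a. \<Sum>i\<in>UNIV. v $ i * (partial_deriv i \<phi> y - partial_deriv i \<phi> x))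
          \<le> (\<Sum>i\<in>UNIV. L i * norm h)"
        by (rule onorm_gradient_le)
      moreover have "(\<lambda>v. \<Sum>i\<in>UNIV. v $ i * partial_deriv i \<phi> y) - (\<lambda>v. \<Sum>i\<in>UNIV. v $ i * partial_deriv i \<phi> x)
          = (\<lambda>v. \<Sum>i\<in>UNIV. v $ i * (partial_deriv i \<phi> y - partial_deriv i \<phi> x))"
        by (simp add: fun_eq_iff right_diff_distrib sum_subtractf)
      ultimately show "onorm ((\<lambda>v. \<Sum>i\<in>UNIV. v $ i * partial_deriv i \<phi> y)
            - (\<lambda>v. \<Sum>i\<in>UNIV. v $ i * partial_deriv i \<phi> x)) \<le> (\<Sum>i\<in>UNIV. L i) * norm h"
        by (simp add: sum_distrib_right)
    next
      fix t :: real assume "t \<in> {0..1}"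
      then show "x + t *\<^sub>R (x + h - x) \<in> closed_segment x (x + h)"
        by (auto simp: in_segment algebra_simps intro!: exI[of _ t])
    qed simp
    then show ?thesis by (simp add: power2_eq_square algebra_simps)
  qed
  moreover have "(\<Sum>i\<in>UNIV. L i) * (norm h)\<^sup>2 \<le> max 1 (\<Sum>i\<in>UNIV. L i) * (norm h)\<^sup>2" for h :: "real^'n"
    by (intro mult_right_mono) auto
  ultimately have "\<bar>\<phi> (x + h) - \<phi> x - (\<Sum>i\<in>UNIV. h $ i * partial_deriv i \<phi> x)\<bar>
      \<le> max 1 (\<Sum>i\<in>UNIV. L i) * (norm h)\<^sup>2" for x h
    using order_trans by blast
  then show thesis by (rule that[rotated]) simp
qed

section \<open>Integration by parts\<close>

lemma lborel_eq_distr_affine: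
  fixes a :: "'a::euclidean_space"
  assumes "\<bar>s\<bar> = 1"
  shows "lborel = distr lborel borel (\<lambda>x::'a. a + s *\<^sub>R x)"
proof -
  have "s \<noteq> 0" using assms by auto
  from lborel_affine[OF this, of a] assms show ?thesis by (simp add: density_1)
qed

lemma lborel_affine_invariant:
  fixes f :: "'a::euclidean_space \<Rightarrow> real"
  assumes "\<bar>s\<bar> = 1" and [measurable]: "f \<in> borel_measurable borel"
  shows "(LBINT x. f (a + s *\<^sub>R x)) = (LBINT x. f x)"
    and "integrable lborel (\<lambda>x. f (a + s *\<^sub>R x)) \<longleftrightarrow> integrable lborel f"
proof -
  have "(LBINT x. f x) = (\<integral>x. f x \<partial>(distr lborel borel (\<lambda>x::'a. a + s *\<^sub>R x)))"
    using lborel_eq_distr_affine[OF assms(1), of a] by simp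
  then show "(LBINT x. f (a + s *\<^sub>R x)) = (LBINT x. f x)" by (simp add: integral_distr)
  have "integrable lborel f \<longleftrightarrow> integrable (distr lborel borel (\<lambda>x::'a. a + s *\<^sub>R x)) f"
    using lborel_eq_distr_affine[OF assms(1), of a] by simp
  then show "integrable lborel (\<lambda>x. f (a + s *\<^sub>R x)) \<longleftrightarrow> integrable lborel f"
    by (simp add: integrable_distr_eq)
qed

text \<open>
  By translation invariance the difference quotient of \<open>\<phi>\<close> in direction \<open>i\<close> with step \<open>t\<close> has
  integral 0. It differs from the partial derivative by at most a multiple of \<open>t\<close>, and only on a
  compact set that does not depend on \<open>t\<close>.
\<close>

lemma integral_partial_deriv_eq_0:
  assumes "\<phi> \<in> test_functions UNIV"
  shows "(LBINT x. partial_deriv i \<phi> x) = 0"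
proof -
  obtain C where C: "C > 0" "\<And>x h. \<bar>\<phi> (x + h) - \<phi> x - (\<Sum>i\<in>UNIV. h $ i * partial_deriv i \<phi> x)\<bar> \<le> C * (norm h)\<^sup>2"
    using test_function_quadratic[OF assms] by blast
  from assms obtain K where K: "smooth \<phi>" "compact K" "K \<subseteq> UNIV" "\<And>x. x \<notin> K \<Longrightarrow> \<phi> x = 0"
    by (rule test_functionE) (rule that)
  define K' where "K' = thicken K 1"
  have cK': "compact K'" unfolding K'_def by (rule compact_thicken[OF K(2)])
  have sub: "x + h \<in> K \<Longrightarrow> norm h \<le> 1 \<Longrightarrow> x \<in> K'" for x h
    unfolding K'_def thicken_def by (auto simp: dist_norm intro!: bexI[of _ "x + h"])
  have KK': "K \<subseteq> K'" using sub[of _ 0] by auto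
  have fin: "emeasure lborel K' < \<infinity>" using emeasure_compact_finite[OF cK'] by simp
  have [measurable]: "K' \<in> sets borel" using cK' by (rule borel_compact)
  have i0: "integrable lborel \<phi>" and i1: "integrable lborel (partial_deriv i \<phi>)"
    using assms test_function_integrable test_function_partial_deriv by blast+
  have [measurable]: "\<phi> \<in> borel_measurable borel" using K(1) by (rule smooth_borel_measurable)
  have *: "\<bar>LBINT x. partial_deriv i \<phi> x\<bar> \<le> t * (C * measure lborel K')" if t: "0 < t" "t \<le> 1" for t
  proof -
    define v where "v = t *\<^sub>R axis i (1::real)"
    have nv: "norm v = t" using t by (simp add: v_def norm_axis_1)
    have tr: "(LBINT x. \<phi> (x + v)) = (LBINT x. \<phi> x)" "integrable lborel (\<lambda>x. \<phi> (x + v))"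
      using lborel_affine_invariant[of 1 \<phi> v] i0 by (auto simp: add.commute)
    have sv: "(\<Sum>j\<in>UNIV. v $ j * partial_deriv j \<phi> x) = t * partial_deriv i \<phi> x" for x
    proof -
      have "(\<Sum>j\<in>UNIV. v $ j * partial_deriv j \<phi> x)
          = (\<Sum>j\<in>UNIV. if j = i then t * partial_deriv i \<phi> x else 0)"
        unfolding v_def by (intro sum.cong) (auto simp: axis_def)
      then show ?thesis by simp
    qed
    have b: "\<bar>\<phi> (x + v) - \<phi> x - t * partial_deriv i \<phi> x\<bar> \<le> C * t\<^sup>2 * indicator K' x" for x
    proof (cases "x \<in> K'")
      case True then show ?thesis using C(2)[of x v] by (simp add: sv nv)
    next
      case False
      then have "x \<notin> K" "x + v \<notin> K" using KK' sub[of x v] nv t by auto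
      then show ?thesis
        using K(4) pderivs_eq_0_outside[of K \<phi> x "[i]"] K(2) False by (simp add: compact_imp_closed)
    qed
    have "t * \<bar>LBINT x. partial_deriv i \<phi> x\<bar> = \<bar>LBINT x. \<phi> (x + v) - \<phi> x - t * partial_deriv i \<phi> x\<bar>"
      using i0 i1 tr t by (simp add: abs_mult)
    also have "\<dots> \<le> (LBINT x. \<bar>\<phi> (x + v) - \<phi> x - t * partial_deriv i \<phi> x\<bar>)"
      by (rule integral_abs_bound)
    also have "\<dots> \<le> (LBINT x. C * t\<^sup>2 * indicator K' x)"
      using i0 i1 tr fin b by (intro integral_mono) auto
    also have "\<dots> = C * t\<^sup>2 * measure lborel K'" by simp
    finally have "t * \<bar>LBINT x. partial_deriv i \<phi> x\<bar> \<le> t * (t * (C * measure lborel K'))"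
      by (simp add: power2_eq_square algebra_simps)
    with t show ?thesis by simp
  qed
  have "\<bar>LBINT x. partial_deriv i \<phi> x\<bar> \<le> 0 * (C * measure lborel K')"
  proof (rule tendsto_lowerbound)
    show "((\<lambda>t. t * (C * measure lborel K')) \<longlongrightarrow> 0 * (C * measure lborel K')) (at_right 0)"
      by (intro tendsto_intros)
    show "\<forall>\<^sub>F t in at_right 0. \<bar>LBINT x. partial_deriv i \<phi> x\<bar> \<le> t * (C * measure lborel K')"
      using * unfolding eventually_at_right_field by (intro exI[of _ 1]) auto
  qed simp
  then show ?thesis by simp
qed

lemma integral_by_parts_partial:
  assumes "smooth f" "\<phi> \<in> test_functions UNIV"
  shows "(LBINT x. partial_deriv i f x * \<phi> x) = - (LBINT x. f x * partial_deriv i \<phi> x)"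
proof -
  have i: "integrable lborel (\<lambda>x. partial_deriv i f x * \<phi> x)" "integrable lborel (\<lambda>x. f x * partial_deriv i \<phi> x)"
    using assms by (auto intro!: test_function_integrable test_function_mult test_function_partial_deriv smooth_partial_deriv)
  have "0 = (LBINT x. partial_deriv i (\<lambda>x. f x * \<phi> x) x)"
    using assms by (simp add: integral_partial_deriv_eq_0 test_function_mult)
  also have "\<dots> = (LBINT x. partial_deriv i f x * \<phi> x + f x * partial_deriv i \<phi> x)"
    using assms by (simp add: partial_deriv_mult_smooth test_function_smooth)
  finally show ?thesis using i by simp
qed

lemma integral_by_parts:
  assumes "smooth f" "\<phi> \<in> test_functions UNIV"
  shows "(LBINT x. pderivs is f x * \<phi> x) = (- 1) ^ length is * (LBINT x. f x * pderivs is \<phi> x)"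
  using assms
proof (induction "is" arbitrary: f \<phi>)
  case (Cons i "is")
  have "(LBINT x. pderivs (i # is) f x * \<phi> x) = - (LBINT x. pderivs is f x * partial_deriv i \<phi> x)"
    using integral_by_parts_partial[of "pderivs is f" \<phi> i] Cons.prems by (simp add: smooth_pderivs)
  also have "\<dots> = - ((- 1) ^ length is * (LBINT x. f x * pderivs is (partial_deriv i \<phi>) x))"
    using Cons by (simp add: test_function_partial_deriv)
  finally show ?case
    using Cons.prems(2) by (simp add: pderivs_partial_commute test_function_smooth)
qed simp

section \<open>Convolution with a test function\<close>

definition conv :: "(real ^ 'n \<Rightarrow> real) \<Rightarrow> (real ^ 'n \<Rightarrow> real) \<Rightarrow> real ^ 'n \<Rightarrow> real" where
  "conv k g x = (LBINT y. k (x - y) * g y)"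

lemma conv_integrable:
  assumes k: "k \<in> test_functions UNIV" and g: "integrable lborel g"
  shows "integrable lborel (\<lambda>y. k (x - y) * g y)"
proof -
  obtain B where B: "B > 0" "\<And>x. \<bar>k x\<bar> \<le> B" using test_function_bounded[OF k] by metis
  have [measurable]: "k \<in> borel_measurable borel" "g \<in> borel_measurable borel"
    using smooth_borel_measurable[OF test_function_smooth[OF k]] g by auto
  show ?thesis
    by (rule Bochner_Integration.integrable_bound[of _ "\<lambda>y. B * g y"])
       (use g B in \<open>auto simp: abs_mult intro!: mult_right_mono\<close>)
qed

text \<open>
  Differentiation under the integral sign. The quadratic remainder of \<open>k\<close> is uniform in the
  point, so it survives integration against \<open>g\<close>, of which only integrability is known.
\<close>

lemma conv_has_derivative:
  assumes k: "k \<in> test_functions UNIV" and g: "integrable lborel g"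
  shows "(conv k g has_derivative (\<lambda>h. \<Sum>i\<in>UNIV. h $ i * conv (partial_deriv i k) g x)) (at x)"
proof -
  obtain C where C: "C > 0" "\<And>x h. \<bar>k (x + h) - k x - (\<Sum>i\<in>UNIV. h $ i * partial_deriv i k x)\<bar> \<le> C * (norm h)\<^sup>2"
    using test_function_quadratic[OF k] by blast
  note ki = conv_integrable[OF k g] and pki = conv_integrable[OF test_function_partial_deriv[OF k] g]
  define J where "J = (LBINT y. \<bar>g y\<bar>)"
  have b: "\<bar>conv k g (x + h) - conv k g x - (\<Sum>i\<in>UNIV. h $ i * conv (partial_deriv i k) g x)\<bar> \<le> C * J * (norm h)\<^sup>2" for h
  proof -
    have pt: "k (x + h - y) * g y - k (x - y) * g y - (\<Sum>i\<in>UNIV. h $ i * (partial_deriv i k (x - y) * g y))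
        = (k (x - y + h) - k (x - y) - (\<Sum>i\<in>UNIV. h $ i * partial_deriv i k (x - y))) * g y" for y
      by (simp add: algebra_simps sum_distrib_left sum_distrib_right)
    have "conv k g (x + h) - conv k g x - (\<Sum>i\<in>UNIV. h $ i * conv (partial_deriv i k) g x)
       = (LBINT y. k (x + h - y) * g y - k (x - y) * g y - (\<Sum>i\<in>UNIV. h $ i * (partial_deriv i k (x - y) * g y)))"
      unfolding conv_def by (simp add: ki pki Bochner_Integration.integral_sum)
    also have "\<bar>\<dots>\<bar> \<le> (LBINT y. C * (norm h)\<^sup>2 * \<bar>g y\<bar>)"
    proof (rule order_trans[OF integral_abs_bound integral_mono])
      show "integrable lborel (\<lambda>y. \<bar>k (x + h - y) * g y - k (x - y) * g y - (\<Sum>i\<in>UNIV. h $ i * (partial_deriv i k (x - y) * g y))\<bar>)"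
        by (intro integrable_abs Bochner_Integration.integrable_diff Bochner_Integration.integrable_sum integrable_mult_right ki pki)
      show "\<bar>k (x + h - y) * g y - k (x - y) * g y - (\<Sum>i\<in>UNIV. h $ i * (partial_deriv i k (x - y) * g y))\<bar>
         \<le> C * (norm h)\<^sup>2 * \<bar>g y\<bar>" for y
        unfolding pt abs_mult by (intro mult_right_mono C) auto
    qed (use g in auto)
    finally show ?thesis by (simp add: J_def mult_ac)
  qed
  show ?thesis
  proof (rule has_derivativeI_sandwich[of 1])
    show "bounded_linear (\<lambda>h. \<Sum>i\<in>UNIV. h $ i * conv (partial_deriv i k) g x)"
      by (intro bounded_linear_intros bounded_linear_vec_nth)
    show "norm (conv k g y - conv k g x - (\<Sum>i\<in>UNIV. (y - x) $ i * conv (partial_deriv i k) g x)) / norm (y - x)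
        \<le> C * J * norm (y - x)" if "y \<noteq> x" for y
      using b[of "y - x"] that by (simp add: divide_le_eq power2_eq_square mult_ac)
    show "((\<lambda>y. C * J * norm (y - x)) \<longlongrightarrow> 0) (at x)"
      by (rule tendsto_eq_intros refl | simp)+
  qed auto
qed

lemma pderivs_conv:
  assumes "k \<in> test_functions UNIV" "integrable lborel g"
  shows "pderivs is (conv k g) = conv (pderivs is k) g"
proof (induction "is")
  case (Cons i "is")
  have "partial_deriv i (conv (pderivs is k) g) = conv (partial_deriv i (pderivs is k)) g"
  proof
    fix x
    show "partial_deriv i (conv (pderivs is k) g) x = conv (partial_deriv i (pderivs is k)) g x"
      using partial_deriv_eqI[OF conv_has_derivative[OF test_function_pderivs[OF assms(1)] assms(2)], of i "is" x]
      by (simp add: axis_def if_distrib[of "\<lambda>c. c * _"] cong: if_cong)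
  qed
  with Cons show ?case by simp
qed simp

lemma smooth_conv:
  "k \<in> test_functions UNIV \<Longrightarrow> integrable lborel g \<Longrightarrow> smooth (conv k g)"
  unfolding smooth_iff pderivs_conv
  by (meson Derivative.differentiableI conv_has_derivative test_function_pderivs)

lemma conv_commute:
  assumes "k \<in> borel_measurable borel" "g \<in> borel_measurable borel"
  shows "conv k g = conv g k"
proof
  fix x
  have "(LBINT y. k (x - y) * g y) = (LBINT y. k (x - (x + (-1) *\<^sub>R y)) * g (x + (-1) *\<^sub>R y))"
    by (rule lborel_affine_invariant(1)[symmetric]) (use assms in auto)
  then show "conv k g x = conv g k x" by (simp add: conv_def mult.commute)
qed

lemma conv_pair_integrable:
  assumes k: "k \<in> test_functions UNIV" and g: "integrable lborel g" and h: "integrable lborel h"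
  shows "integrable (lborel \<Otimes>\<^sub>M lborel) (\<lambda>(x, y). k (x - y) * g y * h x)"
proof -
  obtain B where B: "B > 0" "\<And>x. \<bar>k x\<bar> \<le> B" using test_function_bounded[OF k] by metis
  have [measurable]: "k \<in> borel_measurable borel" "g \<in> borel_measurable borel" "h \<in> borel_measurable borel"
    using smooth_borel_measurable[OF test_function_smooth[OF k]] g h by auto
  have "integrable (lborel \<Otimes>\<^sub>M lborel) (\<lambda>(x, y). B * (g y * h x))"
  proof (rule lborel_pair.Fubini_integrable)
    show "(\<lambda>(x, y). B * (g y * h x)) \<in> borel_measurable (lborel \<Otimes>\<^sub>M lborel)"
      by measurable
    show "integrable lborel (\<lambda>x. LBINT y. norm (case (x, y) of (x, y) \<Rightarrow> B * (g y * h x)))"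
      using g h by (simp add: abs_mult)
    show "AE x in lborel. integrable lborel (\<lambda>y. case (x, y) of (x, y) \<Rightarrow> B * (g y * h x))"
      using g h by simp
  qed
  then show ?thesis
    by (rule Bochner_Integration.integrable_bound)
       (use B in \<open>auto simp: abs_mult mult.assoc intro!: AE_I2 mult_right_mono\<close>)
qed

text \<open>
  The adjoint of the convolution with \<open>k\<close> is the convolution with the reflected kernel.
\<close>

lemma conv_Fubini:
  assumes k: "k \<in> test_functions UNIV" and g: "integrable lborel g" and h: "integrable lborel h"
  shows "(LBINT x. conv k g x * h x) = (LBINT y. g y * conv (\<lambda>z. k (- z)) h y)"
    and "integrable lborel (\<lambda>x. conv k g x * h x)"
proof -
  note i = conv_pair_integrable[OF assms]
  have "(LBINT x. conv k g x * h x) = (LBINT x. LBINT y. k (x - y) * g y * h x)"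
    unfolding conv_def by simp
  also have "\<dots> = (LBINT y. LBINT x. k (x - y) * g y * h x)"
    using lborel_pair.Fubini_integral[OF i] by simp
  also have "\<dots> = (LBINT y. g y * conv (\<lambda>z. k (- z)) h y)"
    unfolding conv_def by (intro Bochner_Integration.integral_cong)
      (simp_all add: mult.assoc mult.left_commute[of "k _"])
  finally show "(LBINT x. conv k g x * h x) = (LBINT y. g y * conv (\<lambda>z. k (- z)) h y)" .
  show "integrable lborel (\<lambda>x. conv k g x * h x)"
    using lborel_pair.integrable_fst[OF i] unfolding conv_def by simp
qed

section \<open>Mollifiers and cutoff functions\<close>

text \<open>
  The functions \<open>exp (-1/t) / t^k\<close>, extended by 0. All negative powers are included to have a family
  whose span is closed under differentiation (\<open>flat_exp_deriv\<close>).
\<close>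

definition flat_exp :: "nat \<Rightarrow> real \<Rightarrow> real" where
  "flat_exp k t = (if t > 0 then exp (- (1 / t)) / t ^ k else 0)"

text \<open>
  A single term of the exponential series, that of order \<open>k + 2\<close>, already beats the negative power.
  The bound yields differentiability at 0, with derivative 0.
\<close>

lemma flat_exp_quadratic: "\<bar>flat_exp k t\<bar> \<le> fact (k + 2) * t\<^sup>2"
proof (cases "t > 0")
  case True
  have "(\<Sum>n\<in>{k + 2}. (1 / t) ^ n /\<^sub>R fact n) \<le> (\<Sum>n. (1 / t) ^ n /\<^sub>R fact n)"
    using True by (intro sum_le_suminf summable_exp_generic) auto
  then have "(1 / t) ^ (k + 2) / fact (k + 2) \<le> exp (1 / t)"
    by (simp add: exp_def divide_inverse mult.commute)
  moreover define c :: real where "c = fact (k + 2)"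
  ultimately have "(1 / t) ^ (k + 2) / c \<le> exp (1 / t)" "c > 0" by simp_all
  then have "1 / t ^ k \<le> c * t\<^sup>2 * exp (1 / t)"
    using True by (simp add: power_divide power_add field_simps power2_eq_square)
  with True show ?thesis unfolding c_def[symmetric]
    by (simp add: flat_exp_def exp_minus field_simps)
qed (simp add: flat_exp_def)

lemma flat_exp_deriv:
  "(flat_exp k has_real_derivative (flat_exp (k + 2) t - real k * flat_exp (k + 1) t)) (at t)"
proof -
  consider "t < 0" | "t = 0" | "t > 0" by linarith
  then show ?thesis
  proof cases
    case 1
    have "(flat_exp k has_real_derivative 0) (at t)"
      by (rule has_field_derivative_transform_within_open[of "\<lambda>_. 0" _ _ "{..<0}"])
         (use 1 in \<open>auto simp: flat_exp_def\<close>)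
    with 1 show ?thesis by (simp add: flat_exp_def)
  next
    case 2
    have "((\<lambda>h. (flat_exp k (0 + h) - flat_exp k 0) / h) \<longlongrightarrow> 0) (at 0)"
    proof (rule Lim_null_comparison)
      show "\<forall>\<^sub>F h in at 0. norm ((flat_exp k (0 + h) - flat_exp k 0) / h) \<le> fact (k + 2) * \<bar>h\<bar>"
      proof (rule always_eventually, rule allI)
        fix h :: real
        show "norm ((flat_exp k (0 + h) - flat_exp k 0) / h) \<le> fact (k + 2) * \<bar>h\<bar>"
          using flat_exp_quadratic[of k h]
          by (cases "h = 0") (auto simp: flat_exp_def[of _ 0] divide_le_eq power2_eq_square mult.assoc abs_mult_self_eq)
      qed
      show "((\<lambda>h. fact (k + 2) * \<bar>h\<bar>) \<longlongrightarrow> 0) (at (0::real))"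
        by (rule tendsto_eq_intros refl | simp)+
    qed
    then have "(flat_exp k has_real_derivative 0) (at 0)"
      by (simp add: DERIV_def)
    with 2 show ?thesis by (simp add: flat_exp_def)
  next
    case 3
    have "((\<lambda>t. exp (- (1 / t)) / t ^ k) has_real_derivative
         (flat_exp (k + 2) t - real k * flat_exp (k + 1) t)) (at t)"
    proof -
      have "real k * t ^ (k - Suc 0) = real k * t ^ k / t" using 3 by (cases k) auto
      then have d1: "((\<lambda>t. t ^ k) has_real_derivative (real k * t ^ k / t)) (at t)"
        using DERIV_pow[of k t] by simp
      have d2: "((\<lambda>t. exp (- (1 / t))) has_real_derivative (exp (- (1 / t)) / t\<^sup>2)) (at t)"
        using 3 by (auto intro!: derivative_eq_intros simp: power2_eq_square)
      show ?thesis
        by (rule DERIV_cong[OF DERIV_divide[OF d2 d1]])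
           (use 3 in \<open>auto simp: flat_exp_def field_simps power2_eq_square\<close>)
    qed
    then show ?thesis
      by (rule has_field_derivative_transform_within_open[of _ _ _ "{0<..}"])
         (use 3 in \<open>auto simp: flat_exp_def\<close>)
  qed
qed

text \<open>
  The derivatives of these functions are polynomials in the coordinates times functions of the
  same kind, so they belong to the algebra that is generated by both.
\<close>

lemma smooth_flat_exp_norm: "smooth (\<lambda>x::real^'n. flat_exp k (1 - x \<bullet> x))"
proof -
  define S :: "(real^'n \<Rightarrow> real) set"
    where "S = range (\<lambda>k x. flat_exp k (1 - x \<bullet> x)) \<union> range (\<lambda>i x. x $ i)"
  have d: "((\<lambda>x::real^'n. flat_exp k (1 - x \<bullet> x)) has_derivative
      (\<lambda>h. (flat_exp (k + 2) (1 - x \<bullet> x) - real k * flat_exp (k + 1) (1 - x \<bullet> x)) * (- (x \<bullet> h + h \<bullet> x)))) (at x)" for k x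
  proof -
    have "((\<lambda>x::real^'n. 1 - x \<bullet> x) has_derivative (\<lambda>h. - (x \<bullet> h + h \<bullet> x))) (at x)"
      by (auto intro!: derivative_eq_intros)
    from diff_chain_at[OF this flat_exp_deriv[unfolded has_field_derivative_def, of k "1 - x \<bullet> x"]]
    show ?thesis by (simp add: o_def)
  qed
  have "partial_deriv i (\<lambda>x::real^'n. flat_exp k (1 - x \<bullet> x))
     = (\<lambda>x. (flat_exp (k + 2) (1 - x \<bullet> x) + (- real k) * flat_exp (k + 1) (1 - x \<bullet> x)) * ((-2) * x $ i))" for i k
    using partial_deriv_eqI[OF d] by (simp add: fun_eq_iff inner_axis inner_axis' algebra_simps)
  moreover have "(\<lambda>x. (flat_exp (k + 2) (1 - x \<bullet> x) + (- real k) * flat_exp (k + 1) (1 - x \<bullet> x)) * ((-2) * x $ i))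
      \<in> smooth_algebra S" for k i
    by (intro smooth_algebra.intros) (auto simp: S_def intro: smooth_algebra.base)
  ultimately have p: "partial_deriv i f \<in> smooth_algebra S" if "f \<in> S" for f i
    using that by (auto simp: S_def smooth_algebra.const)
  have dd: "f differentiable (at x)" if "f \<in> S" for f x
    using that d unfolding S_def
    by (auto simp: differentiable_def intro: bounded_linear_imp_has_derivative[OF bounded_linear_vec_nth])
  have "(\<lambda>x::real^'n. flat_exp k (1 - x \<bullet> x)) \<in> smooth_algebra S"
    by (rule smooth_algebra.base) (auto simp: S_def)
  then show ?thesis by (rule smooth_algebra_smooth[OF _ dd p])
qed

text \<open>
  Evenness is required to make convolution with \<open>\<rho>\<close> self-adjoint.
\<close>

definition mollifier :: "real \<Rightarrow> (real ^ 'n \<Rightarrow> real) \<Rightarrow> bool" where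
  "mollifier \<epsilon> \<rho> \<longleftrightarrow> \<rho> \<in> test_functions UNIV \<and> (\<forall>x. 0 \<le> \<rho> x) \<and> (\<forall>x. \<rho> (- x) = \<rho> x) \<and>
     (\<forall>x. \<epsilon> \<le> norm x \<longrightarrow> \<rho> x = 0) \<and> (LBINT x. \<rho> x) = 1"

lemma mollifier_exists:
  assumes "\<epsilon> > 0"
  obtains \<rho> :: "real ^ 'n \<Rightarrow> real" where "mollifier \<epsilon> \<rho>"
proof -
  define b where "b = (\<lambda>x::real^'n. flat_exp 0 (1 - ((1 / \<epsilon>) *\<^sub>R x) \<bullet> ((1 / \<epsilon>) *\<^sub>R x)))"
  have b_eq: "b x = flat_exp 0 (1 - (norm x / \<epsilon>)\<^sup>2)" for x
    by (simp add: b_def power2_norm_eq_inner[symmetric] power_divide power2_eq_square)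
  have sb: "smooth b"
    using smooth_affine(1)[OF smooth_flat_exp_norm[of 0], of 0 "1 / \<epsilon>"] by (simp add: b_def)
  have z: "b x = 0" if "\<epsilon> \<le> norm x" for x
  proof -
    have "1 \<le> (norm x / \<epsilon>)\<^sup>2" using that assms by (intro one_le_power) simp
    then show ?thesis by (simp add: b_eq flat_exp_def)
  qed
  have tb: "b \<in> test_functions UNIV"
    by (rule test_functionI[OF sb compact_cball[of 0 \<epsilon>]]) (auto intro: z)
  have nn: "0 \<le> b x" for x by (simp add: b_eq flat_exp_def)
  have pos: "b x > 0" if "x \<in> ball 0 \<epsilon>" for x
    using that assms by (simp add: b_eq flat_exp_def power_less_one_iff abs_square_less_1)
  have "(LBINT x. b x) \<noteq> 0"
  proof
    assume "(LBINT x. b x) = 0"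
    then have "AE x in lborel. b x = 0"
      using integral_nonneg_eq_0_iff_AE[OF test_function_integrable[OF tb]] nn by simp
    then have "AE x in lborel. x \<notin> ball (0::real^'n) \<epsilon>"
      by eventually_elim (use pos in force)
    then have "emeasure lborel (ball (0::real^'n) \<epsilon>) = 0"
      using AE_iff_measurable[of "ball (0::real^'n) \<epsilon>" lborel "\<lambda>x. x \<notin> ball 0 \<epsilon>"] by (simp add: ball_def)
    moreover have "emeasure lborel (ball (0::real^'n) \<epsilon>) > 0"
      using assms emeasure_ball[of \<epsilon> "0::real^'n"] by (simp add: ennreal_zero_less_mult_iff)
    ultimately show False by simp
  qed
  moreover have "(LBINT x. b x) \<ge> 0" using nn by simp
  ultimately have I: "(LBINT x. b x) > 0" by simp
  define \<rho> where "\<rho> = (\<lambda>x. (1 / (LBINT x. b x)) * b x)"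
  have "mollifier \<epsilon> \<rho>"
    unfolding mollifier_def
  proof (intro conjI allI impI)
    show "\<rho> \<in> test_functions UNIV" unfolding \<rho>_def by (rule test_function_cmult[OF tb])
    show "\<rho> (- x) = \<rho> x" for x by (simp add: \<rho>_def b_eq)
  qed (use nn z I in \<open>simp_all add: \<rho>_def\<close>)
  then show thesis by (rule that)
qed

lemma mollifier_test: "mollifier \<epsilon> \<rho> \<Longrightarrow> \<rho> \<in> test_functions UNIV"
  and mollifier_nonneg: "mollifier \<epsilon> \<rho> \<Longrightarrow> 0 \<le> \<rho> x"
  by (simp_all add: mollifier_def)

lemma mollifier_translate:
  assumes "mollifier \<epsilon> \<rho>" "\<bar>s\<bar> = 1"
  shows "(LBINT y. \<rho> (x + s *\<^sub>R y)) = 1" "integrable lborel (\<lambda>y. \<rho> (x + s *\<^sub>R y))"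
  using lborel_affine_invariant[of s \<rho> x] assms test_function_integrable[OF mollifier_test[OF assms(1)]]
  by (auto simp: mollifier_def)

lemmas mollifier_reflect = mollifier_translate[of _ _ "-1", simplified]
lemmas mollifier_shift = mollifier_translate[of _ _ 1 "- y" for y, simplified]

lemma mollifier_support: "mollifier \<epsilon> \<rho> \<Longrightarrow> \<rho> (x - y) \<noteq> 0 \<Longrightarrow> dist x y < \<epsilon>"
  unfolding mollifier_def dist_norm by (meson not_le)

lemma mollifier_conv_Lipschitz:
  assumes m: "mollifier \<epsilon> \<rho>" and g: "integrable lborel g" and e: "0 \<le> \<epsilon>" "0 \<le> L"
    and L: "\<And>x y. \<bar>g x - g y\<bar> \<le> L * norm (x - y)"
  shows "\<bar>conv \<rho> g x - g x\<bar> \<le> L * \<epsilon>"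
proof -
  note t = mollifier_test[OF m] and nn = mollifier_nonneg[OF m]
  note J = mollifier_reflect[OF m, of x]
  note ci = conv_integrable[OF t g, of x]
  have "conv \<rho> g x - g x = (LBINT y. \<rho> (x - y) * g y - \<rho> (x - y) * g x)"
    unfolding conv_def using ci J by simp
  also have "\<bar>\<dots>\<bar> \<le> (LBINT y. \<rho> (x - y) * (L * \<epsilon>))"
  proof (rule order_trans[OF integral_abs_bound integral_mono])
    show "\<bar>\<rho> (x - y) * g y - \<rho> (x - y) * g x\<bar> \<le> \<rho> (x - y) * (L * \<epsilon>)" for y
    proof (cases "\<rho> (x - y) = 0")
      case False
      then have "norm (y - x) \<le> \<epsilon>" using mollifier_support[OF m] by (force simp: dist_norm norm_minus_commute)
      then have "\<bar>g y - g x\<bar> \<le> L * \<epsilon>" using L[of y x] mult_left_mono[of "norm (y - x)" \<epsilon> L] e by linarith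
      then show ?thesis
        unfolding right_diff_distrib[symmetric] abs_mult using nn by (simp add: mult_left_mono)
    qed simp
  qed (use ci J in \<open>auto intro!: integrable_abs Bochner_Integration.integrable_diff\<close>)
  also have "\<dots> = L * \<epsilon>" using J by simp
  finally show ?thesis .
qed

text \<open>
  Jensen's inequality for the probability density \<open>\<rho> (x - y)\<close>: with \<open>c\<close> the mean of \<open>g\<close>, expand
  the nonnegative integral of \<open>\<rho> (x - y) * (g y - c)\<^sup>2\<close>.
\<close>

lemma mollifier_conv_square_le:
  assumes m: "mollifier \<epsilon> \<rho>" and g: "integrable lborel g" and g2: "integrable lborel (\<lambda>x. (g x)\<^sup>2)"
  shows "(conv \<rho> g x)\<^sup>2 \<le> conv \<rho> (\<lambda>y. (g y)\<^sup>2) x"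
proof -
  note t = mollifier_test[OF m] and nn = mollifier_nonneg[OF m]
  note J = mollifier_reflect[OF m, of x]
  define c where "c = conv \<rho> g x"
  note ci = conv_integrable[OF t g, of x] conv_integrable[OF t g2, of x]
  have "0 \<le> (LBINT y. \<rho> (x - y) * (g y - c)\<^sup>2)" using nn by simp
  also have "\<dots> = (LBINT y. \<rho> (x - y) * (g y)\<^sup>2 - 2 * c * (\<rho> (x - y) * g y) + c\<^sup>2 * \<rho> (x - y))"
    by (intro Bochner_Integration.integral_cong) (auto simp: power2_eq_square algebra_simps)
  also have "\<dots> = conv \<rho> (\<lambda>y. (g y)\<^sup>2) x - 2 * c * c + c\<^sup>2"
    using ci J by (simp add: conv_def c_def)
  finally show ?thesis by (simp add: c_def power2_eq_square)
qed

text \<open>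
  Integrating Jensen's inequality shows that mollification contracts the square norm. The bound
  is uniform in \<open>\<epsilon>\<close>, so that estimates for mollified solutions persist as the scale tends to 0.
\<close>

lemma mollifier_conv_L2:
  assumes m: "mollifier \<epsilon> \<rho>" and g: "integrable lborel g" and g2: "integrable lborel (\<lambda>x. (g x)\<^sup>2)"
  shows "integrable lborel (\<lambda>x. (conv \<rho> g x)\<^sup>2)"
    and "(LBINT x. (conv \<rho> g x)\<^sup>2) \<le> (LBINT x. (g x)\<^sup>2)"
proof -
  note t = mollifier_test[OF m] and nn = mollifier_nonneg[OF m]
  have [measurable]: "\<rho> \<in> borel_measurable borel" "g \<in> borel_measurable borel" "conv \<rho> g \<in> borel_measurable borel"
    using t g by (auto simp: smooth_borel_measurable test_function_smooth smooth_conv)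
  have "integrable (lborel \<Otimes>\<^sub>M lborel) (\<lambda>(y, x). \<rho> (x - y) * (g y)\<^sup>2)"
  proof (rule lborel_pair.Fubini_integrable)
    show "integrable lborel (\<lambda>y. LBINT x. norm (case (y, x) of (y, x) \<Rightarrow> \<rho> (x - y) * (g y)\<^sup>2))"
      and "AE y in lborel. integrable lborel (\<lambda>x. case (y, x) of (y, x) \<Rightarrow> \<rho> (x - y) * (g y)\<^sup>2)"
      using g2 nn mollifier_shift[OF m] by (auto simp: abs_mult)
  qed measurable
  then have i: "integrable (lborel \<Otimes>\<^sub>M lborel) (\<lambda>(x, y). \<rho> (x - y) * (g y)\<^sup>2)"
    using lborel_pair.integrable_product_swap[of "\<lambda>(y, x). \<rho> (x - y) * (g y)\<^sup>2"] by simp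
  then have ic: "integrable lborel (conv \<rho> (\<lambda>y. (g y)\<^sup>2))"
    using lborel_pair.integrable_fst[OF i] unfolding conv_def[abs_def] by simp
  have "(LBINT x. conv \<rho> (\<lambda>y. (g y)\<^sup>2) x) = (LBINT y. LBINT x. \<rho> (x - y) * (g y)\<^sup>2)"
    using lborel_pair.Fubini_integral[OF i] unfolding conv_def by simp
  also have "\<dots> = (LBINT y. (g y)\<^sup>2)"
    using mollifier_shift(1)[OF m] by simp
  finally have e: "(LBINT x. conv \<rho> (\<lambda>y. (g y)\<^sup>2) x) = (LBINT y. (g y)\<^sup>2)" .
  note le = mollifier_conv_square_le[OF m g g2]
  show *: "integrable lborel (\<lambda>x. (conv \<rho> g x)\<^sup>2)"
  proof (rule Bochner_Integration.integrable_bound[OF ic])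
    show "AE x in lborel. norm ((conv \<rho> g x)\<^sup>2) \<le> norm (conv \<rho> (\<lambda>y. (g y)\<^sup>2) x)"
      using le by (intro AE_I2) (smt (verit) real_norm_def zero_le_power2)
  qed measurable
  show "(LBINT x. (conv \<rho> g x)\<^sup>2) \<le> (LBINT x. (g x)\<^sup>2)"
    unfolding e[symmetric] by (rule integral_mono[OF * ic le])
qed

lemma mollifier_conv_test_function:
  assumes m: "mollifier \<epsilon> \<rho>" and \<psi>: "\<psi> \<in> test_functions U" and e: "\<epsilon> > 0"
    and sub: "\<And>x y. x \<in> U \<Longrightarrow> dist x y \<le> \<epsilon> \<Longrightarrow> y \<in> V"
  shows "conv \<rho> \<psi> \<in> test_functions V"
proof -
  from \<psi> obtain K where K: "smooth \<psi>" "compact K" "K \<subseteq> U" "\<And>x. x \<notin> K \<Longrightarrow> \<psi> x = 0"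
    by (rule test_functionE) (rule that)
  define L where "L = thicken K \<epsilon>"
  show ?thesis
  proof (rule test_functionI)
    show "smooth (conv \<rho> \<psi>)"
      using m \<psi> by (auto simp: mollifier_def intro: smooth_conv test_function_integrable)
    show "compact L" unfolding L_def by (rule compact_thicken[OF K(2)])
    show "L \<subseteq> V" using sub K(3) by (auto simp: L_def thicken_def)
    show "conv \<rho> \<psi> x = 0" if "x \<notin> L" for x
    proof -
      have "\<rho> (x - y) * \<psi> y = 0" for y
      proof (rule ccontr)
        assume a: "\<rho> (x - y) * \<psi> y \<noteq> 0"
        then have "y \<in> K" "dist y x \<le> \<epsilon>"
          using K(4) mollifier_support[OF m, of x y] by (auto simp: dist_commute)
        with that show False by (auto simp: L_def thicken_def)
      qed
      then show ?thesis unfolding conv_def by (simp only: Bochner_Integration.integral_zero)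
    qed
  qed
qed

text \<open>
  Mollify the indicator function of a closed neighbourhood of \<open>K\<close>, with a radius and at a scale for
  which the support stays in \<open>V\<close>.
\<close>

lemma cutoff_exists:
  fixes K V :: "(real ^ 'n) set"
  assumes "compact K" "open V" "K \<subseteq> V"
  obtains \<eta> where "\<eta> \<in> test_functions V" "\<And>x. x \<in> K \<Longrightarrow> \<eta> x = 1" "\<And>x. 0 \<le> \<eta> x" "\<And>x. \<eta> x \<le> 1"
proof -
  obtain d where d: "d > 0" "(\<Union>x\<in>K. cball x d) \<subseteq> V"
    using compact_subset_open_imp_cball_epsilon_subset[OF assms] by blast
  define \<epsilon> where "\<epsilon> = d / 2"
  have e: "\<epsilon> > 0" using d by (simp add: \<epsilon>_def)
  obtain \<rho> :: "real ^ 'n \<Rightarrow> real" where m: "mollifier \<epsilon> \<rho>" using mollifier_exists[OF e] .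
  note t = mollifier_test[OF m] and nn = mollifier_nonneg[OF m]
  define S where "S = thicken K \<epsilon>"
  define L where "L = thicken K d"
  have cS: "compact S" and cL: "compact L" unfolding S_def L_def by (rule compact_thicken[OF assms(1)])+
  have inS: "y \<in> S" if "x \<in> K" "dist x y \<le> \<epsilon>" for x y
    using that by (auto simp: S_def thicken_def)
  have [measurable]: "S \<in> sets borel" using cS by (rule borel_compact)
  have "emeasure lborel S < \<infinity>" using emeasure_compact_finite[OF cS] by simp
  then have g: "integrable lborel (indicator S :: real^'n \<Rightarrow> real)" by simp
  note J = mollifier_reflect[OF m]
  show thesis
  proof (rule that[of "conv \<rho> (indicator S)"])
    show "conv \<rho> (indicator S) x = 1" if "x \<in> K" for x
    proof -
      have "\<rho> (x - y) * indicator S y = \<rho> (x - y)" for y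
        using inS[OF that, of y] mollifier_support[OF m, of x y] by (cases "\<rho> (x - y) = 0") auto
      then show ?thesis unfolding conv_def by (simp only: J)
    qed
    show "0 \<le> conv \<rho> (indicator S) x" for x unfolding conv_def using nn by simp
    show "conv \<rho> (indicator S) x \<le> 1" for x
      unfolding conv_def J(1)[of x, symmetric]
      by (rule integral_mono[OF conv_integrable[OF t g] J(2)]) (use nn in \<open>auto simp: indicator_def\<close>)
    show "conv \<rho> (indicator S) \<in> test_functions V"
    proof (rule test_functionI[OF smooth_conv[OF t g] cL])
      show "L \<subseteq> V" using d(2) by (simp add: L_def thicken_def UN_subset_iff cball_def subset_iff)
      show "conv \<rho> (indicator S) x = 0" if "x \<notin> L" for x
      proof -
        have "\<rho> (x - y) * indicator S y = 0" for y
        proof (rule ccontr)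
          assume a: "\<rho> (x - y) * indicator S y \<noteq> 0"
          then have "y \<in> S" and xy: "dist x y \<le> \<epsilon>"
            using mollifier_support[OF m, of x y] by (auto simp: indicator_def split: if_splits)
          then obtain p where p: "p \<in> K" "dist p y \<le> \<epsilon>" by (auto simp: S_def thicken_def)
          have "dist p x \<le> d"
            using dist_triangle2[of p x y] p(2) xy by (simp add: \<epsilon>_def)
          with p have "x \<in> L" by (auto simp: L_def thicken_def)
          with that show False by simp
        qed
        then show ?thesis unfolding conv_def by (simp only: Bochner_Integration.integral_zero)
      qed
    qed
  qed
qed

section \<open>The Cauchy-Schwarz inequality\<close>

lemma integrable_product_of_squares:
  fixes f g :: "'a \<Rightarrow> real"
  assumes [measurable]: "f \<in> borel_measurable M" "g \<in> borel_measurable M"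
    and "integrable M (\<lambda>x. (f x)\<^sup>2)" "integrable M (\<lambda>x. (g x)\<^sup>2)"
  shows "integrable M (\<lambda>x. f x * g x)"
proof (rule Bochner_Integration.integrable_bound)
  show "integrable M (\<lambda>x. (f x)\<^sup>2 + (g x)\<^sup>2)" using assms by simp
  show "AE x in M. norm (f x * g x) \<le> norm ((f x)\<^sup>2 + (g x)\<^sup>2)"
  proof (rule AE_I2)
    fix x
    have "2 * \<bar>f x * g x\<bar> \<le> (f x)\<^sup>2 + (g x)\<^sup>2"
      using sum_squares_bound[of "\<bar>f x\<bar>" "\<bar>g x\<bar>"] by (simp add: abs_mult)
    moreover have "0 \<le> \<bar>f x * g x\<bar>" by simp
    ultimately show "norm (f x * g x) \<le> norm ((f x)\<^sup>2 + (g x)\<^sup>2)"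
      unfolding real_norm_def by linarith
  qed
qed measurable

lemma nonneg_quadratic_discriminant:
  fixes A B I :: real
  assumes q: "\<And>t. 0 \<le> A + 2 * t * I + t\<^sup>2 * B" and B0: "0 \<le> B"
  shows "I\<^sup>2 \<le> A * B"
proof (cases "B = 0")
  case True
  have "I = 0"
  proof (rule ccontr)
    assume "I \<noteq> 0"
    then have "2 * (- (A + 1) / (2 * I)) * I = - (A + 1)" by simp
    with q[of "- (A + 1) / (2 * I)"] True show False by simp
  qed
  with True show ?thesis by simp
next
  case False
  then have "0 \<le> B * (A + 2 * (- I / B) * I + (- I / B)\<^sup>2 * B)"
    using q[of "- I / B"] B0 by (intro mult_nonneg_nonneg) auto
  also have "\<dots> = A * B - I\<^sup>2" using False by (simp add: field_simps power2_eq_square)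
  finally show ?thesis by simp
qed

lemma integral_Cauchy_Schwarz:
  fixes f g :: "'a \<Rightarrow> real"
  assumes [measurable]: "f \<in> borel_measurable M" "g \<in> borel_measurable M"
    and f2: "integrable M (\<lambda>x. (f x)\<^sup>2)" and g2: "integrable M (\<lambda>x. (g x)\<^sup>2)"
  shows "(\<integral>x. f x * g x \<partial>M)\<^sup>2 \<le> (\<integral>x. (f x)\<^sup>2 \<partial>M) * (\<integral>x. (g x)\<^sup>2 \<partial>M)"
proof -
  define A B I where "A = (\<integral>x. (f x)\<^sup>2 \<partial>M)" and "B = (\<integral>x. (g x)\<^sup>2 \<partial>M)" and "I = (\<integral>x. f x * g x \<partial>M)"
  note fg = integrable_product_of_squares[OF assms]
  have q: "0 \<le> A + 2 * t * I + t\<^sup>2 * B" for t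
  proof -
    have "0 \<le> (\<integral>x. (f x + t * g x)\<^sup>2 \<partial>M)" by simp
    also have "\<dots> = (\<integral>x. (f x)\<^sup>2 + 2 * t * (f x * g x) + t\<^sup>2 * (g x)\<^sup>2 \<partial>M)"
      by (intro Bochner_Integration.integral_cong) (auto simp: power2_eq_square algebra_simps)
    also have "\<dots> = A + 2 * t * I + t\<^sup>2 * B"
      using f2 g2 fg by (simp add: A_def B_def I_def)
    finally show ?thesis .
  qed
  have B0: "B \<ge> 0" by (simp add: B_def)
  from nonneg_quadratic_discriminant[OF q B0]
  show ?thesis by (simp add: A_def B_def I_def)
qed

lemma integral_product_le:
  fixes f g :: "'a \<Rightarrow> real"
  assumes [measurable]: "f \<in> borel_measurable M" "g \<in> borel_measurable M"
    and A: "integrable M A" "\<And>x. (f x)\<^sup>2 \<le> A x" and B: "integrable M B" "\<And>x. (g x)\<^sup>2 \<le> B x"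
  shows "\<bar>\<integral>x. f x * g x \<partial>M\<bar> \<le> sqrt ((\<integral>x. A x \<partial>M) * (\<integral>x. B x \<partial>M))"
proof -
  have f2: "integrable M (\<lambda>x. (f x)\<^sup>2)"
    by (rule Bochner_Integration.integrable_bound[OF A(1)])
       (use A(2) in \<open>auto intro!: AE_I2 order_trans[OF _ abs_ge_self]\<close>)
  have g2: "integrable M (\<lambda>x. (g x)\<^sup>2)"
    by (rule Bochner_Integration.integrable_bound[OF B(1)])
       (use B(2) in \<open>auto intro!: AE_I2 order_trans[OF _ abs_ge_self]\<close>)
  have "(\<integral>x. f x * g x \<partial>M)\<^sup>2 \<le> (\<integral>x. (f x)\<^sup>2 \<partial>M) * (\<integral>x. (g x)\<^sup>2 \<partial>M)"
    by (rule integral_Cauchy_Schwarz) (use f2 g2 in auto)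
  also have "\<dots> \<le> (\<integral>x. A x \<partial>M) * (\<integral>x. B x \<partial>M)"
    using A B f2 g2 by (intro mult_mono integral_mono Bochner_Integration.integral_nonneg)
      (auto intro: order_trans[OF zero_le_power2])
  finally show ?thesis by (metis real_sqrt_abs real_sqrt_le_iff)
qed

section \<open>Jets and the Leibniz rule\<close>

text \<open>
  The inequality is strict because the commutator of a derivative with a cutoff involves
  derivatives of strictly smaller order: counting in this way avoids predecessors.
\<close>

definition words :: "nat \<Rightarrow> 'n::finite list set" where
  "words n = {is. length is < n}"

lemma finite_words [simp]: "finite (words n :: 'n::finite list set)"
  unfolding words_def
  by (rule finite_subset[OF _ finite_lists_length_le[of UNIV n]]) auto

lemmas finite_shorter_lists [simp] = finite_words[unfolded words_def]

lemma finite_words_of_length [simp]: "finite {is :: 'n::finite list. length is = n}"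
  by (rule finite_list_length)

text \<open>
  Integrated over a set, this is the square of the Sobolev norm of order \<open>n - 1\<close>, up to the
  multiplicity with which lists represent multi-indices.
\<close>

definition jet_sq :: "nat \<Rightarrow> (real ^ 'n \<Rightarrow> real) \<Rightarrow> real ^ 'n \<Rightarrow> real" where
  "jet_sq n f x = (\<Sum>is\<in>words n. (pderivs is f x)\<^sup>2)"

lemma jet_sq_nonneg [simp]: "0 \<le> jet_sq n f x"
  by (simp add: jet_sq_def sum_nonneg)

lemma jet_sq_mono: "n \<le> n' \<Longrightarrow> jet_sq n f x \<le> jet_sq n' f x"
  unfolding jet_sq_def by (rule sum_mono2) (auto simp: words_def)

lemma pderivs_sq_le_jet_sq: "length is < n \<Longrightarrow> (pderivs is f x)\<^sup>2 \<le> jet_sq n f x"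
  unfolding jet_sq_def by (rule member_le_sum) (auto simp: words_def)

lemma jet_sq_pderivs: "jet_sq n (pderivs js f) x \<le> jet_sq (n + length js) f x"
proof -
  have "jet_sq n (pderivs js f) x = (\<Sum>is\<in>(\<lambda>is. is @ js) ` words n. (pderivs is f x)\<^sup>2)"
    unfolding jet_sq_def by (subst sum.reindex) (auto simp: inj_on_def)
  also have "\<dots> \<le> jet_sq (n + length js) f x"
    unfolding jet_sq_def by (rule sum_mono2) (auto simp: words_def)
  finally show ?thesis .
qed

lemma jet_sq_Suc: "jet_sq (Suc n) f x = jet_sq n f x + (\<Sum>is | length is = n. (pderivs is f x)\<^sup>2)"
proof -
  have "words (Suc n) = words n \<union> {is :: 'a list. length is = n}"
    and "words n \<inter> {is :: 'a list. length is = n} = {}" by (auto simp: words_def)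
  then show ?thesis unfolding jet_sq_def by (simp add: sum.union_disjoint)
qed

lemma jet_sq_continuous: "smooth f \<Longrightarrow> continuous_on S (jet_sq n f)"
  unfolding jet_sq_def[abs_def]
  by (intro continuous_intros smooth_continuous_on smooth_pderivs)

lemma square_sum3_le: "(a + b + c)\<^sup>2 \<le> 3 * (a\<^sup>2 + b\<^sup>2 + c\<^sup>2)" for a b c :: real
  using sum_squares_bound[of a b] sum_squares_bound[of a c] sum_squares_bound[of b c]
  by (simp add: power2_eq_square algebra_simps)

lemma square_sum2_le: "(a + b)\<^sup>2 \<le> 2 * (a\<^sup>2 + b\<^sup>2)" for a b :: real
  using sum_squares_bound[of a b] by (simp add: power2_eq_square algebra_simps)

lemma test_function_square_bound:
  assumes "\<eta> \<in> test_functions UNIV" "\<And>x. x \<notin> K \<Longrightarrow> \<eta> x = 0"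
  obtains B where "B \<ge> 0" "\<And>x. (\<eta> x)\<^sup>2 \<le> B * indicator K x"
proof -
  obtain B where B: "B > 0" "\<And>x. \<bar>\<eta> x\<bar> \<le> B" using test_function_bounded[OF assms(1)] by metis
  have "(\<eta> x)\<^sup>2 \<le> B\<^sup>2 * indicator K x" for x
    using assms(2)[of x] B power_mono[OF B(2)[of x], of 2] by (cases "x \<in> K") auto
  then show thesis using that[of "B\<^sup>2"] by simp
qed

lemma partial_deriv_eq_0_outside:
  assumes "closed K" "\<And>x. x \<notin> K \<Longrightarrow> f x = 0" "x \<notin> K"
  shows "partial_deriv i f x = 0"
  using pderivs_eq_0_outside[of K f x "[i]"] assms by simp

text \<open>
  In the commutator every derivative of \<open>\<phi>\<close> comes with a derivative of \<open>\<eta>\<close> of positive order, so it has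
  order less than the length of the list, and everything is supported in \<open>K\<close>. The induction
  splits off the innermost direction: the outer derivatives are then applied to products again,
  and no inequality has to be differentiated.
\<close>

lemma leibniz_commutator:
  assumes "closed K" "\<eta> \<in> test_functions UNIV" "\<And>x. x \<notin> K \<Longrightarrow> \<eta> x = 0"
  shows "\<exists>C\<ge>0. \<forall>\<phi> x. smooth \<phi> \<longrightarrow>
      (pderivs is (\<lambda>x. \<eta> x * \<phi> x) x - \<eta> x * pderivs is \<phi> x)\<^sup>2
        \<le> C * indicator K x * jet_sq (length is) \<phi> x"
  using assms(2,3)
proof (induction "is" arbitrary: \<eta> rule: rev_induct)
  case (snoc i "is")
  note s\<eta> = test_function_smooth[OF snoc.prems(1)]
  have \<eta>': "partial_deriv i \<eta> \<in> test_functions UNIV" "\<And>x. x \<notin> K \<Longrightarrow> partial_deriv i \<eta> x = 0"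
    using test_function_partial_deriv[OF snoc.prems(1)]
      partial_deriv_eq_0_outside[OF assms(1) snoc.prems(2)] by auto
  obtain C1 where C1: "C1 \<ge> 0" "\<And>\<phi> x. smooth \<phi> \<Longrightarrow>
      (pderivs is (\<lambda>x. partial_deriv i \<eta> x * \<phi> x) x - partial_deriv i \<eta> x * pderivs is \<phi> x)\<^sup>2
        \<le> C1 * indicator K x * jet_sq (length is) \<phi> x"
    using snoc.IH[OF \<eta>'] by blast
  obtain C2 where C2: "C2 \<ge> 0" "\<And>\<phi> x. smooth \<phi> \<Longrightarrow>
      (pderivs is (\<lambda>x. \<eta> x * \<phi> x) x - \<eta> x * pderivs is \<phi> x)\<^sup>2
        \<le> C2 * indicator K x * jet_sq (length is) \<phi> x"
    using snoc.IH[OF snoc.prems] by blast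
  obtain B where B: "B \<ge> 0" "\<And>x. (partial_deriv i \<eta> x)\<^sup>2 \<le> B * indicator K x"
    using test_function_square_bound[OF \<eta>'] by blast
  show ?case
  proof (intro exI[of _ "3 * (C1 + B + C2)"] conjI allI impI)
    fix \<phi> :: "real ^ 'a \<Rightarrow> real" and x assume \<phi>: "smooth \<phi>"
    define J where "J = indicator K x * jet_sq (Suc (length is)) \<phi> x"
    have J0: "0 \<le> indicator K x * jet_sq n \<psi> x" for n \<psi> by simp
    have "pderivs (is @ [i]) (\<lambda>x. \<eta> x * \<phi> x)
        = pderivs is (\<lambda>x. partial_deriv i \<eta> x * \<phi> x + \<eta> x * partial_deriv i \<phi> x)"
      using s\<eta> \<phi> by (simp add: partial_deriv_mult_smooth)
    also have "\<dots> = (\<lambda>x. pderivs is (\<lambda>x. partial_deriv i \<eta> x * \<phi> x) x + pderivs is (\<lambda>x. \<eta> x * partial_deriv i \<phi> x) x)"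
      using s\<eta> \<phi> by (simp add: pderivs_add smooth_mult smooth_partial_deriv)
    finally have eq: "pderivs (is @ [i]) (\<lambda>x. \<eta> x * \<phi> x) x - \<eta> x * pderivs (is @ [i]) \<phi> x
       = (pderivs is (\<lambda>x. partial_deriv i \<eta> x * \<phi> x) x - partial_deriv i \<eta> x * pderivs is \<phi> x)
         + partial_deriv i \<eta> x * pderivs is \<phi> x
         + (pderivs is (\<lambda>x. \<eta> x * partial_deriv i \<phi> x) x - \<eta> x * pderivs is (partial_deriv i \<phi>) x)"
      by simp
    have 1: "(pderivs is (\<lambda>x. partial_deriv i \<eta> x * \<phi> x) x - partial_deriv i \<eta> x * pderivs is \<phi> x)\<^sup>2 \<le> C1 * J"
      unfolding J_def mult.assoc[symmetric]
      by (rule order_trans[OF C1(2)[OF \<phi>] mult_left_mono]) (use C1(1) in \<open>auto intro: jet_sq_mono\<close>)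
    have 2: "(partial_deriv i \<eta> x * pderivs is \<phi> x)\<^sup>2 \<le> B * J"
      unfolding J_def mult.assoc[symmetric] power_mult_distrib
      by (intro mult_mono B pderivs_sq_le_jet_sq) (use B(1) in auto)
    have 3: "(pderivs is (\<lambda>x. \<eta> x * partial_deriv i \<phi> x) x - \<eta> x * pderivs is (partial_deriv i \<phi>) x)\<^sup>2 \<le> C2 * J"
      unfolding J_def mult.assoc[symmetric]
      by (rule order_trans[OF C2(2)[OF smooth_partial_deriv[OF \<phi>]] mult_left_mono])
         (use C2(1) jet_sq_pderivs[of "length is" "[i]" \<phi> x] in auto)
    show "(pderivs (is @ [i]) (\<lambda>x. \<eta> x * \<phi> x) x - \<eta> x * pderivs (is @ [i]) \<phi> x)\<^sup>2
      \<le> 3 * (C1 + B + C2) * indicator K x * jet_sq (length (is @ [i])) \<phi> x"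
      unfolding eq by (rule order_trans[OF square_sum3_le]) (use 1 2 3 in \<open>simp add: J_def algebra_simps\<close>)
  qed (use C1(1) B(1) C2(1) in auto)
qed (auto intro: exI[of _ 0])

text \<open>
  All the bounds on a fixed cutoff that the energy estimate uses, with a single constant.
\<close>

lemma leibniz_bounds:
  assumes K: "closed K" and \<eta>: "\<eta> \<in> test_functions UNIV" "\<And>x. x \<notin> K \<Longrightarrow> \<eta> x = 0"
  obtains C where "C \<ge> 1"
    "\<And>is \<phi> x. length is \<le> n \<Longrightarrow> smooth \<phi> \<Longrightarrow>
      (pderivs is (\<lambda>x. \<eta> x * \<phi> x) x - \<eta> x * pderivs is \<phi> x)\<^sup>2 \<le> C * indicator K x * jet_sq (length is) \<phi> x"
    "\<And>is \<phi> x. length is \<le> n \<Longrightarrow> smooth \<phi> \<Longrightarrow>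
      (pderivs is (\<lambda>x. \<eta> x * \<phi> x) x)\<^sup>2 \<le> C * indicator K x * jet_sq (Suc (length is)) \<phi> x"
    "\<And>i x. (partial_deriv i \<eta> x)\<^sup>2 \<le> C * indicator K x"
proof -
  have "\<forall>is. \<exists>C\<ge>0. \<forall>\<phi> x. smooth \<phi> \<longrightarrow>
      (pderivs is (\<lambda>x. \<eta> x * \<phi> x) x - \<eta> x * pderivs is \<phi> x)\<^sup>2 \<le> C * indicator K x * jet_sq (length is) \<phi> x"
    using leibniz_commutator[OF K \<eta>] by blast
  then obtain C where C: "\<And>is. C is \<ge> 0" "\<And>is \<phi> x. smooth \<phi> \<Longrightarrow>
      (pderivs is (\<lambda>x. \<eta> x * \<phi> x) x - \<eta> x * pderivs is \<phi> x)\<^sup>2 \<le> C is * indicator K x * jet_sq (length is) \<phi> x"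
    by metis
  have "\<exists>B\<ge>0. \<forall>x. (partial_deriv i \<eta> x)\<^sup>2 \<le> B * indicator K x" for i
    by (rule test_function_square_bound[of "partial_deriv i \<eta>" K])
       (auto intro: test_function_partial_deriv[OF \<eta>(1)] partial_deriv_eq_0_outside[OF K \<eta>(2)])
  then obtain B where B: "\<And>i. B i \<ge> 0" "\<And>i x. (partial_deriv i \<eta> x)\<^sup>2 \<le> B i * indicator K x" by metis
  obtain B0 where B0: "B0 \<ge> 0" "\<And>x. (\<eta> x)\<^sup>2 \<le> B0 * indicator K x"
    using test_function_square_bound[OF \<eta>] by blast
  define S where "S = (\<Sum>is\<in>words (Suc n). C is)"
  define D where "D = 1 + 2 * (S + B0) + (\<Sum>i\<in>UNIV. B i)"
  have S0: "0 \<le> S" "0 \<le> (\<Sum>i\<in>UNIV. B i)" using C(1) B(1) by (auto simp: S_def intro: sum_nonneg)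
  have CS: "C is \<le> S" if "length is \<le> n" for "is"
    unfolding S_def using that C(1) by (intro member_le_sum) (auto simp: words_def)
  have comm: "(pderivs is (\<lambda>x. \<eta> x * \<phi> x) x - \<eta> x * pderivs is \<phi> x)\<^sup>2 \<le> S * indicator K x * jet_sq (length is) \<phi> x"
    if "length is \<le> n" "smooth \<phi>" for "is" \<phi> x
    by (rule order_trans[OF C(2)[OF that(2)]]) (intro mult_right_mono CS that; simp)
  show thesis
  proof (rule that[of D])
    show "D \<ge> 1" using S0 B0 by (simp add: D_def)
    show "(pderivs is (\<lambda>x. \<eta> x * \<phi> x) x - \<eta> x * pderivs is \<phi> x)\<^sup>2 \<le> D * indicator K x * jet_sq (length is) \<phi> x"
      if "length is \<le> n" "smooth \<phi>" for "is" \<phi> x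
      by (rule order_trans[OF comm[OF that]]) (intro mult_right_mono; use S0 B0 in \<open>simp add: D_def\<close>)
    show "(pderivs is (\<lambda>x. \<eta> x * \<phi> x) x)\<^sup>2 \<le> D * indicator K x * jet_sq (Suc (length is)) \<phi> x"
      if "length is \<le> n" "smooth \<phi>" for "is" \<phi> x
    proof -
      define J where "J = indicator K x * jet_sq (Suc (length is)) \<phi> x"
      have "S * indicator K x * jet_sq (length is) \<phi> x \<le> S * indicator K x * jet_sq (Suc (length is)) \<phi> x"
        using S0 by (intro mult_left_mono jet_sq_mono) auto
      with comm[OF that, of x]
      have 1: "(pderivs is (\<lambda>x. \<eta> x * \<phi> x) x - \<eta> x * pderivs is \<phi> x)\<^sup>2 \<le> S * J"
        by (simp add: J_def mult.assoc)
      have 2: "(\<eta> x * pderivs is \<phi> x)\<^sup>2 \<le> B0 * J"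
        unfolding J_def mult.assoc[symmetric] power_mult_distrib
        by (intro mult_mono B0 pderivs_sq_le_jet_sq) (use B0(1) in auto)
      have "(pderivs is (\<lambda>x. \<eta> x * \<phi> x) x)\<^sup>2 \<le> 2 * (S * J + B0 * J)"
        using square_sum2_le[of "pderivs is (\<lambda>x. \<eta> x * \<phi> x) x - \<eta> x * pderivs is \<phi> x" "\<eta> x * pderivs is \<phi> x"] 1 2
        by simp
      also have "\<dots> = 2 * (S + B0) * J" by (simp add: algebra_simps)
      also have "\<dots> \<le> D * J" using S0 by (intro mult_right_mono) (auto simp: D_def J_def)
      finally show ?thesis by (simp add: J_def mult.assoc)
    qed
    show "(partial_deriv i \<eta> x)\<^sup>2 \<le> D * indicator K x" for i x
    proof (rule order_trans[OF B(2) mult_right_mono])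
      have "B i \<le> (\<Sum>i\<in>UNIV. B i)" using B(1) by (intro member_le_sum) auto
      then show "B i \<le> D" using S0 B0 by (simp add: D_def)
    qed simp
  qed
qed

section \<open>Multi-indices as lists of directions\<close>

text \<open>
  The same choice as in \<open>mi_deriv\<close>, so that \<open>mi_deriv \<alpha>\<close> is \<open>pderivs (word \<alpha>)\<close>.
\<close>

definition word :: "nat ^ 'n \<Rightarrow> 'n list" where
  "word \<alpha> = (SOME is. \<forall>i. count_list is i = \<alpha> $ i)"

definition multi_index :: "'n list \<Rightarrow> nat ^ 'n" where
  "multi_index is = (\<chi> i. count_list is i)"

lemma count_list_word: "count_list (word \<alpha>) i = \<alpha> $ i"
proof -
  have "\<exists>is. \<forall>i. count_list is i = \<alpha> $ i"
  proof -
    define A where "A = (\<Sum>j\<in>UNIV. replicate_mset (\<alpha> $ j) j)"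
    obtain xs where xs: "mset xs = A" using ex_mset by blast
    have "count A i = \<alpha> $ i" for i by (simp add: A_def count_sum)
    then show ?thesis using xs by (metis count_mset)
  qed
  then show ?thesis unfolding word_def by (rule someI2_ex) auto
qed

lemma mi_deriv_eq_pderivs: "mi_deriv \<alpha> f = pderivs (word \<alpha>) f"
  by (simp add: mi_deriv_def pderivs_def word_def)

lemma length_word: "length (word \<alpha>) = mi_order \<alpha>"
  using sum_count_set[of "word \<alpha>" UNIV] by (simp add: mi_order_def count_list_word)

lemma multi_index_word [simp]: "multi_index (word \<alpha>) = \<alpha>"
  by (simp add: multi_index_def count_list_word vec_eq_iff)

lemma mi_order_multi_index: "mi_order (multi_index is) = length is"
  using sum_count_set[of "is" UNIV] by (simp add: mi_order_def multi_index_def)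

lemma finite_multi_indices_le [simp]: "finite {\<alpha> :: nat ^ 'n. mi_order \<alpha> \<le> m}"
proof (rule finite_subset)
  show "{\<alpha> :: nat ^ 'n. mi_order \<alpha> \<le> m} \<subseteq> multi_index ` words (Suc m)"
  proof
    fix \<alpha> :: "nat ^ 'n" assume "\<alpha> \<in> {\<alpha>. mi_order \<alpha> \<le> m}"
    then have "word \<alpha> \<in> words (Suc m)" by (simp add: words_def length_word)
    then show "\<alpha> \<in> multi_index ` words (Suc m)" by (metis image_eqI multi_index_word)
  qed
qed simp

lemma finite_multi_indices_eq [simp]: "finite {\<alpha> :: nat ^ 'n. mi_order \<alpha> = m}"
  by (rule finite_subset[OF _ finite_multi_indices_le[of m]]) auto

lemma pderivs_multi_index: "smooth f \<Longrightarrow> pderivs (word (multi_index is)) f = pderivs is f"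
  by (rule pderivs_mset_cong) (auto simp: multiset_eq_iff count_mset count_list_word multi_index_def)

section \<open>The interior estimate for smooth solutions\<close>

definition ball_int :: "real \<Rightarrow> (real ^ 'n \<Rightarrow> real) \<Rightarrow> real" where
  "ball_int r F = (LBINT x. indicator (ball 0 r) x * F x)"

text \<open>
  The weak formulation for smooth functions. The integrals may be taken over the whole space,
  because \<open>\<psi>\<close> vanishes outside the ball.
\<close>

definition solves_weakly ::
  "nat \<Rightarrow> (nat ^ 'n \<Rightarrow> nat ^ 'n \<Rightarrow> real) \<Rightarrow> real \<Rightarrow> (real ^ 'n \<Rightarrow> real) \<Rightarrow> (real ^ 'n \<Rightarrow> real) \<Rightarrow> bool" where
  "solves_weakly m a R w g \<longleftrightarrow> (\<forall>\<psi>\<in>test_functions (ball 0 R).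
     (\<Sum>\<alpha> | mi_order \<alpha> = m. \<Sum>\<beta> | mi_order \<beta> = m.
        a \<alpha> \<beta> * (LBINT x. pderivs (word \<alpha>) w x * pderivs (word \<beta>) \<psi> x)) =
     (LBINT x. g x * \<psi> x))"

text \<open>
  The hypotheses of the a priori estimates. The constants in these estimates must not depend on
  \<open>a\<close>, \<open>w\<close> and \<open>g\<close>, only on the other parameters.
\<close>

definition smooth_solution ::
  "nat \<Rightarrow> real \<Rightarrow> real \<Rightarrow> real \<Rightarrow> (nat ^ 'n \<Rightarrow> nat ^ 'n \<Rightarrow> real) \<Rightarrow> (real ^ 'n \<Rightarrow> real) \<Rightarrow> (real ^ 'n \<Rightarrow> real) \<Rightarrow> bool" where
  "smooth_solution m c M R a w g \<longleftrightarrow> elliptic_coeffs m c a \<and>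
     (\<forall>\<alpha> \<beta>. mi_order \<alpha> = m \<longrightarrow> mi_order \<beta> = m \<longrightarrow> \<bar>a \<alpha> \<beta>\<bar> \<le> M) \<and>
     smooth w \<and> smooth g \<and> solves_weakly m a R w g"

lemma ball_integrable:
  fixes F :: "real ^ 'n \<Rightarrow> real"
  assumes "continuous_on UNIV F"
  shows "integrable lborel (\<lambda>x. indicator (ball 0 r) x * F x)"
proof -
  have i: "integrable lborel (\<lambda>x. indicator (cball 0 r) x *\<^sub>R F x)"
    by (rule borel_integrable_compact) (use assms in \<open>auto intro: continuous_on_subset\<close>)
  have [measurable]: "F \<in> borel_measurable borel" using assms by (rule borel_measurable_continuous_onI)
  show ?thesis
    by (rule Bochner_Integration.integrable_bound[OF i]) (auto simp: indicator_def)
qed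

text \<open>
  If \<open>Y < X\<close>, then \<open>Y\<close> may be replaced by \<open>X\<close> in one factor under the root, and after squaring a
  factor \<open>X\<close> cancels.
\<close>

lemma absorb_inequality:
  fixes X Y A B P c :: real
  assumes "0 \<le> X" "0 \<le> Y" "0 \<le> A" "0 \<le> B" "0 \<le> P" "c > 0"
    and le: "c * X \<le> P * sqrt (Y * (A * Y + B * X))"
  shows "X \<le> (1 + P\<^sup>2 * (A + B) / c\<^sup>2) * Y"
proof (cases "X \<le> Y")
  case True
  have "1 * Y \<le> (1 + P\<^sup>2 * (A + B) / c\<^sup>2) * Y"
    by (rule mult_right_mono) (use assms in auto)
  with True show ?thesis by linarith
next
  case False
  then have X: "X > 0" using assms by linarith
  have "(c * X)\<^sup>2 \<le> (P * sqrt (Y * (A * Y + B * X)))\<^sup>2"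
    by (rule power_mono[OF le]) (use assms in auto)
  also have "\<dots> = P\<^sup>2 * (Y * (A * Y + B * X))"
    using assms by (simp add: power_mult_distrib)
  also have "\<dots> \<le> P\<^sup>2 * (Y * (A * X + B * X))"
    using False assms by (intro mult_left_mono add_mono) auto
  finally have "X * (c\<^sup>2 * X) \<le> X * (P\<^sup>2 * (A + B) * Y)"
    by (simp add: power2_eq_square algebra_simps)
  then have "c\<^sup>2 * X \<le> P\<^sup>2 * (A + B) * Y" using X by simp
  then have "X \<le> P\<^sup>2 * (A + B) / c\<^sup>2 * Y" using assms(6) by (simp add: field_simps)
  also have "\<dots> \<le> (1 + P\<^sup>2 * (A + B) / c\<^sup>2) * Y"
    by (rule mult_right_mono) (use assms in auto)
  finally show ?thesis .
qed

lemma double_sum_bound: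
  fixes t :: "'a \<Rightarrow> 'a \<Rightarrow> real"
  assumes "finite S" "\<And>p q. p \<in> S \<Longrightarrow> q \<in> S \<Longrightarrow> \<bar>a p q\<bar> \<le> M" "\<And>p q. p \<in> S \<Longrightarrow> q \<in> S \<Longrightarrow> \<bar>t p q\<bar> \<le> T" "0 \<le> M"
  shows "\<bar>\<Sum>p\<in>S. \<Sum>q\<in>S. a p q * t p q\<bar> \<le> (real (card S))\<^sup>2 * M * T"
proof -
  have "\<bar>a p q * t p q\<bar> \<le> M * T" if "p \<in> S" "q \<in> S" for p q
    unfolding abs_mult by (rule mult_mono) (use assms that in auto)
  note b = this
  have "\<bar>\<Sum>q\<in>S. a p q * t p q\<bar> \<le> real (card S) * (M * T)" if "p \<in> S" for p
    by (rule order_trans[OF sum_abs], rule sum_bounded_above) (rule b[OF that])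
  note b' = this
  have "\<bar>\<Sum>p\<in>S. \<Sum>q\<in>S. a p q * t p q\<bar> \<le> real (card S) * (real (card S) * (M * T))"
    by (rule order_trans[OF sum_abs], rule sum_bounded_above) (rule b')
  then show ?thesis by (simp add: power2_eq_square mult_ac)
qed

text \<open>
  The energy estimate. Put \<open>v = D\<^sub>\<gamma> w\<close>, \<open>\<phi> = \<eta> v\<close> and \<open>\<psi> = \<eta> \<phi>\<close> for a cutoff \<open>\<eta>\<close> that is 1 on the smaller
  ball. By ellipticity, the derivatives of \<open>\<phi>\<close> of order \<open>m\<close> are bounded by the energy
  \<open>\<Sum> a \<alpha> \<beta> \<integral> D\<^sub>\<alpha> \<phi> D\<^sub>\<beta> \<phi>\<close>, and \<open>D\<^sub>\<alpha> \<phi> D\<^sub>\<beta> \<phi>\<close> is the sum of three products: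

  \<^item> \<open>D\<^sub>\<alpha> v D\<^sub>\<beta> \<psi>\<close>: after moving \<open>D\<^sub>\<gamma>\<close> to \<open>\<psi>\<close>, this is the equation, tested with \<open>D\<^sub>\<gamma> \<psi>\<close>. Of the
    derivatives \<open>\<gamma>\<close> at most \<open>m\<close> are left on \<open>\<psi>\<close>; the others, at most \<open>l\<close>, are moved to the
    right-hand side.

  \<^item> \<open>(D\<^sub>\<alpha> \<phi> - \<eta> D\<^sub>\<alpha> v) D\<^sub>\<beta> \<phi>\<close>: the commutator contains derivatives of \<open>v\<close> of order less than \<open>m\<close> only.

  \<^item> \<open>D\<^sub>\<alpha> v (\<eta> D\<^sub>\<beta> \<phi> - D\<^sub>\<beta> \<psi>)\<close>: here \<open>v\<close> carries \<open>m\<close> derivatives, but the commutator contains derivatives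
    of \<open>\<phi>\<close> of order less than \<open>m\<close>, so that one derivative can be moved from \<open>v\<close> to the commutator.

  By Cauchy-Schwarz each contribution is at most a multiple of \<open>sqrt (Y * Z)\<close>. Here \<open>Y\<close> collects the
  quantities on the right-hand side of the claim, and \<open>Z\<close> the derivatives of \<open>\<phi>\<close> up to order \<open>m\<close>.
  Since \<open>Z\<close> is at most a multiple of \<open>Y\<close> plus a multiple of the quantity to be estimated, the
  latter can be absorbed.
\<close>

lemma gain_one_derivative_single:
  fixes \<gamma> :: "'n::finite list"
  assumes m: "m \<ge> 1" and c: "c > 0" and M: "M \<ge> 0" and rR: "0 < r" "r < R" and k: "length \<gamma> \<le> m + l"
  shows "\<exists>C\<ge>0. \<forall>a w g. smooth_solution m c M R a w g \<longrightarrow>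
      ball_int r (\<lambda>x. \<Sum>is | length is = m. (pderivs (is @ \<gamma>) w x)\<^sup>2)
        \<le> C * (ball_int R (jet_sq (m + length \<gamma>) w) + ball_int R (jet_sq (Suc l) g))"
proof -
  obtain \<eta> where \<eta>: "\<eta> \<in> test_functions (ball 0 R :: (real^'n) set)" "\<And>x. x \<in> cball 0 r \<Longrightarrow> \<eta> x = 1"
    using cutoff_exists[of "cball (0::real^'n) r" "ball 0 R"] rR by (metis cball_subset_ball_iff compact_cball diff_self norm_zero dist_self add.left_neutral open_ball)
  then obtain K where K: "compact K" "K \<subseteq> ball 0 R" "\<And>x. x \<notin> K \<Longrightarrow> \<eta> x = 0" and s\<eta>: "smooth \<eta>"
    unfolding test_functions_iff by blast
  have clK: "closed K" using K(1) by (rule compact_imp_closed)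
  have [measurable]: "K \<in> sets borel" using K(1) by (rule borel_compact)
  have \<eta>U: "\<eta> \<in> test_functions UNIV" using test_functions_mono[OF \<eta>(1)] by simp
  obtain D where D: "D \<ge> 1"
    "\<And>is \<phi> x. length is \<le> Suc m \<Longrightarrow> smooth \<phi> \<Longrightarrow>
      (pderivs is (\<lambda>x. \<eta> x * \<phi> x) x - \<eta> x * pderivs is \<phi> x)\<^sup>2 \<le> D * indicator K x * jet_sq (length is) \<phi> x"
    "\<And>is \<phi> x. length is \<le> Suc m \<Longrightarrow> smooth \<phi> \<Longrightarrow>
      (pderivs is (\<lambda>x. \<eta> x * \<phi> x) x)\<^sup>2 \<le> D * indicator K x * jet_sq (Suc (length is)) \<phi> x"
    "\<And>i x. (partial_deriv i \<eta> x)\<^sup>2 \<le> D * indicator K x"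
    by (rule leibniz_bounds[OF clK \<eta>U K(3), of "Suc m"]) (assumption | rule that)+
  define mis where "mis = {\<alpha> :: nat ^ 'n. mi_order \<alpha> = m}"
  define W where "W = real (card (words m :: 'n list set))"
  define V where "V = real (card {is :: 'n list. length is = m})"
  define P where "P = (1 + 2 * ((real (card mis))\<^sup>2 * M)) * sqrt (4 * D)"
  define C5 where "C5 = 1 + P\<^sup>2 * (W * D + V) / c\<^sup>2"
  have pos: "0 \<le> W" "0 \<le> V" "0 \<le> P" using D(1) M by (auto simp: W_def V_def P_def)
  have C5: "0 \<le> C5" using pos D(1) by (auto simp: C5_def)
  show ?thesis
  proof (rule exI[of _ "W * D + V * C5"], intro conjI allI impI, goal_cases)
    case 1 show ?case using pos D(1) C5 by simp
  next
    case (2 a w g)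
    then have ell: "elliptic_coeffs m c a" and aM: "\<And>\<alpha> \<beta>. \<alpha> \<in> mis \<Longrightarrow> \<beta> \<in> mis \<Longrightarrow> \<bar>a \<alpha> \<beta>\<bar> \<le> M"
      and sw: "smooth w" and sg: "smooth g" and eq: "solves_weakly m a R w g"
      by (auto simp: mis_def smooth_solution_def)
    define v where "v = pderivs \<gamma> w"
    define \<phi> where "\<phi> = (\<lambda>x. \<eta> x * v x)"
    define \<psi> where "\<psi> = (\<lambda>x. \<eta> x * \<phi> x)"
    have sv: "smooth v" by (simp add: v_def sw smooth_pderivs)
    have \<phi>R: "\<phi> \<in> test_functions (ball 0 R)" unfolding \<phi>_def by (rule test_function_mult_left[OF \<eta>(1) sv])
    have s\<phi>: "smooth \<phi>" by (rule test_function_smooth[OF \<phi>R])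
    have \<psi>R: "\<psi> \<in> test_functions (ball 0 R)" unfolding \<psi>_def by (rule test_function_mult_left[OF \<eta>(1) s\<phi>])
    have s\<psi>: "smooth \<psi>" by (rule test_function_smooth[OF \<psi>R])
    have \<phi>U: "\<phi> \<in> test_functions UNIV" and \<psi>U: "\<psi> \<in> test_functions UNIV"
      using \<phi>R \<psi>R test_functions_mono by blast+
    have \<phi>0: "x \<notin> K \<Longrightarrow> \<phi> x = 0" and \<psi>0: "x \<notin> K \<Longrightarrow> \<psi> x = 0" for x
      using K(3) by (auto simp: \<phi>_def \<psi>_def)
    have D\<phi>0: "pderivs is \<phi> x = 0" and D\<psi>0: "pderivs is \<psi> x = 0" if "x \<notin> K" for x "is"
      using pderivs_eq_0_outside[OF clK \<phi>0 that] pderivs_eq_0_outside[OF clK \<psi>0 that] by auto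
    define Yf where "Yf = (\<lambda>x. indicator K x * (jet_sq (m + length \<gamma>) w x + jet_sq (Suc l) g x))"
    define Zf where "Zf = jet_sq (Suc m) \<phi>"
    define Xf where "Xf = (\<lambda>x. \<Sum>\<alpha>\<in>mis. (pderivs (word \<alpha>) \<phi> x)\<^sup>2)"
    define Y where "Y = (LBINT x. Yf x)"
    define Z where "Z = (LBINT x. Zf x)"
    define X where "X = (LBINT x. Xf x)"
    have iY: "integrable lborel Yf"
    proof -
      have "integrable lborel (\<lambda>x. indicator K x *\<^sub>R (jet_sq (m + length \<gamma>) w x + jet_sq (Suc l) g x))"
        by (rule borel_integrable_compact) (auto intro!: K continuous_intros jet_sq_continuous sw sg)
      then show ?thesis by (simp add: Yf_def)
    qed
    have iZ: "integrable lborel Zf" unfolding Zf_def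
      by (rule compact_support_integrable[OF jet_sq_continuous[OF s\<phi>] K(1)]) (simp add: jet_sq_def D\<phi>0)
    have iX: "integrable lborel Xf" unfolding Xf_def
    proof (rule compact_support_integrable[OF _ K(1)])
      show "continuous_on UNIV (\<lambda>x. \<Sum>\<alpha>\<in>mis. (pderivs (word \<alpha>) \<phi> x)\<^sup>2)"
        by (intro continuous_intros smooth_continuous_on smooth_pderivs s\<phi>)
    qed (simp add: D\<phi>0)
    have Y0: "0 \<le> Y" "0 \<le> Yf x" for x by (auto simp: Y_def Yf_def)
    have Z0: "0 \<le> Z" "0 \<le> Zf x" for x by (auto simp: Z_def Zf_def)
    have X0: "0 \<le> X" by (auto simp: X_def Xf_def sum_nonneg)
    have jv: "indicator K x * jet_sq m v x \<le> Yf x" for x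
      using jet_sq_pderivs[of m \<gamma> w x] unfolding Yf_def v_def
      by (intro mult_left_mono) (auto simp: add_increasing2)
    have meas: "pderivs is f \<in> borel_measurable borel" if "smooth f" for "is" and f :: "real^'n \<Rightarrow> real"
      using that by (simp add: smooth_borel_measurable smooth_pderivs)
    note [measurable] = meas[OF sw] meas[OF sg] meas[OF s\<phi>] meas[OF s\<psi>] meas[OF sv] smooth_borel_measurable[OF s\<eta>]
    \<comment> \<open>The factor 4 comes from the third contribution, where a sum of two terms is squared.\<close>
    define T where "T = sqrt (4 * D * (Y * Z))"
    have bound: "\<bar>LBINT x. f x * h x\<bar> \<le> T"
      if "f \<in> borel_measurable borel" "h \<in> borel_measurable borel" "\<And>x. (f x)\<^sup>2 \<le> p * Yf x" "\<And>x. (h x)\<^sup>2 \<le> q * Zf x" "p * q \<le> 4 * D"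
      for f h :: "real^'n \<Rightarrow> real" and p q
    proof -
      have "\<bar>LBINT x. f x * h x\<bar> \<le> sqrt ((LBINT x. p * Yf x) * (LBINT x. q * Zf x))"
        by (rule integral_product_le) (use that iY iZ in auto)
      also have "\<dots> = sqrt (p * q * (Y * Z))" by (simp add: Y_def Z_def mult_ac)
      also have "\<dots> \<le> T" unfolding T_def using that(5) Y0 Z0 by (intro real_sqrt_le_mono mult_right_mono) auto
      finally show ?thesis .
    qed
    \<comment> \<open>The part governed by the equation. Splitting \<open>\<gamma>\<close> after \<open>m\<close> directions leaves at most \<open>l\<close> of them
      for \<open>g\<close>.\<close>
    define \<gamma>1 \<gamma>2 where "\<gamma>1 = take m \<gamma>" and "\<gamma>2 = drop m \<gamma>"
    have \<gamma>: "\<gamma> = \<gamma>1 @ \<gamma>2" "length \<gamma>1 \<le> m" "length \<gamma>2 \<le> l" using k by (auto simp: \<gamma>1_def \<gamma>2_def)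
    define T1 where "T1 = (\<Sum>\<alpha>\<in>mis. \<Sum>\<beta>\<in>mis. a \<alpha> \<beta> * (LBINT x. pderivs (word \<alpha>) v x * pderivs (word \<beta>) \<psi> x))"
    have T1: "\<bar>T1\<bar> \<le> T"
    proof -
      have "(LBINT x. pderivs (word \<alpha>) v x * pderivs (word \<beta>) \<psi> x)
          = (-1) ^ length \<gamma> * (LBINT x. pderivs (word \<alpha>) w x * pderivs (word \<beta>) (pderivs \<gamma> \<psi>) x)" for \<alpha> \<beta>
        unfolding v_def pderivs_commute[OF sw, of "word \<alpha>" \<gamma>] pderivs_commute[OF s\<psi>, of "word \<beta>" \<gamma>]
        by (rule integral_by_parts) (use sw \<psi>U in \<open>auto intro: smooth_pderivs test_function_pderivs\<close>)
      then have "T1 = (-1) ^ length \<gamma> * (\<Sum>\<alpha>\<in>mis. \<Sum>\<beta>\<in>mis. a \<alpha> \<beta> *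
          (LBINT x. pderivs (word \<alpha>) w x * pderivs (word \<beta>) (pderivs \<gamma> \<psi>) x))"
        unfolding T1_def by (simp add: sum_distrib_left mult_ac)
      also have "(\<Sum>\<alpha>\<in>mis. \<Sum>\<beta>\<in>mis. a \<alpha> \<beta> *
          (LBINT x. pderivs (word \<alpha>) w x * pderivs (word \<beta>) (pderivs \<gamma> \<psi>) x))
          = (LBINT x. g x * pderivs \<gamma> \<psi> x)"
        using eq test_function_pderivs[OF \<psi>R] unfolding solves_weakly_def mis_def by blast
      also have "pderivs \<gamma> \<psi> = pderivs \<gamma>2 (pderivs \<gamma>1 \<psi>)"
        unfolding \<gamma>(1) pderivs_append by (rule pderivs_commute[OF s\<psi>])
      finally have "\<bar>T1\<bar> = \<bar>LBINT x. g x * pderivs \<gamma>2 (pderivs \<gamma>1 \<psi>) x\<bar>"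
        by (simp add: abs_mult power_abs)
      also have "\<dots> = \<bar>LBINT x. pderivs \<gamma>2 g x * pderivs \<gamma>1 \<psi> x\<bar>"
        using integral_by_parts[OF sg test_function_pderivs[OF \<psi>U], of \<gamma>2 \<gamma>1] by (simp add: abs_mult power_abs)
      also have "\<dots> = \<bar>LBINT x. (indicator K x * pderivs \<gamma>2 g x) * pderivs \<gamma>1 \<psi> x\<bar>"
        by (intro arg_cong[where f = abs] Bochner_Integration.integral_cong refl) (auto simp: D\<psi>0 indicator_def)
      also have "\<dots> \<le> T"
      proof (rule bound[of _ _ 1 D])
        show "(indicator K x * pderivs \<gamma>2 g x)\<^sup>2 \<le> 1 * Yf x" for x
          using pderivs_sq_le_jet_sq[of \<gamma>2 "Suc l" g x] \<gamma>(3)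
          by (auto simp: Yf_def indicator_def intro: add_increasing)
        have "(pderivs \<gamma>1 \<psi> x)\<^sup>2 \<le> D * indicator K x * jet_sq (Suc (length \<gamma>1)) \<phi> x" for x
          unfolding \<psi>_def using D(3)[of \<gamma>1 \<phi> x] \<gamma>(2) s\<phi> by simp
        also have "\<dots> x \<le> D * 1 * Zf x" for x
          unfolding Zf_def using D(1) \<gamma>(2) by (intro mult_mono jet_sq_mono) (auto simp: indicator_def)
        finally show "(pderivs \<gamma>1 \<psi> x)\<^sup>2 \<le> D * Zf x" for x by simp
      qed (use D(1) in auto)
      finally show ?thesis .
    qed
    \<comment> \<open>The commutator falls on \<open>v\<close>, in which it is of order less than \<open>m\<close>.\<close>
    define T2 where "T2 = (\<Sum>\<alpha>\<in>mis. \<Sum>\<beta>\<in>mis. a \<alpha> \<beta> *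
       (LBINT x. (pderivs (word \<alpha>) \<phi> x - \<eta> x * pderivs (word \<alpha>) v x) * pderivs (word \<beta>) \<phi> x))"
    have lw: "length (word \<alpha>) = m" if "\<alpha> \<in> mis" for \<alpha> using that by (simp add: mis_def length_word)
    have T2: "\<bar>T2\<bar> \<le> (real (card mis))\<^sup>2 * M * T"
      unfolding T2_def
    proof (rule double_sum_bound)
      fix \<alpha> \<beta> assume ab: "\<alpha> \<in> mis" "\<beta> \<in> mis"
      show "\<bar>LBINT x. (pderivs (word \<alpha>) \<phi> x - \<eta> x * pderivs (word \<alpha>) v x) * pderivs (word \<beta>) \<phi> x\<bar> \<le> T"
      proof (rule bound[of _ _ D 1])
        show "(pderivs (word \<alpha>) \<phi> x - \<eta> x * pderivs (word \<alpha>) v x)\<^sup>2 \<le> D * Yf x" for x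
        proof -
          have "(pderivs (word \<alpha>) \<phi> x - \<eta> x * pderivs (word \<alpha>) v x)\<^sup>2 \<le> D * (indicator K x * jet_sq m v x)"
            unfolding \<phi>_def using D(2)[of "word \<alpha>" v x] lw[OF ab(1)] sv by (simp add: mult.assoc)
          also have "\<dots> \<le> D * Yf x" using jv[of x] D(1) by (intro mult_left_mono) auto
          finally show ?thesis .
        qed
        show "(pderivs (word \<beta>) \<phi> x)\<^sup>2 \<le> 1 * Zf x" for x
          unfolding Zf_def using pderivs_sq_le_jet_sq[of "word \<beta>" "Suc m"] lw[OF ab(2)] by simp
      qed (use D(1) in auto)
    qed (use aM M in \<open>auto simp: mis_def\<close>)
    \<comment> \<open>The commutator falls on \<open>\<phi>\<close>. One direction \<open>i\<close> of \<open>\<alpha>\<close>, which exists as \<open>m\<close> is positive, is moved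
      to it.\<close>
    define \<zeta> where "\<zeta> = (\<lambda>\<beta> x. \<eta> x * pderivs (word \<beta>) \<phi> x - pderivs (word \<beta>) \<psi> x)"
    have \<zeta>U: "\<zeta> \<beta> \<in> test_functions UNIV" for \<beta>
      unfolding \<zeta>_def by (intro test_function_diff test_function_mult_left test_function_pderivs \<eta>U \<psi>U smooth_pderivs s\<phi>)
    define T3 where "T3 = (\<Sum>\<alpha>\<in>mis. \<Sum>\<beta>\<in>mis. a \<alpha> \<beta> * (LBINT x. pderivs (word \<alpha>) v x * \<zeta> \<beta> x))"
    have T3: "\<bar>T3\<bar> \<le> (real (card mis))\<^sup>2 * M * T"
      unfolding T3_def
    proof (rule double_sum_bound)
      fix \<alpha> \<beta> assume ab: "\<alpha> \<in> mis" "\<beta> \<in> mis"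
      obtain i \<alpha>' where \<alpha>': "word \<alpha> = i # \<alpha>'" "Suc (length \<alpha>') = m"
        using lw[OF ab(1)] m by (cases "word \<alpha>") auto
      have d\<zeta>: "partial_deriv i (\<zeta> \<beta>) x = partial_deriv i \<eta> x * pderivs (word \<beta>) \<phi> x
          + (-1) * (pderivs (i # word \<beta>) \<psi> x - \<eta> x * pderivs (i # word \<beta>) \<phi> x)" for x
      proof -
        have "partial_deriv i (\<zeta> \<beta>) = (\<lambda>x. partial_deriv i (\<lambda>x. \<eta> x * pderivs (word \<beta>) \<phi> x) x - partial_deriv i (pderivs (word \<beta>) \<psi>) x)"
          unfolding \<zeta>_def using pderivs_diff[of "\<lambda>x. \<eta> x * pderivs (word \<beta>) \<phi> x" "pderivs (word \<beta>) \<psi>" "[i]"]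
          by (simp add: s\<eta> s\<phi> s\<psi> smooth_mult smooth_pderivs)
        then show ?thesis by (simp add: partial_deriv_mult_smooth s\<eta> s\<phi> smooth_pderivs)
      qed
      have out: "partial_deriv i (\<zeta> \<beta>) x = 0" if "x \<notin> K" for x
        by (rule partial_deriv_eq_0_outside[OF clK _ that]) (simp add: \<zeta>_def D\<phi>0 D\<psi>0)
      have "(LBINT x. pderivs (word \<alpha>) v x * \<zeta> \<beta> x) = - (LBINT x. pderivs \<alpha>' v x * partial_deriv i (\<zeta> \<beta>) x)"
        unfolding \<alpha>' pderivs_Cons by (rule integral_by_parts_partial[OF smooth_pderivs[OF sv] \<zeta>U])
      also have "\<dots> = - (LBINT x. (indicator K x * pderivs \<alpha>' v x) * partial_deriv i (\<zeta> \<beta>) x)"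
        by (intro arg_cong[where f = uminus] Bochner_Integration.integral_cong refl) (auto simp: out indicator_def)
      also have "\<bar>\<dots>\<bar> \<le> T" unfolding abs_minus_cancel
      proof (rule bound[of _ _ 1 "4 * D"])
        show "(indicator K x * pderivs \<alpha>' v x)\<^sup>2 \<le> 1 * Yf x" for x
          using pderivs_sq_le_jet_sq[of \<alpha>' m v x] \<alpha>'(2) jv[of x] by (auto simp: indicator_def split: if_splits)
        show "(partial_deriv i (\<zeta> \<beta>) x)\<^sup>2 \<le> (4 * D) * Zf x" for x
        proof -
          have "(partial_deriv i \<eta> x * pderivs (word \<beta>) \<phi> x)\<^sup>2 \<le> D * Zf x"
          proof -
            have "(partial_deriv i \<eta> x)\<^sup>2 \<le> D" 
              by (rule order_trans[OF D(4)]) (use D(1) in \<open>auto simp: indicator_def\<close>)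
            moreover have "(pderivs (word \<beta>) \<phi> x)\<^sup>2 \<le> Zf x"
              unfolding Zf_def using lw[OF ab(2)] by (intro pderivs_sq_le_jet_sq) simp
            ultimately show ?thesis unfolding power_mult_distrib using D(1) by (intro mult_mono) auto
          qed
          moreover have "(pderivs (i # word \<beta>) \<psi> x - \<eta> x * pderivs (i # word \<beta>) \<phi> x)\<^sup>2 \<le> D * Zf x"
          proof -
            have "(pderivs (i # word \<beta>) \<psi> x - \<eta> x * pderivs (i # word \<beta>) \<phi> x)\<^sup>2 \<le> D * indicator K x * jet_sq (length (i # word \<beta>)) \<phi> x"
              unfolding \<psi>_def by (rule D(2)) (use lw[OF ab(2)] s\<phi> in auto)
            also have "\<dots> \<le> D * 1 * Zf x"
              unfolding Zf_def using D(1) lw[OF ab(2)] by (intro mult_mono) (auto simp: indicator_def)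
            finally show ?thesis by simp
          qed
          ultimately show ?thesis
            unfolding d\<zeta> using square_sum2_le[of "partial_deriv i \<eta> x * pderivs (word \<beta>) \<phi> x"
              "(-1) * (pderivs (i # word \<beta>) \<psi> x - \<eta> x * pderivs (i # word \<beta>) \<phi> x)"]
            by (simp add: power2_commute)
        qed
        show "partial_deriv i (\<zeta> \<beta>) \<in> borel_measurable borel"
          by (intro smooth_borel_measurable smooth_partial_deriv test_function_smooth[OF \<zeta>U])
      qed (use D(1) in auto)
      finally show "\<bar>LBINT x. pderivs (word \<alpha>) v x * \<zeta> \<beta> x\<bar> \<le> T" .
    qed (use aM M in \<open>auto simp: mis_def\<close>)
    \<comment> \<open>Ellipticity holds pointwise, with the derivatives of \<open>\<phi>\<close> at the given point as the vector \<open>\<xi>\<close>.\<close>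
    have en: "c * X \<le> T1 + T2 + T3"
    proof -
      have iab: "integrable lborel (\<lambda>x. pderivs (word \<alpha>) \<phi> x * pderivs (word \<beta>) \<phi> x)" for \<alpha> \<beta>
        by (rule test_function_integrable[OF test_function_mult]) (auto intro: smooth_pderivs s\<phi> test_function_pderivs[OF \<phi>U])
      have split: "(LBINT x. pderivs (word \<alpha>) \<phi> x * pderivs (word \<beta>) \<phi> x)
         = (LBINT x. pderivs (word \<alpha>) v x * pderivs (word \<beta>) \<psi> x)
         + (LBINT x. (pderivs (word \<alpha>) \<phi> x - \<eta> x * pderivs (word \<alpha>) v x) * pderivs (word \<beta>) \<phi> x)
         + (LBINT x. pderivs (word \<alpha>) v x * \<zeta> \<beta> x)" for \<alpha> \<beta>
      proof -
        have i1: "integrable lborel (\<lambda>x. pderivs (word \<alpha>) v x * pderivs (word \<beta>) \<psi> x)"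
          by (rule test_function_integrable[OF test_function_mult]) (auto intro: smooth_pderivs sv test_function_pderivs[OF \<psi>U])
        have i2: "integrable lborel (\<lambda>x. (pderivs (word \<alpha>) \<phi> x - \<eta> x * pderivs (word \<alpha>) v x) * pderivs (word \<beta>) \<phi> x)"
          by (rule test_function_integrable[OF test_function_mult])
             (auto intro!: smooth_diff smooth_mult smooth_pderivs sv s\<phi> s\<eta> test_function_pderivs[OF \<phi>U])
        have i3: "integrable lborel (\<lambda>x. pderivs (word \<alpha>) v x * \<zeta> \<beta> x)"
          by (rule test_function_integrable[OF test_function_mult]) (auto intro: smooth_pderivs sv \<zeta>U)
        have "(LBINT x. pderivs (word \<alpha>) \<phi> x * pderivs (word \<beta>) \<phi> x)
          = (LBINT x. pderivs (word \<alpha>) v x * pderivs (word \<beta>) \<psi> x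
              + (pderivs (word \<alpha>) \<phi> x - \<eta> x * pderivs (word \<alpha>) v x) * pderivs (word \<beta>) \<phi> x
              + pderivs (word \<alpha>) v x * \<zeta> \<beta> x)"
          by (intro Bochner_Integration.integral_cong) (auto simp: \<zeta>_def algebra_simps)
        then show ?thesis using i1 i2 i3 by simp
      qed
      have "c * X = (LBINT x. c * Xf x)" by (simp add: X_def)
      also have "\<dots> \<le> (LBINT x. (\<Sum>\<alpha>\<in>mis. \<Sum>\<beta>\<in>mis. a \<alpha> \<beta> * (pderivs (word \<alpha>) \<phi> x * pderivs (word \<beta>) \<phi> x)))"
      proof (rule integral_mono)
        show "c * Xf x \<le> (\<Sum>\<alpha>\<in>mis. \<Sum>\<beta>\<in>mis. a \<alpha> \<beta> * (pderivs (word \<alpha>) \<phi> x * pderivs (word \<beta>) \<phi> x))" for x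
          using ell[unfolded elliptic_coeffs_def, rule_format, of "\<lambda>\<alpha>. pderivs (word \<alpha>) \<phi> x"]
          unfolding Xf_def mis_def by (simp add: mult.assoc)
      qed (use iX iab in auto)
      also have "\<dots> = (\<Sum>\<alpha>\<in>mis. \<Sum>\<beta>\<in>mis. a \<alpha> \<beta> * (LBINT x. pderivs (word \<alpha>) \<phi> x * pderivs (word \<beta>) \<phi> x))"
        using iab by (simp add: Bochner_Integration.integral_sum)
      also have "\<dots> = T1 + T2 + T3"
        unfolding split T1_def T2_def T3_def by (simp add: distrib_left sum.distrib)
      finally show ?thesis .
    qed
    have ZXY: "Z \<le> W * D * Y + V * X"
    proof -
      have "Zf x \<le> W * D * Yf x + V * Xf x" for x
      proof -
        have "jet_sq m \<phi> x \<le> W * (D * Yf x)"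
          unfolding jet_sq_def W_def
        proof (rule sum_bounded_above)
          fix "is" :: "'n list" assume "is \<in> words m"
          then have l: "length is < m" by (simp add: words_def)
          have "(pderivs is \<phi> x)\<^sup>2 \<le> D * indicator K x * jet_sq (Suc (length is)) v x"
            unfolding \<phi>_def by (rule D(3)) (use l sv in auto)
          also have "\<dots> \<le> D * indicator K x * jet_sq m v x"
            using l D(1) by (intro mult_left_mono jet_sq_mono) auto
          also have "\<dots> \<le> D * Yf x" unfolding mult.assoc using D(1) jv by (intro mult_left_mono) auto
          finally show "(pderivs is \<phi> x)\<^sup>2 \<le> D * Yf x" .
        qed
        moreover have "(\<Sum>is | length is = m. (pderivs is \<phi> x)\<^sup>2) \<le> V * Xf x"
          unfolding V_def
        proof (rule sum_bounded_above)
          fix "is" :: "'n list" assume l: "is \<in> {is. length is = m}"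
          have "(pderivs is \<phi> x)\<^sup>2 = (pderivs (word (multi_index is)) \<phi> x)\<^sup>2"
            by (simp add: pderivs_multi_index s\<phi>)
          also have "\<dots> \<le> Xf x" unfolding Xf_def
            by (rule member_le_sum) (use l in \<open>auto simp: mis_def mi_order_multi_index\<close>)
          finally show "(pderivs is \<phi> x)\<^sup>2 \<le> Xf x" .
        qed
        ultimately show ?thesis unfolding Zf_def jet_sq_Suc by simp
      qed
      then have "Z \<le> (LBINT x. W * D * Yf x + V * Xf x)"
        unfolding Z_def by (intro integral_mono iZ) (use iX iY in auto)
      also have "\<dots> = W * D * Y + V * X" using iX iY by (simp add: X_def Y_def)
      finally show ?thesis .
    qed
    have "c * X \<le> T + (real (card mis))\<^sup>2 * M * T + (real (card mis))\<^sup>2 * M * T"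
      using en T1 T2 T3 by linarith
    also have "\<dots> = P * sqrt (Y * Z)"
      by (simp add: P_def T_def real_sqrt_mult algebra_simps)
    also have "\<dots> \<le> P * sqrt (Y * (W * D * Y + V * X))"
      using ZXY Y0 pos by (intro mult_left_mono real_sqrt_le_mono) auto
    finally have "X \<le> C5 * Y"
      unfolding C5_def by (intro absorb_inequality X0 Y0 pos c) (use pos D(1) in auto)
    then have ZY: "Z \<le> (W * D + V * C5) * Y"
      using ZXY mult_left_mono[of X "C5 * Y" V] pos by (simp add: algebra_simps)
    have "ball_int r (\<lambda>x. \<Sum>is | length is = m. (pderivs (is @ \<gamma>) w x)\<^sup>2) \<le> Z"
      unfolding ball_int_def Z_def
    proof (rule integral_mono[OF ball_integrable iZ])
      show "continuous_on UNIV (\<lambda>x. \<Sum>is | length is = m. (pderivs (is @ \<gamma>) w x)\<^sup>2)"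
        by (intro continuous_intros smooth_continuous_on smooth_pderivs sw)
      show "indicator (ball 0 r) x * (\<Sum>is | length is = m. (pderivs (is @ \<gamma>) w x)\<^sup>2) \<le> Zf x" for x
      proof (cases "x \<in> ball 0 r")
        case True
        have "pderivs (is @ \<gamma>) w x = pderivs is \<phi> x" for "is"
          unfolding pderivs_append v_def[symmetric]
          by (rule pderivs_cong_open[OF open_ball _ True]) (auto simp: \<phi>_def \<eta>(2))
        then show ?thesis using True by (simp add: Zf_def jet_sq_Suc)
      qed (use Z0 in auto)
    qed
    also note ZY
    also have "(W * D + V * C5) * Y \<le> (W * D + V * C5) * (ball_int R (jet_sq (m + length \<gamma>) w) + ball_int R (jet_sq (Suc l) g))"
    proof (rule mult_left_mono)
      note iR = ball_integrable[OF jet_sq_continuous[OF sw], of R "m + length \<gamma>"] ball_integrable[OF jet_sq_continuous[OF sg], of R "Suc l"]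
      have "Y \<le> (LBINT x. indicator (ball 0 R) x * jet_sq (m + length \<gamma>) w x + indicator (ball 0 R) x * jet_sq (Suc l) g x)"
        unfolding Y_def
      proof (rule integral_mono[OF iY])
        show "Yf x \<le> indicator (ball 0 R) x * jet_sq (m + length \<gamma>) w x + indicator (ball 0 R) x * jet_sq (Suc l) g x" for x
          using K(2) by (auto simp: Yf_def indicator_def)
      qed (use iR in auto)
      then show "Y \<le> ball_int R (jet_sq (m + length \<gamma>) w) + ball_int R (jet_sq (Suc l) g)"
        using iR by (simp add: ball_int_def)
    qed (use pos C5 D(1) in auto)
    finally show ?case .
  qed
qed

lemma ball_int_mono:
  assumes "continuous_on UNIV F" "continuous_on UNIV G" "r \<le> R" "\<And>x. F x \<le> G x" "\<And>x. 0 \<le> G x"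
  shows "ball_int r F \<le> ball_int R G"
  unfolding ball_int_def
  by (rule integral_mono[OF ball_integrable[OF assms(1)] ball_integrable[OF assms(2)]])
     (use assms(3,4,5) in \<open>auto simp: indicator_def\<close>)

text \<open>
  A derivative of order \<open>m + k\<close> is a derivative of order \<open>m\<close> of some derivative of order \<open>k\<close>.
\<close>

lemma gain_one_derivative:
  assumes m: "m \<ge> 1" and c: "c > 0" and M: "M \<ge> 0" and rR: "0 < r" "r < R" and k: "k \<le> m + l"
  shows "\<exists>C\<ge>0. \<forall>(a :: nat ^ 'n \<Rightarrow> nat ^ 'n \<Rightarrow> real) w g. smooth_solution m c M R a w g \<longrightarrow>
      ball_int r (jet_sq (Suc (m + k)) w) \<le> C * (ball_int R (jet_sq (m + k) w) + ball_int R (jet_sq (Suc l) g))"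
proof -
  define G where "G = {\<gamma> :: 'n list. length \<gamma> = k}"
  have "\<forall>\<gamma>\<in>G. \<exists>C\<ge>0. \<forall>(a :: nat ^ 'n \<Rightarrow> nat ^ 'n \<Rightarrow> real) w g. smooth_solution m c M R a w g \<longrightarrow>
      ball_int r (\<lambda>x. \<Sum>is | length is = m. (pderivs (is @ \<gamma>) w x)\<^sup>2)
        \<le> C * (ball_int R (jet_sq (m + length \<gamma>) w) + ball_int R (jet_sq (Suc l) g))"
    using gain_one_derivative_single[OF m c M rR] k by (auto simp: G_def)
  then obtain C where C: "\<And>\<gamma>. \<gamma> \<in> G \<Longrightarrow> C \<gamma> \<ge> 0"
    "\<And>\<gamma> a w g. \<gamma> \<in> G \<Longrightarrow> smooth_solution m c M R a w g \<Longrightarrow>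
      ball_int r (\<lambda>x. \<Sum>is | length is = m. (pderivs (is @ \<gamma>) w x)\<^sup>2)
        \<le> C \<gamma> * (ball_int R (jet_sq (m + length \<gamma>) w) + ball_int R (jet_sq (Suc l) g))"
    unfolding bchoice_iff by blast
  show ?thesis
  proof (rule exI[of _ "1 + (\<Sum>\<gamma>\<in>G. C \<gamma>)"], intro conjI allI impI, goal_cases)
    case 1 show ?case using C(1) by (simp add: sum_nonneg)
  next
    case (2 a w g)
    then have sw: "smooth w" and sg: "smooth g" by (auto simp: smooth_solution_def)
    define S where "S = ball_int R (jet_sq (m + k) w) + ball_int R (jet_sq (Suc l) g)"
    have nn: "0 \<le> ball_int R (jet_sq (Suc l) g)" by (simp add: ball_int_def)
    have "(\<Sum>is | length is = m + k. (pderivs is w x)\<^sup>2)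
        = (\<Sum>\<gamma>\<in>G. \<Sum>is | length is = m. (pderivs (is @ \<gamma>) w x)\<^sup>2)" for x
    proof -
      have "(\<Sum>\<gamma>\<in>G. \<Sum>is | length is = m. (pderivs (is @ \<gamma>) w x)\<^sup>2)
          = (\<Sum>(\<gamma>, is)\<in>G \<times> {is. length is = m}. (pderivs (is @ \<gamma>) w x)\<^sup>2)"
        by (rule sum.cartesian_product)
      also have "\<dots> = (\<Sum>is | length is = m + k. (pderivs is w x)\<^sup>2)"
        by (rule sum.reindex_bij_witness[of _ "\<lambda>is. (drop m is, take m is)" "\<lambda>(\<gamma>, is). is @ \<gamma>"])
           (auto simp: G_def simp del: pderivs_append)
      finally show ?thesis by simp
    qed
    then have e: "jet_sq (Suc (m + k)) w x = jet_sq (m + k) w x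
        + (\<Sum>\<gamma>\<in>G. \<Sum>is | length is = m. (pderivs (is @ \<gamma>) w x)\<^sup>2)" for x
      by (simp add: jet_sq_Suc)
    have i0: "integrable lborel (\<lambda>x. indicator (ball 0 r) x * jet_sq (m + k) w x)"
      by (rule ball_integrable[OF jet_sq_continuous[OF sw]])
    have i1: "integrable lborel (\<lambda>x. indicator (ball 0 r) x * (\<Sum>is | length is = m. (pderivs (is @ \<gamma>) w x)\<^sup>2))" for \<gamma>
      by (rule ball_integrable) (intro continuous_intros smooth_continuous_on smooth_pderivs sw)
    have "ball_int r (jet_sq (Suc (m + k)) w) = ball_int r (jet_sq (m + k) w)
        + (\<Sum>\<gamma>\<in>G. ball_int r (\<lambda>x. \<Sum>is | length is = m. (pderivs (is @ \<gamma>) w x)\<^sup>2))"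
      unfolding ball_int_def e distrib_left sum_distrib_left[of _ _ G]
      using i0 i1 by (simp add: Bochner_Integration.integral_sum)
    also have "\<dots> \<le> S + (\<Sum>\<gamma>\<in>G. C \<gamma> * S)"
    proof (intro add_mono sum_mono)
      have "ball_int r (jet_sq (m + k) w) \<le> ball_int R (jet_sq (m + k) w)"
        using rR by (intro ball_int_mono jet_sq_continuous sw) auto
      then show "ball_int r (jet_sq (m + k) w) \<le> S" using nn by (simp add: S_def)
      show "ball_int r (\<lambda>x. \<Sum>is | length is = m. (pderivs (is @ \<gamma>) w x)\<^sup>2) \<le> C \<gamma> * S" if "\<gamma> \<in> G" for \<gamma>
        using C(2)[OF that, of a w g] 2 that by (simp add: S_def G_def)
    qed
    also have "\<dots> = (1 + (\<Sum>\<gamma>\<in>G. C \<gamma>)) * S"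
      by (simp add: distrib_right sum_distrib_right)
    finally show ?case by (simp add: S_def)
  qed
qed

lemma smooth_solution_mono: "smooth_solution m c M R a w g \<Longrightarrow> R' \<le> R \<Longrightarrow> smooth_solution m c M R' a w g"
  unfolding smooth_solution_def solves_weakly_def by (meson subset_ball test_functions_mono)

text \<open>
  The gain of one derivative costs a slightly larger ball. Each step of the iteration uses up
  half of the remaining distance between the radii.
\<close>

lemma interior_estimate:
  assumes m: "m \<ge> 1" and c: "c > 0" and M: "M \<ge> 0" and rR: "0 < r" "r < R" and k: "k \<le> m + l"
  shows "\<exists>C\<ge>0. \<forall>(a :: nat ^ 'n \<Rightarrow> nat ^ 'n \<Rightarrow> real) w g. smooth_solution m c M R a w g \<longrightarrow>
      ball_int r (jet_sq (Suc (m + k)) w) \<le> C * (ball_int R (jet_sq (Suc m) w) + ball_int R (jet_sq (Suc l) g))"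
  using rR k
proof (induction k arbitrary: r)
  case 0
  show ?case
  proof (rule exI[of _ 1], intro conjI allI impI, goal_cases)
    case (2 a w g)
    have "ball_int r (jet_sq (Suc (m + 0)) w) \<le> ball_int R (jet_sq (Suc m) w)"
      using 0 2 by (intro ball_int_mono jet_sq_continuous) (auto simp: smooth_solution_def)
    moreover have "0 \<le> ball_int R (jet_sq (Suc l) g)" by (simp add: ball_int_def)
    ultimately show ?case by simp
  qed simp
next
  case (Suc k)
  define s where "s = (r + R) / 2"
  have s: "0 < s" "r < s" "s < R" using Suc.prems by (auto simp: s_def)
  obtain C1 where C1: "C1 \<ge> 0" "\<And>(a :: nat ^ 'n \<Rightarrow> nat ^ 'n \<Rightarrow> real) w g. smooth_solution m c M R a w g \<Longrightarrow>
      ball_int s (jet_sq (Suc (m + k)) w) \<le> C1 * (ball_int R (jet_sq (Suc m) w) + ball_int R (jet_sq (Suc l) g))"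
    using Suc.IH[OF s(1,3)] Suc.prems by auto
  obtain C2 where C2: "C2 \<ge> 0" "\<And>(a :: nat ^ 'n \<Rightarrow> nat ^ 'n \<Rightarrow> real) w g. smooth_solution m c M s a w g \<Longrightarrow>
      ball_int r (jet_sq (Suc (m + Suc k)) w) \<le> C2 * (ball_int s (jet_sq (m + Suc k) w) + ball_int s (jet_sq (Suc l) g))"
    using gain_one_derivative[OF m c M Suc.prems(1) s(2) Suc.prems(3)] by blast
  show ?case
  proof (rule exI[of _ "C2 * (C1 + 1)"], intro conjI allI impI, goal_cases)
    case 1 show ?case using C1(1) C2(1) by simp
  next
    case (2 a w g)
    then have sw: "smooth w" and sg: "smooth g" by (auto simp: smooth_solution_def)
    define T where "T = ball_int R (jet_sq (Suc m) w) + ball_int R (jet_sq (Suc l) g)"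
    have nn: "0 \<le> ball_int R (jet_sq (Suc m) w)" by (simp add: ball_int_def)
    have "ball_int s (jet_sq (Suc l) g) \<le> ball_int R (jet_sq (Suc l) g)"
      using s by (intro ball_int_mono jet_sq_continuous sg) auto
    then have "ball_int s (jet_sq (Suc l) g) \<le> T" using nn by (simp add: T_def)
    moreover have "ball_int s (jet_sq (m + Suc k) w) \<le> C1 * T"
      using C1(2)[of a w g] 2 by (simp add: T_def)
    ultimately have "ball_int s (jet_sq (m + Suc k) w) + ball_int s (jet_sq (Suc l) g) \<le> (C1 + 1) * T"
      by (simp add: distrib_right)
    moreover have "smooth_solution m c M s a w g" using 2 s smooth_solution_mono by (metis less_imp_le)
    ultimately show ?case
      using C2(2)[of a w g] 2 mult_left_mono[OF _ C2(1)] unfolding T_def[symmetric] mult.assoc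
      by (meson order_trans)
  qed
qed

section \<open>Functionals on test functions that are bounded in the square norm\<close>

text \<open>
  The argument of Riesz and Fischer. The sum of \<open>4^n * (f (Suc n) x - f n x)\<^sup>2\<close> has a finite
  integral, so it is finite for almost all \<open>x\<close>. For these \<open>x\<close> the increments of \<open>f n x\<close> are of order
  \<open>2^-n\<close>, which gives pointwise convergence, and Fatou's lemma bounds the distance to the limit.
\<close>

lemma L2_fast_Cauchy_limit:
  fixes f :: "nat \<Rightarrow> 'a \<Rightarrow> real"
  assumes [measurable]: "\<And>n. f n \<in> borel_measurable M"
    and i: "\<And>n p. integrable M (\<lambda>x. (f p x - f n x)\<^sup>2)"
    and b: "\<And>n p. n \<le> p \<Longrightarrow> (\<integral>x. (f p x - f n x)\<^sup>2 \<partial>M) \<le> (1 / 16) ^ n"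
  defines "g \<equiv> (\<lambda>x. lim (\<lambda>n. f n x))"
  shows "g \<in> borel_measurable M"
    and "integrable M (\<lambda>x. (g x - f n x)\<^sup>2)"
    and "(\<integral>x. (g x - f n x)\<^sup>2 \<partial>M) \<le> (1 / 16) ^ n"
proof -
  show g[measurable]: "g \<in> borel_measurable M" unfolding g_def by measurable
  have "(\<integral>\<^sup>+x. (\<Sum>n. ennreal (4 ^ n * (f (Suc n) x - f n x)\<^sup>2)) \<partial>M) = (\<Sum>n. \<integral>\<^sup>+x. ennreal (4 ^ n * (f (Suc n) x - f n x)\<^sup>2) \<partial>M)"
    by (rule nn_integral_suminf) simp
  also have "\<dots> \<le> (\<Sum>n. ennreal ((1 / 4) ^ n))"
  proof (rule suminf_le)
    show "(\<integral>\<^sup>+x. ennreal (4 ^ n * (f (Suc n) x - f n x)\<^sup>2) \<partial>M) \<le> ennreal ((1 / 4) ^ n)" for n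
    proof -
      have "(\<integral>\<^sup>+x. ennreal (4 ^ n * (f (Suc n) x - f n x)\<^sup>2) \<partial>M) = ennreal (4 ^ n * (\<integral>x. (f (Suc n) x - f n x)\<^sup>2 \<partial>M))"
        using i by (subst nn_integral_eq_integral) auto
      also have "\<dots> \<le> ennreal (4 ^ n * (1 / 16) ^ n)"
        using b[of n "Suc n"] by (intro ennreal_leI mult_left_mono) auto
      also have "4 ^ n * (1 / 16) ^ n = (1 / 4 :: real) ^ n"
        by (simp flip: power_mult_distrib)
      finally show ?thesis .
    qed
  qed auto
  also have "\<dots> < \<infinity>"
    by (subst suminf_ennreal2) (auto simp: summable_geometric)
  finally have "AE x in M. (\<Sum>n. ennreal (4 ^ n * (f (Suc n) x - f n x)\<^sup>2)) \<noteq> \<infinity>"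
    by (intro nn_integral_PInf_AE) auto
  then have conv: "AE x in M. (\<lambda>n. f n x) \<longlonglongrightarrow> g x"
  proof eventually_elim
    fix x assume fin: "(\<Sum>n. ennreal (4 ^ n * (f (Suc n) x - f n x)\<^sup>2)) \<noteq> \<infinity>"
    have "summable (\<lambda>n. 4 ^ n * (f (Suc n) x - f n x)\<^sup>2)"
      by (rule summable_suminf_not_top) (use fin in auto)
    then have "bounded (range (\<lambda>n. 4 ^ n * (f (Suc n) x - f n x)\<^sup>2))"
      by (intro convergent_imp_bounded) (rule summable_LIMSEQ_zero)
    then obtain C where C: "\<And>n. \<bar>4 ^ n * (f (Suc n) x - f n x)\<^sup>2\<bar> \<le> C"
      by (auto simp: bounded_iff)
    have "\<bar>f (Suc n) x - f n x\<bar> \<le> sqrt C * (1 / 2) ^ n" for n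
    proof -
      have "(2 ^ n * \<bar>f (Suc n) x - f n x\<bar>)\<^sup>2 \<le> C"
      proof -
        have "(2 ^ n)\<^sup>2 = (4 :: real) ^ n" by (simp add: power2_eq_square flip: power_mult_distrib)
        then show ?thesis using C[of n] by (simp add: power_mult_distrib)
      qed
      then have "2 ^ n * \<bar>f (Suc n) x - f n x\<bar> \<le> sqrt C" by (rule real_le_rsqrt)
      then show ?thesis by (simp add: power_divide field_simps)
    qed
    then have le: "norm (f (Suc n) x - f n x) \<le> sqrt C * (1 / 2) ^ n" for n by simp
    have "summable (\<lambda>n. sqrt C * (1 / 2) ^ n)"
      by (intro summable_mult summable_geometric) simp
    then have "summable (\<lambda>n. f (Suc n) x - f n x)"
      by (rule summable_comparison_test'[where N = 0]) (rule le)
    then have "convergent (\<lambda>n. \<Sum>k<n. f (Suc k) x - f k x)"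
      by (simp add: summable_iff_convergent)
    then have "convergent (\<lambda>n. f n x - f 0 x)" by (simp only: sum_lessThan_telescope[of "\<lambda>n. f n x"])
    then have "convergent (\<lambda>n. (f n x - f 0 x) + f 0 x)"
      by (intro convergent_add convergent_const)
    then show "(\<lambda>n. f n x) \<longlonglongrightarrow> g x" by (simp add: g_def convergent_LIMSEQ_iff)
  qed
  have nn: "(\<integral>\<^sup>+x. ennreal ((g x - f n x)\<^sup>2) \<partial>M) \<le> ennreal ((1 / 16) ^ n)"
  proof -
    have "(\<integral>\<^sup>+x. ennreal ((g x - f n x)\<^sup>2) \<partial>M) = (\<integral>\<^sup>+x. liminf (\<lambda>p. ennreal ((f p x - f n x)\<^sup>2)) \<partial>M)"
    proof (rule nn_integral_cong_AE, use conv in eventually_elim)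
      fix x assume "(\<lambda>n. f n x) \<longlonglongrightarrow> g x"
      then have "(\<lambda>p. ennreal ((f p x - f n x)\<^sup>2)) \<longlonglongrightarrow> ennreal ((g x - f n x)\<^sup>2)"
        by (intro tendsto_intros) auto
      then show "ennreal ((g x - f n x)\<^sup>2) = liminf (\<lambda>p. ennreal ((f p x - f n x)\<^sup>2))"
        by (metis lim_imp_Liminf sequentially_bot)
    qed
    also have "\<dots> \<le> liminf (\<lambda>p. \<integral>\<^sup>+x. ennreal ((f p x - f n x)\<^sup>2) \<partial>M)"
      by (rule nn_integral_liminf) simp
    also have "\<dots> \<le> ennreal ((1 / 16) ^ n)"
    proof (rule Liminf_le)
      show "\<forall>\<^sub>F p in sequentially. (\<integral>\<^sup>+x. ennreal ((f p x - f n x)\<^sup>2) \<partial>M) \<le> ennreal ((1 / 16) ^ n)"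
        unfolding eventually_sequentially
        by (intro exI[of _ n] allI impI, subst nn_integral_eq_integral) (auto intro: i b ennreal_leI)
    qed simp
    finally show ?thesis .
  qed
  show int: "integrable M (\<lambda>x. (g x - f n x)\<^sup>2)"
    by (rule integrableI_bounded) (use nn in \<open>auto intro: le_less_trans\<close>)
  show "(\<integral>x. (g x - f n x)\<^sup>2 \<partial>M) \<le> (1 / 16) ^ n"
    using nn int by (subst (asm) nn_integral_eq_integral) auto
qed

lemma test_function_square_integrable: "\<psi> \<in> test_functions U \<Longrightarrow> integrable lborel (\<lambda>x. (\<psi> x)\<^sup>2)"
  using test_function_integrable[OF test_function_mult[of \<psi> \<psi> U]]
  by (simp add: power2_eq_square test_function_smooth)

text \<open>
  The representing function is the limit of a minimising sequence of \<open>\<integral> \<phi>\<^sup>2 - 2 * \<L> \<phi>\<close>. By the parallelogram law such a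
  sequence is a Cauchy sequence. Along the line from a member of this
  sequence in the direction of a test function, the functional is a quadratic polynomial that is almost
  minimal at 0. So its linear coefficient is small, and this identifies the limit.
\<close>

lemma Riesz_representation_test_functions:
  fixes \<L> :: "(real ^ 'n \<Rightarrow> real) \<Rightarrow> real"
  assumes add: "\<And>\<phi> \<psi>. \<phi> \<in> test_functions U \<Longrightarrow> \<psi> \<in> test_functions U \<Longrightarrow> \<L> (\<lambda>x. \<phi> x + \<psi> x) = \<L> \<phi> + \<L> \<psi>"
    and scale: "\<And>\<phi> c. \<phi> \<in> test_functions U \<Longrightarrow> \<L> (\<lambda>x. c * \<phi> x) = c * \<L> \<phi>"
    and bound: "\<And>\<phi>. \<phi> \<in> test_functions U \<Longrightarrow> \<bar>\<L> \<phi>\<bar> \<le> K * sqrt (LBINT x. (\<phi> x)\<^sup>2)"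
  obtains g where "g \<in> borel_measurable borel" "\<And>x. x \<notin> U \<Longrightarrow> g x = 0"
    "integrable lborel (\<lambda>x. (g x)\<^sup>2)" "(LBINT x. (g x)\<^sup>2) \<le> K\<^sup>2"
    "\<And>\<phi>. \<phi> \<in> test_functions U \<Longrightarrow> \<L> \<phi> = (LBINT x. g x * \<phi> x)"
proof -
  define Q where "Q = (\<lambda>\<phi>::real^'n\<Rightarrow>real. LBINT x. (\<phi> x)\<^sup>2)"
  define J where "J = (\<lambda>\<phi>. Q \<phi> - 2 * \<L> \<phi>)"
  have Q0: "0 \<le> Q \<phi>" for \<phi> by (simp add: Q_def)
  have low: "2 * \<L> \<phi> - Q \<phi> \<le> K\<^sup>2" if "\<phi> \<in> test_functions U" for \<phi>
  proof -
    have "2 * \<L> \<phi> \<le> 2 * (K * sqrt (Q \<phi>))" using bound[OF that] by (simp add: Q_def)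
    moreover have "2 * (K * sqrt (Q \<phi>)) \<le> K\<^sup>2 + Q \<phi>"
      using sum_squares_bound[of K "sqrt (Q \<phi>)"] Q0[of \<phi>] by simp
    ultimately show ?thesis by linarith
  qed
  define d where "d = Inf (J ` test_functions U)"
  have bb: "bdd_below (J ` test_functions U)"
    unfolding bdd_below_def by (intro exI[of _ "- K\<^sup>2"]) (use low in \<open>auto simp: J_def algebra_simps\<close>)
  have dJ: "d \<le> J \<phi>" if "\<phi> \<in> test_functions U" for \<phi>
    unfolding d_def by (rule cInf_lower) (use that bb in auto)
  \<comment> \<open>The gap is chosen such that the parallelogram law gives the rate of the preceding lemma.\<close>
  have "\<exists>\<phi>\<in>test_functions U. J \<phi> < d + (1 / 16) ^ n / 4" for n :: nat
  proof -
    have "J ` test_functions U \<noteq> {}" using test_function_zero by blast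
    then show ?thesis
      using cInf_lessD[of "J ` test_functions U" "d + (1 / 16) ^ n / 4"] unfolding d_def by auto
  qed
  then obtain \<psi> where \<psi>: "\<And>n. \<psi> n \<in> test_functions U" "\<And>n. J (\<psi> n) < d + (1 / 16) ^ n / 4" by metis
  have i2: "integrable lborel (\<lambda>x. (\<phi> x)\<^sup>2)" if "\<phi> \<in> test_functions U" for \<phi>
    using that by (rule test_function_square_integrable)
  have i11: "integrable lborel (\<lambda>x. \<phi> x * \<phi>' x)" if "\<phi> \<in> test_functions U" "\<phi>' \<in> test_functions U" for \<phi> \<phi>'
    using test_function_integrable[OF test_function_mult[of \<phi> \<phi>' U]] that by (simp add: test_function_smooth)
  have bm: "\<phi> \<in> borel_measurable borel" if "\<phi> \<in> test_functions U" for \<phi>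
    using that by (simp add: test_function_smooth smooth_borel_measurable)
  have Qadd: "Q (\<lambda>x. \<phi> x + t * \<phi>' x) = Q \<phi> + 2 * t * (LBINT x. \<phi> x * \<phi>' x) + t\<^sup>2 * Q \<phi>'"
    if "\<phi> \<in> test_functions U" "\<phi>' \<in> test_functions U" for \<phi> \<phi>' t
  proof -
    have "Q (\<lambda>x. \<phi> x + t * \<phi>' x) = (LBINT x. (\<phi> x)\<^sup>2 + 2 * t * (\<phi> x * \<phi>' x) + t\<^sup>2 * (\<phi>' x)\<^sup>2)"
      unfolding Q_def by (intro Bochner_Integration.integral_cong) (auto simp: power2_eq_square algebra_simps)
    then show ?thesis using i2 i11 that by (simp add: Q_def)
  qed
  have Ladd: "\<L> (\<lambda>x. \<phi> x + t * \<phi>' x) = \<L> \<phi> + t * \<L> \<phi>'" 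
    if "\<phi> \<in> test_functions U" "\<phi>' \<in> test_functions U" for \<phi> \<phi>' t
    using add[OF that(1) test_function_cmult[OF that(2)]] scale[OF that(2)] by simp
  have arith: "q - 2 * i + r \<le> en"
    if "e \<le> (q + 2 * i + r) / 4 - (s + t)" "q - 2 * s < e + ep / 4" "r - 2 * t < e + en / 4" "ep \<le> en"
    for e q i r s t ep en :: real
    using that by (simp add: field_simps)
  have cauchy: "(LBINT x. (\<psi> p x - \<psi> n x)\<^sup>2) \<le> (1 / 16) ^ n" if "n \<le> p" for n p
  proof -
    have mid: "(\<lambda>x. (1/2) * (\<psi> p x + 1 * \<psi> n x)) \<in> test_functions U"
      using test_function_cmult[OF test_function_add[OF \<psi>(1)[of p] \<psi>(1)[of n]], of "1/2"] by simp
    define I where "I = (LBINT x. \<psi> p x * \<psi> n x)"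
    have "J (\<lambda>x. (1/2) * (\<psi> p x + 1 * \<psi> n x))
        = Q (\<lambda>x. \<psi> p x + 1 * \<psi> n x) / 4 - \<L> (\<lambda>x. \<psi> p x + 1 * \<psi> n x)"
      unfolding J_def
      using scale[OF test_function_add[OF \<psi>(1)[of p] \<psi>(1)[of n]], of "1/2"]
      by (simp add: Q_def power_mult_distrib power_divide)
    also have "\<dots> = (Q (\<psi> p) + 2 * I + Q (\<psi> n)) / 4 - (\<L> (\<psi> p) + \<L> (\<psi> n))"
      unfolding Qadd[OF \<psi>(1)[of p] \<psi>(1)[of n], of 1] Ladd[OF \<psi>(1)[of p] \<psi>(1)[of n], of 1]
      by (simp add: I_def)
    finally have 1: "d \<le> (Q (\<psi> p) + 2 * I + Q (\<psi> n)) / 4 - (\<L> (\<psi> p) + \<L> (\<psi> n))"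
      using dJ[OF mid] by simp
    have 2: "(LBINT x. (\<psi> p x - \<psi> n x)\<^sup>2) = Q (\<psi> p) - 2 * I + Q (\<psi> n)"
      using Qadd[OF \<psi>(1)[of p] \<psi>(1)[of n], of "-1"] by (simp add: Q_def I_def)
    have "(1 / 16 :: real) ^ p \<le> (1 / 16) ^ n" using that by (intro power_decreasing) auto
    from arith[OF 1 \<psi>(2)[of p, unfolded J_def] \<psi>(2)[of n, unfolded J_def] this] 2
    show ?thesis by simp
  qed
  define g where "g = (\<lambda>x. lim (\<lambda>n. \<psi> n x))"
  have idiff: "integrable lborel (\<lambda>x. (\<psi> p x - \<psi> n x)\<^sup>2)" for n p
    by (rule i2[OF test_function_diff[OF \<psi>(1) \<psi>(1)]])
  have mpsi: "\<psi> n \<in> borel_measurable lborel" for n using bm[OF \<psi>(1)] by simp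
  note lim0 = L2_fast_Cauchy_limit[of \<psi> lborel, OF mpsi idiff cauchy]
  have lim: "g \<in> borel_measurable lborel" "integrable lborel (\<lambda>x. (g x - \<psi> n x)\<^sup>2)"
    "(LBINT x. (g x - \<psi> n x)\<^sup>2) \<le> (1 / 16) ^ n" for n
    unfolding g_def by (rule lim0; assumption)+
  have [measurable]: "g \<in> borel_measurable borel" using lim(1) by simp
  have ig2: "integrable lborel (\<lambda>x. (g x)\<^sup>2)"
  proof (rule Bochner_Integration.integrable_bound)
    show "integrable lborel (\<lambda>x. 2 * ((g x - \<psi> 0 x)\<^sup>2 + (\<psi> 0 x)\<^sup>2))"
      using lim(2)[of 0] i2[OF \<psi>(1)] by simp
    have "(g x)\<^sup>2 \<le> 2 * ((g x - \<psi> 0 x)\<^sup>2 + (\<psi> 0 x)\<^sup>2)" for x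
      using square_sum2_le[of "g x - \<psi> 0 x" "\<psi> 0 x"] by simp
    then show "AE x in lborel. norm ((g x)\<^sup>2) \<le> norm (2 * ((g x - \<psi> 0 x)\<^sup>2 + (\<psi> 0 x)\<^sup>2))"
      by (intro AE_I2) simp
  qed measurable
  have rep: "\<L> \<phi> = (LBINT x. g x * \<phi> x)" if \<phi>: "\<phi> \<in> test_functions U" for \<phi>
  proof -
    have [measurable]: "\<phi> \<in> borel_measurable borel" "\<psi> n \<in> borel_measurable borel" for n using bm \<phi> \<psi>(1) by auto
    have igp: "integrable lborel (\<lambda>x. g x * \<phi> x)"
      by (rule integrable_product_of_squares) (use ig2 i2[OF \<phi>] in auto)
    have close: "\<bar>(LBINT x. g x * \<phi> x) - \<L> \<phi>\<bar> \<le> 2 * sqrt (Q \<phi>) * (1 / 4) ^ n" for n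
    proof -
      have "((LBINT x. \<psi> n x * \<phi> x) - \<L> \<phi>)\<^sup>2 \<le> (1 / 16) ^ n / 4 * Q \<phi>"
      proof (rule nonneg_quadratic_discriminant[OF _ Q0])
        fix t
        have "(\<lambda>x. \<psi> n x + t * \<phi> x) \<in> test_functions U"
          by (intro test_function_add test_function_cmult \<psi> \<phi>)
        from dJ[OF this] \<psi>(2)[of n]
        show "0 \<le> (1 / 16) ^ n / 4 + 2 * t * ((LBINT x. \<psi> n x * \<phi> x) - \<L> \<phi>) + t\<^sup>2 * Q \<phi>"
          unfolding J_def Qadd[OF \<psi>(1) \<phi>] Ladd[OF \<psi>(1) \<phi>] by (simp add: algebra_simps)
      qed
      also have "\<dots> \<le> (1 / 16) ^ n * Q \<phi>" using Q0[of \<phi>] by (intro mult_right_mono) auto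
      finally have 1: "\<bar>(LBINT x. \<psi> n x * \<phi> x) - \<L> \<phi>\<bar> \<le> sqrt ((1 / 16) ^ n * Q \<phi>)"
        by (intro real_le_rsqrt) simp
      have "(LBINT x. g x * \<phi> x) - (LBINT x. \<psi> n x * \<phi> x) = (LBINT x. (g x - \<psi> n x) * \<phi> x)"
        using igp i11[OF \<psi>(1) \<phi>] by (simp add: left_diff_distrib)
      moreover have "(LBINT x. (g x - \<psi> n x) * \<phi> x)\<^sup>2 \<le> (1 / 16) ^ n * Q \<phi>"
      proof (rule order_trans)
        show "(LBINT x. (g x - \<psi> n x) * \<phi> x)\<^sup>2 \<le> (LBINT x. (g x - \<psi> n x)\<^sup>2) * Q \<phi>"
          unfolding Q_def by (rule integral_Cauchy_Schwarz) (use lim(2) i2[OF \<phi>] in auto)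
        show "(LBINT x. (g x - \<psi> n x)\<^sup>2) * Q \<phi> \<le> (1 / 16) ^ n * Q \<phi>"
          by (intro mult_right_mono lim(3) Q0)
      qed
      ultimately have 2: "\<bar>(LBINT x. g x * \<phi> x) - (LBINT x. \<psi> n x * \<phi> x)\<bar> \<le> sqrt ((1 / 16) ^ n * Q \<phi>)"
        by (intro real_le_rsqrt) simp
      have "(1 / 16 :: real) ^ n = ((1 / 4) ^ n)\<^sup>2"
        by (simp add: power2_eq_square flip: power_mult_distrib)
      then have "sqrt ((1 / 16) ^ n * Q \<phi>) = (1 / 4) ^ n * sqrt (Q \<phi>)"
        by (simp add: real_sqrt_mult)
      with 1 2 show ?thesis by (simp add: algebra_simps)
    qed
    have "(\<lambda>n. 2 * sqrt (Q \<phi>) * (1 / 4 :: real) ^ n) \<longlonglongrightarrow> 2 * sqrt (Q \<phi>) * 0"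
      by (intro tendsto_intros LIMSEQ_power_zero) auto
    then have "\<bar>(LBINT x. g x * \<phi> x) - \<L> \<phi>\<bar> \<le> 2 * sqrt (Q \<phi>) * 0"
      by (rule LIMSEQ_le_const) (use close in auto)
    then show ?thesis by simp
  qed
  have "(LBINT x. (g x)\<^sup>2) \<le> (1 / 16) ^ n + K\<^sup>2" for n
  proof -
    have [measurable]: "\<psi> n \<in> borel_measurable borel" using bm \<psi>(1) by auto
    have ip: "integrable lborel (\<lambda>x. g x * \<psi> n x)"
      by (rule integrable_product_of_squares) (use ig2 i2[OF \<psi>(1)] in auto)
    have "(LBINT x. (g x)\<^sup>2) = (LBINT x. (g x - \<psi> n x)\<^sup>2 + 2 * (g x * \<psi> n x) - (\<psi> n x)\<^sup>2)"
      by (intro Bochner_Integration.integral_cong) (auto simp: power2_eq_square algebra_simps)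
    also have "\<dots> = (LBINT x. (g x - \<psi> n x)\<^sup>2) + 2 * \<L> (\<psi> n) - Q (\<psi> n)"
      using lim(2)[of n] ip i2[OF \<psi>(1)[of n]] by (simp add: rep[OF \<psi>(1)] Q_def)
    also have "\<dots> \<le> (1 / 16) ^ n + K\<^sup>2"
      using lim(3)[of n] low[OF \<psi>(1)[of n]] by linarith
    finally show ?thesis .
  qed
  moreover have "(\<lambda>n. (1 / 16 :: real) ^ n + K\<^sup>2) \<longlonglongrightarrow> 0 + K\<^sup>2"
    by (intro tendsto_intros LIMSEQ_power_zero) auto
  ultimately have "(LBINT x. (g x)\<^sup>2) \<le> 0 + K\<^sup>2"
    by (intro LIMSEQ_le_const) auto
  moreover have "g x = 0" if "x \<notin> U" for x
  proof -
    have "\<psi> n x = 0" for n using \<psi>(1)[of n] that by (auto simp: test_functions_iff)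
    then show ?thesis by (simp add: g_def limI)
  qed
  ultimately show thesis using that[of g] ig2 rep by simp
qed

section \<open>Borel representatives\<close>

text \<open>
  Fubini's theorem applies to Borel functions, whereas elements of the Sobolev spaces are
  Lebesgue measurable on \<open>U\<close>. They are therefore replaced by Borel functions that vanish outside
  \<open>U\<close>, and all integrals by integrals over the whole space.
\<close>

lemma borel_representative:
  fixes f :: "real ^ 'n \<Rightarrow> real"
  assumes f: "f \<in> borel_measurable (lebesgue_on U)" and U: "U \<in> sets borel"
  obtains f' where "f' \<in> borel_measurable borel" "\<And>x. x \<notin> U \<Longrightarrow> f' x = 0"
    "AE x in lborel. x \<in> U \<longrightarrow> f x = f' x"
proof -
  have "(\<lambda>x. if x \<in> U then f x else 0) \<in> borel_measurable lebesgue"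
    by (rule borel_measurable_if_I[OF f]) (use U in simp)
  then obtain h where h: "h \<in> borel_measurable lborel" "AE x in lborel. (if x \<in> U then f x else 0) = h x"
    using completion_ex_borel_measurable_real by blast
  show thesis
  proof (rule that[of "\<lambda>x. indicator U x * h x"])
    show "(\<lambda>x. indicator U x * h x) \<in> borel_measurable borel" using h(1) U by simp
    show "AE x in lborel. x \<in> U \<longrightarrow> f x = indicator U x * h x"
      using h(2) by eventually_elim (auto split: if_splits)
  qed auto
qed

text \<open>
  Measurability of \<open>f\<close> is a conclusion, because Lebesgue measure is complete.
\<close>

lemma lebesgue_on_transfer:
  fixes f f' :: "real ^ 'n \<Rightarrow> real"
  assumes U: "U \<in> sets borel"
    and f': "f' \<in> borel_measurable borel" "\<And>x. x \<notin> U \<Longrightarrow> f' x = 0" "AE x in lborel. x \<in> U \<longrightarrow> f x = f' x"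
  shows "f \<in> borel_measurable (lebesgue_on U)"
    and "integral\<^sup>L (lebesgue_on U) f = (LBINT x. f' x)"
    and "integrable (lebesgue_on U) f \<longleftrightarrow> integrable lborel f'"
proof -
  have m': "f' \<in> borel_measurable lebesgue"
    by (rule measurable_completion) (use f'(1) in simp)
  have ae: "AE x in lebesgue. f' x = indicator U x *\<^sub>R f x"
    by (rule AE_completion) (use f'(3) in eventually_elim, use f'(2) in \<open>auto simp: indicator_def\<close>)
  have m: "(\<lambda>x. indicator U x *\<^sub>R f x) \<in> borel_measurable lebesgue"
    by (rule borel_measurable_AE[OF m' ae])
  then show "f \<in> borel_measurable (lebesgue_on U)"
    unfolding indicator_scaleR_eq_if by (rule borel_measurable_if_D)
  have U': "U \<inter> space lebesgue \<in> sets lebesgue" using U by simp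
  have "integral\<^sup>L (lebesgue_on U) f = (\<integral>x. indicator U x *\<^sub>R f x \<partial>lebesgue)"
    by (rule integral_restrict_space[OF U'])
  also have "\<dots> = (\<integral>x. f' x \<partial>lebesgue)" by (rule integral_cong_AE[OF m' m ae, symmetric])
  also have "\<dots> = (LBINT x. f' x)" by (rule integral_completion) (use f'(1) in simp)
  finally show "integral\<^sup>L (lebesgue_on U) f = (LBINT x. f' x)" .
  have "integrable (lebesgue_on U) f \<longleftrightarrow> integrable lebesgue (\<lambda>x. indicator U x *\<^sub>R f x)"
    by (rule integrable_restrict_space[OF U'])
  also have "\<dots> \<longleftrightarrow> integrable lebesgue f'" by (rule integrable_cong_AE[OF m' m ae, symmetric])
  also have "\<dots> \<longleftrightarrow> integrable lborel f'" by (rule integrable_completion) (use f'(1) in simp)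
  finally show "integrable (lebesgue_on U) f \<longleftrightarrow> integrable lborel f'" .
qed

section \<open>The fundamental lemma of the calculus of variations\<close>

text \<open>
  Cutoff functions that are 1 on \<open>K\<close> and whose supports shrink to \<open>K\<close> converge to the indicator
  function of \<open>K\<close>. A compact neighbourhood of \<open>K\<close>, on which \<open>g\<close> is integrable, provides the
  dominating function.
\<close>

lemma integral_compact_eq_0:
  fixes g :: "real ^ 'n \<Rightarrow> real"
  assumes U: "open U" and g: "locally_integrable U g"
    and z: "\<And>\<psi>. \<psi> \<in> test_functions U \<Longrightarrow> integral\<^sup>L (lebesgue_on U) (\<lambda>x. g x * \<psi> x) = 0"
    and K: "compact K" "K \<subseteq> U"
  shows "integral\<^sup>L (lebesgue_on K) g = 0"
proof -
  obtain d where d: "d > 0" "(\<Union>x\<in>K. cball x d) \<subseteq> U"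
    using compact_subset_open_imp_cball_epsilon_subset[OF K(1) U K(2)] by blast
  define L where "L = thicken K d"
  have cL: "compact L" unfolding L_def by (rule compact_thicken[OF K(1)])
  have inL: "y \<in> L" if "x \<in> K" "dist x y \<le> d" for x y
    using that by (auto simp: L_def thicken_def)
  have LU: "L \<subseteq> U" using d(2) by (simp add: L_def thicken_def UN_subset_iff cball_def subset_iff)
  have KL: "K \<subseteq> L" using inL d(1) by force
  have bL: "L \<in> sets borel" and bK: "K \<in> sets borel" using cL K(1) by (auto intro: borel_compact)
  have iL: "integrable (lebesgue_on L) g"
    using g cL LU by (auto simp: locally_integrable_def)
  then have mL: "g \<in> borel_measurable (lebesgue_on L)" by auto
  obtain g' where g': "g' \<in> borel_measurable borel" "\<And>x. x \<notin> L \<Longrightarrow> g' x = 0" "AE x in lborel. x \<in> L \<longrightarrow> g x = g' x"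
    by (rule borel_representative[OF mL bL]) (rule that)
  have ig': "integrable lborel g'" using lebesgue_on_transfer(3)[OF bL g'] iL by simp
  define V where "V = (\<lambda>n::nat. \<Union>x\<in>K. ball x (d / Suc n))"
  have KV: "K \<subseteq> V n" for n using d(1) by (force simp: V_def)
  have VL: "V n \<subseteq> L" for n
  proof
    fix y assume "y \<in> V n"
    then obtain x where x: "x \<in> K" "dist x y < d / Suc n" by (auto simp: V_def)
    have "d / Suc n \<le> d" using d(1) by (simp add: divide_le_eq)
    with x show "y \<in> L" by (intro inL[of x]) auto
  qed
  have "\<exists>\<psi>\<in>test_functions (V n). (\<forall>x\<in>K. \<psi> x = 1) \<and> (\<forall>x. 0 \<le> \<psi> x) \<and> (\<forall>x. \<psi> x \<le> 1)" for n
    using cutoff_exists[OF K(1) _ KV[of n]] unfolding V_def by (metis open_UN open_ball)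
  then obtain \<psi> where \<psi>: "\<And>n. \<psi> n \<in> test_functions (V n)" "\<And>n x. x \<in> K \<Longrightarrow> \<psi> n x = 1"
    "\<And>n x. 0 \<le> \<psi> n x" "\<And>n x. \<psi> n x \<le> 1" by metis
  have m\<psi>: "\<psi> n \<in> borel_measurable borel" for n
    by (rule smooth_borel_measurable[OF test_function_smooth[OF \<psi>(1)]])
  have \<psi>0: "\<psi> n x = 0" if "x \<notin> V n" for n x using \<psi>(1)[of n] that by (auto simp: test_functions_iff)
  have zero: "(LBINT x. g' x * \<psi> n x) = 0" for n
  proof -
    have "\<psi> n x = 0" if "x \<notin> L" for x using \<psi>0 VL that by blast
    then have "(\<lambda>x. indicator U x *\<^sub>R (g x * \<psi> n x)) = (\<lambda>x. indicator L x *\<^sub>R (g x * \<psi> n x))"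
      using LU by (auto simp: fun_eq_iff indicator_def)
    then have "integral\<^sup>L (lebesgue_on U) (\<lambda>x. g x * \<psi> n x) = integral\<^sup>L (lebesgue_on L) (\<lambda>x. g x * \<psi> n x)"
      using U bL by (simp add: integral_restrict_space)
    also have "\<dots> = (LBINT x. g' x * \<psi> n x)"
    proof (rule lebesgue_on_transfer(2)[OF bL])
      show "AE x in lborel. x \<in> L \<longrightarrow> g x * \<psi> n x = g' x * \<psi> n x"
        using g'(3) by eventually_elim auto
    qed (use g' m\<psi> in auto)
    finally show ?thesis
      using z[OF test_functions_mono[OF \<psi>(1) order_trans[OF VL LU]]] by simp
  qed
  have "(\<lambda>n. LBINT x. g' x * \<psi> n x) \<longlonglongrightarrow> (LBINT x. g' x * indicator K x)"
  proof (rule integral_dominated_convergence[where w = "\<lambda>x. \<bar>g' x\<bar>"])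
    show "AE x in lborel. (\<lambda>n. g' x * \<psi> n x) \<longlonglongrightarrow> g' x * indicator K x"
    proof (rule AE_I2)
      fix x
      have "\<forall>\<^sub>F n in sequentially. \<psi> n x = indicator K x"
      proof (cases "x \<in> K")
        case False
        then obtain e where e: "e > 0" "ball x e \<subseteq> - K"
          using K(1) by (metis ComplI compact_imp_closed open_Compl open_contains_ball)
        have "(\<lambda>n. d * inverse (real (Suc n))) \<longlonglongrightarrow> d * 0"
          by (intro tendsto_mult tendsto_const LIMSEQ_inverse_real_of_nat)
        then have "\<forall>\<^sub>F n in sequentially. d * inverse (real (Suc n)) < e"
          using e(1) by (auto dest: order_tendstoD)
        then show ?thesis
        proof eventually_elim
          case (elim n)
          have "x \<notin> V n"
          proof
            assume "x \<in> V n"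
            then obtain y where "y \<in> K" "dist x y < e"
              using elim by (auto simp: V_def dist_commute divide_inverse)
            with e(2) show False by auto
          qed
          then show ?case using \<psi>0 False by simp
        qed
      qed (simp add: \<psi>)
      then show "(\<lambda>n. g' x * \<psi> n x) \<longlonglongrightarrow> g' x * indicator K x"
        by (intro tendsto_mult tendsto_const tendsto_eventually)
    qed
    show "AE x in lborel. norm (g' x * \<psi> n x) \<le> \<bar>g' x\<bar>" for n
      using \<psi>(3,4)[of n] by (intro AE_I2) (auto simp: abs_mult mult_left_le)
  qed (use g'(1) m\<psi> bK ig' in auto)
  then have "(LBINT x. g' x * indicator K x) = 0"
    unfolding zero by (simp add: LIMSEQ_const_iff)
  moreover have "integral\<^sup>L (lebesgue_on K) g = (LBINT x. g' x * indicator K x)"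
    by (rule lebesgue_on_transfer(2)[OF bK])
       (use g' bK KL in \<open>auto elim: eventually_mono\<close>)
  ultimately show ?thesis by simp
qed

text \<open>
  A closed subset of the set where \<open>g\<close> is positive is null, as \<open>g\<close> has integral 0 over it. By inner
  regularity the whole set is null.
\<close>

lemma AE_nonpos_if_compact_integrals_0:
  fixes g :: "real ^ 'n \<Rightarrow> real"
  assumes L: "compact L" and i: "integrable (lebesgue_on L) g"
    and z: "\<And>K. compact K \<Longrightarrow> K \<subseteq> L \<Longrightarrow> integral\<^sup>L (lebesgue_on K) g = 0"
  shows "AE x in lborel. x \<in> L \<longrightarrow> g x \<le> 0"
proof -
  have bL: "L \<in> sets borel" using L by (rule borel_compact)
  have mL: "g \<in> borel_measurable (lebesgue_on L)" using i by auto
  obtain g' where g': "g' \<in> borel_measurable borel" "\<And>x. x \<notin> L \<Longrightarrow> g' x = 0" "AE x in lborel. x \<in> L \<longrightarrow> g x = g' x"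
    by (rule borel_representative[OF mL bL]) (rule that)
  note [measurable] = g'(1) bL
  have ig': "integrable lborel g'" using lebesgue_on_transfer(3)[OF bL g'] i by simp
  define A where "A = {x. g' x > 0}"
  have mA[measurable]: "A \<in> sets borel" unfolding A_def by measurable
  have null: "emeasure lborel K = 0" if K: "closed K" "K \<subseteq> A" for K
  proof -
    have KL: "K \<subseteq> L" using K(2) g'(2) by (force simp: A_def)
    have cK: "compact K" using compact_Int_closed[OF L K(1)] KL by (simp add: inf.absorb2)
    have bK[measurable]: "K \<in> sets borel" using cK by (rule borel_compact)
    have "(LBINT x. g' x * indicator K x) = integral\<^sup>L (lebesgue_on K) g"
      by (intro lebesgue_on_transfer(2)[symmetric] bK)
         (use g' KL in \<open>auto elim: eventually_mono\<close>)
    then have "(LBINT x. g' x * indicator K x) = 0" using z[OF cK KL] by simp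
    moreover have "integrable lborel (\<lambda>x. g' x * indicator K x)"
      using integrable_mult_indicator[OF _ ig', of K] by (simp add: mult.commute)
    moreover have "0 \<le> g' x * indicator K x" for x using K(2) by (auto simp: A_def indicator_def intro: less_imp_le)
    ultimately have "AE x in lborel. g' x * indicator K x = 0"
      by (subst (asm) integral_nonneg_eq_0_iff_AE) auto
    then have "AE x in lborel. x \<notin> K"
      by eventually_elim (use K(2) in \<open>force simp: A_def indicator_def\<close>)
    then show ?thesis using AE_iff_measurable[of K lborel "\<lambda>x. x \<notin> K"] by simp
  qed
  have "emeasure lborel A \<le> ennreal e" if "e > 0" for e
  proof -
    obtain T where T: "closed T" "T \<subseteq> A" "A - T \<in> lmeasurable" "emeasure lebesgue (A - T) < ennreal e"
      using sets_lebesgue_inner_closed[of A e] mA \<open>e > 0\<close> by auto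
    have [measurable]: "T \<in> sets borel" using T(1) by simp
    have "emeasure lborel A \<le> emeasure lborel T + emeasure lborel (A - T)"
      by (rule order_trans[OF emeasure_mono emeasure_subadditive]) auto
    also have "\<dots> \<le> ennreal e" using null[OF T(1,2)] T(4) by simp
    finally show ?thesis .
  qed
  note eps = this
  have "emeasure lborel A \<le> 0"
    by (rule ennreal_le_epsilon) (simp add: eps)
  then have "AE x in lborel. x \<notin> A"
    using AE_iff_measurable[of A lborel "\<lambda>x. x \<notin> A"] by simp
  with g'(3) show ?thesis by eventually_elim (auto simp: A_def)
qed

lemma fundamental_lemma:
  fixes g :: "real ^ 'n \<Rightarrow> real"
  assumes U: "open U" and g: "locally_integrable U g"
    and z: "\<And>\<psi>. \<psi> \<in> test_functions U \<Longrightarrow> integral\<^sup>L (lebesgue_on U) (\<lambda>x. g x * \<psi> x) = 0"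
  shows "AE x in lborel. x \<in> U \<longrightarrow> g x = 0"
proof -
  obtain C where C: "\<And>n::nat. compact (C n)" "\<And>n. C n \<subseteq> U" "\<Union>(range C) = U"
    using open_Union_compact_subsets[OF U] by metis
  have "AE x in lborel. x \<in> C n \<longrightarrow> g x = 0" for n
  proof -
    have i: "integrable (lebesgue_on (C n)) g" using g C by (simp add: locally_integrable_def)
    have "AE x in lborel. x \<in> C n \<longrightarrow> g x \<le> 0"
      by (rule AE_nonpos_if_compact_integrals_0[OF C(1) i])
         (use C(2) integral_compact_eq_0[OF U g z] in blast)
    moreover have "AE x in lborel. x \<in> C n \<longrightarrow> - g x \<le> 0"
    proof (rule AE_nonpos_if_compact_integrals_0[OF C(1)])
      show "integrable (lebesgue_on (C n)) (\<lambda>x. - g x)" using i by simp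
      show "integral\<^sup>L (lebesgue_on K) (\<lambda>x. - g x) = 0" if "compact K" "K \<subseteq> C n" for K
        using integral_compact_eq_0[OF U g z that(1)] that C(2)[of n] by auto
    qed
    ultimately show ?thesis by eventually_elim auto
  qed
  then have "AE x in lborel. \<forall>n. x \<in> C n \<longrightarrow> g x = 0" unfolding AE_all_countable by blast
  then show ?thesis by eventually_elim (use C(3) in auto)
qed

section \<open>Weak derivatives and Sobolev functions\<close>

lemma test_function_mult_integrable_on:
  fixes g :: "real ^ 'n \<Rightarrow> real"
  assumes U: "open U" and g: "locally_integrable U g" and \<psi>: "\<psi> \<in> test_functions U"
  shows "integrable (lebesgue_on U) (\<lambda>x. g x * \<psi> x)"
proof -
  from \<psi> obtain K where K: "smooth \<psi>" "compact K" "K \<subseteq> U" "\<And>x. x \<notin> K \<Longrightarrow> \<psi> x = 0"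
    by (rule test_functionE) (rule that)
  obtain B where B: "B > 0" "\<And>x. \<bar>\<psi> x\<bar> \<le> B" using test_function_bounded[OF \<psi>] by metis
  have iK: "integrable (lebesgue_on K) g" using g K by (simp add: locally_integrable_def)
  have bK: "K \<in> sets borel" using K(2) by (rule borel_compact)
  have le: "norm (g x * \<psi> x) \<le> norm (B * g x)" for x
    using mult_right_mono[OF B(2)[of x], of "\<bar>g x\<bar>"] B(1) by (simp add: abs_mult mult.commute)
  have "\<psi> \<in> borel_measurable (lebesgue_on K)"
    by (intro measurable_restrict_space1 measurable_completion)
       (use smooth_borel_measurable[OF K(1)] in simp)
  then have "integrable (lebesgue_on K) (\<lambda>x. g x * \<psi> x)"
    using iK by (intro Bochner_Integration.integrable_bound[OF _ _ AE_I2[OF le]]) auto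
  moreover have "(\<lambda>x. indicator U x *\<^sub>R (g x * \<psi> x)) = (\<lambda>x. indicator K x *\<^sub>R (g x * \<psi> x))"
    using K(3,4) by (auto simp: fun_eq_iff indicator_def)
  ultimately show ?thesis
    using U bK by (simp add: integrable_restrict_space)
qed

text \<open>
  Uniqueness is indispensable: \<open>weak_deriv\<close> is an arbitrary choice, so nothing is known about it,
  including its square integrability, until it is compared with a known weak derivative.
\<close>

lemma has_weak_deriv_unique:
  fixes u :: "real ^ 'n \<Rightarrow> real"
  assumes U: "open U" and g: "has_weak_deriv U \<alpha> u g" and h: "has_weak_deriv U \<alpha> u h"
  shows "AE x in lborel. x \<in> U \<longrightarrow> g x = h x"
proof -
  have lg: "locally_integrable U g" and lh: "locally_integrable U h"
    using g h by (auto simp: has_weak_deriv_def)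
  have "AE x in lborel. x \<in> U \<longrightarrow> g x - h x = 0"
  proof (rule fundamental_lemma[OF U])
    show "locally_integrable U (\<lambda>x. g x - h x)"
      using lg lh by (auto simp: locally_integrable_def)
    fix \<psi> :: "real ^ 'n \<Rightarrow> real" assume \<psi>: "\<psi> \<in> test_functions U"
    have "integral\<^sup>L (lebesgue_on U) (\<lambda>x. u x * mi_deriv \<alpha> \<psi> x)
        = (-1) ^ mi_order \<alpha> * integral\<^sup>L (lebesgue_on U) (\<lambda>x. g x * \<psi> x)"
      using g \<psi> unfolding has_weak_deriv_def by blast
    moreover have "integral\<^sup>L (lebesgue_on U) (\<lambda>x. u x * mi_deriv \<alpha> \<psi> x)
        = (-1) ^ mi_order \<alpha> * integral\<^sup>L (lebesgue_on U) (\<lambda>x. h x * \<psi> x)"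
      using h \<psi> unfolding has_weak_deriv_def by blast
    ultimately have "integral\<^sup>L (lebesgue_on U) (\<lambda>x. g x * \<psi> x) = integral\<^sup>L (lebesgue_on U) (\<lambda>x. h x * \<psi> x)"
      by simp
    then show "integral\<^sup>L (lebesgue_on U) (\<lambda>x. (g x - h x) * \<psi> x) = 0"
      using test_function_mult_integrable_on[OF U lg \<psi>] test_function_mult_integrable_on[OF U lh \<psi>]
      by (simp add: left_diff_distrib)
  qed
  then show ?thesis by eventually_elim auto
qed

lemma has_weak_deriv_weak_deriv: "has_weak_deriv U \<alpha> u g \<Longrightarrow> has_weak_deriv U \<alpha> u (weak_deriv U \<alpha> u)"
  unfolding weak_deriv_def by (rule someI[of "has_weak_deriv U \<alpha> u" g])

lemma weak_deriv_AE_eq: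
  "open U \<Longrightarrow> has_weak_deriv U \<alpha> u g \<Longrightarrow> AE x in lborel. x \<in> U \<longrightarrow> weak_deriv U \<alpha> u x = g x"
  by (rule has_weak_deriv_unique) (auto intro: has_weak_deriv_weak_deriv)

lemma L2_representative:
  fixes f :: "real ^ 'n \<Rightarrow> real"
  assumes f: "f \<in> L2_space U" and U: "U \<in> sets borel" "bounded U"
  obtains f' where "f' \<in> borel_measurable borel" "\<And>x. x \<notin> U \<Longrightarrow> f' x = 0"
    "AE x in lborel. x \<in> U \<longrightarrow> f x = f' x" "integrable lborel (\<lambda>x. (f' x)\<^sup>2)" "integrable lborel f'"
    "(L2_norm_on U f)\<^sup>2 = (LBINT x. (f' x)\<^sup>2)"
proof -
  have mf: "f \<in> borel_measurable (lebesgue_on U)" and i: "integrable (lebesgue_on U) (\<lambda>x. (f x)\<^sup>2)"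
    using f by (auto simp: L2_space_def)
  obtain f' where f': "f' \<in> borel_measurable borel" "\<And>x. x \<notin> U \<Longrightarrow> f' x = 0" "AE x in lborel. x \<in> U \<longrightarrow> f x = f' x"
    by (rule borel_representative[OF mf U(1)]) (rule that)
  have sq: "AE x in lborel. x \<in> U \<longrightarrow> (f x)\<^sup>2 = (f' x)\<^sup>2" using f'(3) by eventually_elim auto
  have [measurable]: "(\<lambda>x. (f' x)\<^sup>2) \<in> borel_measurable borel" "f' \<in> borel_measurable borel" using f'(1) by auto
  note tr = lebesgue_on_transfer[OF U(1) this(1) _ sq]
  have i2: "integrable lborel (\<lambda>x. (f' x)\<^sup>2)" using tr(3) i f'(2) by simp
  have fin: "emeasure lborel U < \<infinity>" using emeasure_bounded_finite[OF U(2)] .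
  have "integrable lborel f'"
  proof (rule Bochner_Integration.integrable_bound)
    show "integrable lborel (\<lambda>x. (f' x)\<^sup>2 + indicator U x)" using i2 fin U(1) by simp
    show "AE x in lborel. norm (f' x) \<le> norm ((f' x)\<^sup>2 + indicator U x)"
    proof (rule AE_I2)
      fix x
      have "2 * \<bar>f' x\<bar> * 1 \<le> \<bar>f' x\<bar>\<^sup>2 + 1\<^sup>2" by (rule sum_squares_bound)
      then have "\<bar>f' x\<bar> \<le> (f' x)\<^sup>2 + 1" by simp
      then show "norm (f' x) \<le> norm ((f' x)\<^sup>2 + indicator U x)"
        using f'(2)[of x] by (cases "x \<in> U") auto
    qed
  qed measurable
  moreover have "(L2_norm_on U f)\<^sup>2 = (LBINT x. (f' x)\<^sup>2)"
    using tr(2) f'(2) by (simp add: L2_norm_on_def)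
  ultimately show thesis using that f' i2 by blast
qed

lemma L2_spaceI:
  fixes f :: "real ^ 'n \<Rightarrow> real"
  assumes U: "U \<in> sets borel"
    and f': "f' \<in> borel_measurable borel" "\<And>x. x \<notin> U \<Longrightarrow> f' x = 0"
    "AE x in lborel. x \<in> U \<longrightarrow> f x = f' x" "integrable lborel (\<lambda>x. (f' x)\<^sup>2)"
  shows "f \<in> L2_space U" "(L2_norm_on U f)\<^sup>2 = (LBINT x. (f' x)\<^sup>2)"
proof -
  have sq: "AE x in lborel. x \<in> U \<longrightarrow> (f x)\<^sup>2 = (f' x)\<^sup>2" using f'(3) by eventually_elim auto
  have m: "(\<lambda>x. (f' x)\<^sup>2) \<in> borel_measurable borel" using f'(1) by auto
  note tr = lebesgue_on_transfer[OF U m _ sq]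
  show "f \<in> L2_space U"
    using lebesgue_on_transfer(1)[OF U f'(1,2,3)] tr(3) f'(2,4) by (simp add: L2_space_def)
  show "(L2_norm_on U f)\<^sup>2 = (LBINT x. (f' x)\<^sup>2)"
    using tr(2) f'(2) by (simp add: L2_norm_on_def)
qed

lemma integrable_imp_locally_integrable:
  fixes f :: "real ^ 'n \<Rightarrow> real"
  assumes f': "integrable lborel f'" "AE x in lborel. x \<in> U \<longrightarrow> f x = f' x"
  shows "locally_integrable U f"
  unfolding locally_integrable_def
proof (intro allI impI)
  fix K :: "(real ^ 'n) set" assume "compact K \<and> K \<subseteq> U"
  then have bK: "K \<in> sets borel" and KU: "K \<subseteq> U" by (auto intro: borel_compact)
  have "integrable lborel (\<lambda>x. indicator K x *\<^sub>R f' x)"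
    by (rule integrable_mult_indicator) (use bK f' in auto)
  moreover have "integrable (lebesgue_on K) f \<longleftrightarrow> integrable lborel (\<lambda>x. indicator K x *\<^sub>R f' x)"
    by (rule lebesgue_on_transfer(3)[OF bK])
       (use f' bK KU in \<open>auto elim: eventually_mono\<close>)
  ultimately show "integrable (lebesgue_on K) f" by simp
qed

lemma integral_on_test_product:
  fixes f f' \<theta> :: "real ^ 'n \<Rightarrow> real"
  assumes U: "U \<in> sets borel" and f': "f' \<in> borel_measurable borel" "AE x in lborel. x \<in> U \<longrightarrow> f x = f' x"
    and \<theta>: "\<theta> \<in> borel_measurable borel" "\<And>x. x \<notin> U \<Longrightarrow> \<theta> x = 0"
  shows "integral\<^sup>L (lebesgue_on U) (\<lambda>x. f x * \<theta> x) = (LBINT x. f' x * \<theta> x)"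
  by (rule lebesgue_on_transfer(2)[OF U]) (use f' \<theta> in \<open>auto elim: eventually_mono\<close>)

lemma test_function_eq_0: "\<psi> \<in> test_functions U \<Longrightarrow> x \<notin> U \<Longrightarrow> \<psi> x = 0"
  by (auto simp: test_functions_iff)

lemma test_function_borel: "\<psi> \<in> test_functions U \<Longrightarrow> \<psi> \<in> borel_measurable borel"
  by (simp add: smooth_borel_measurable test_function_smooth)

lemma has_weak_deriv_test_function:
  assumes U: "open U" and \<phi>: "\<phi> \<in> test_functions U"
  shows "has_weak_deriv U \<alpha> \<phi> (pderivs (word \<alpha>) \<phi>)"
  unfolding has_weak_deriv_def mi_deriv_eq_pderivs
proof (intro conjI ballI)
  show "locally_integrable U \<phi>" "locally_integrable U (pderivs (word \<alpha>) \<phi>)"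
    by (rule integrable_imp_locally_integrable[where f' = \<phi>]
         integrable_imp_locally_integrable[where f' = "pderivs (word \<alpha>) \<phi>"];
        use \<phi> in \<open>auto intro: test_function_integrable test_function_pderivs\<close>)+
  fix \<psi> assume \<psi>: "\<psi> \<in> test_functions U"
  have bU: "U \<in> sets borel" using U by simp
  have "integral\<^sup>L (lebesgue_on U) (\<lambda>x. \<phi> x * pderivs (word \<alpha>) \<psi> x) = (LBINT x. \<phi> x * pderivs (word \<alpha>) \<psi> x)"
    by (rule integral_on_test_product[OF bU])
       (use \<phi> \<psi> in \<open>auto intro: test_function_borel test_function_pderivs test_function_eq_0\<close>)
  moreover have "integral\<^sup>L (lebesgue_on U) (\<lambda>x. pderivs (word \<alpha>) \<phi> x * \<psi> x) = (LBINT x. pderivs (word \<alpha>) \<phi> x * \<psi> x)"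
    by (rule integral_on_test_product[OF bU])
       (use \<phi> \<psi> in \<open>auto intro: test_function_borel test_function_pderivs test_function_eq_0\<close>)
  moreover have "\<psi> \<in> test_functions UNIV" using \<psi> test_functions_mono by blast
  ultimately show "integral\<^sup>L (lebesgue_on U) (\<lambda>x. \<phi> x * pderivs (word \<alpha>) \<psi> x) =
      (-1) ^ mi_order \<alpha> * integral\<^sup>L (lebesgue_on U) (\<lambda>x. pderivs (word \<alpha>) \<phi> x * \<psi> x)"
    using integral_by_parts[OF test_function_smooth[OF \<phi>], of \<psi> "word \<alpha>"]
    by (simp add: length_word power_mult_distrib[symmetric] mult.assoc[symmetric])
qed

lemma test_function_in_L2_space:
  assumes "open U" "\<phi> \<in> test_functions U"
  shows "\<phi> \<in> L2_space U"
  by (rule L2_spaceI(1)[of U \<phi>])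
     (use assms in \<open>auto intro: test_function_borel test_function_eq_0 test_function_square_integrable\<close>)

lemma sobolev_norm_zero:
  assumes "open U"
  shows "sobolev_norm k U (\<lambda>x. 0) = 0"
proof -
  have "(L2_norm_on U (weak_deriv U \<alpha> (\<lambda>x. 0)))\<^sup>2 = 0" for \<alpha>
  proof -
    have "AE x in lborel. x \<in> U \<longrightarrow> weak_deriv U \<alpha> (\<lambda>x. 0) x = (\<lambda>x. 0) x"
      using weak_deriv_AE_eq[OF assms has_weak_deriv_test_function[OF assms test_function_zero]] by simp
    from L2_spaceI(2)[of U "\<lambda>x. 0", OF _ _ _ this] assms show ?thesis by simp
  qed
  then show ?thesis by (simp add: sobolev_norm_def)
qed

lemma test_function_in_sobolev0:
  assumes U: "open U" and \<phi>: "\<phi> \<in> test_functions U"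
  shows "\<phi> \<in> sobolev0 k U"
proof -
  have "\<phi> \<in> sobolev k U"
    unfolding sobolev_def using test_function_in_L2_space[OF U] has_weak_deriv_test_function[OF U \<phi>] \<phi>
    by (auto intro: test_function_pderivs)
  moreover have "\<exists>\<psi>\<in>test_functions U. sobolev_norm k U (\<lambda>x. \<phi> x - \<psi> x) < \<epsilon>" if "\<epsilon> > 0" for \<epsilon>
    using that \<phi> sobolev_norm_zero[OF U] by (intro bexI[of _ \<phi>]) auto
  ultimately show ?thesis by (simp add: sobolev0_def)
qed

lemma integrable_mult_test_function:
  assumes v: "integrable lborel v" and \<psi>: "\<psi> \<in> test_functions U"
  shows "integrable lborel (\<lambda>x. v x * \<psi> x)"
proof -
  obtain B where B: "B > 0" "\<And>x. \<bar>\<psi> x\<bar> \<le> B" using test_function_bounded[OF \<psi>] by metis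
  show ?thesis
    by (rule Bochner_Integration.integrable_bound[of _ "\<lambda>x. B * v x"])
       (use v B test_function_borel[OF \<psi>] in \<open>auto simp: abs_mult mult.commute[of "\<bar>v _\<bar>"] intro!: AE_I2 mult_right_mono\<close>)
qed

text \<open>
  Borel functions on the whole space that stand for a Sobolev function on \<open>U\<close> and for its weak
  derivatives.
\<close>

definition weak_derivs ::
  "nat \<Rightarrow> (real ^ 'n) set \<Rightarrow> (real ^ 'n \<Rightarrow> real) \<Rightarrow> (nat ^ 'n \<Rightarrow> real ^ 'n \<Rightarrow> real) \<Rightarrow> bool" where
  "weak_derivs k U u v \<longleftrightarrow> integrable lborel u \<and> (\<forall>x. x \<notin> U \<longrightarrow> u x = 0) \<and>
     (\<forall>\<alpha>. mi_order \<alpha> \<le> k \<longrightarrow> integrable lborel (v \<alpha>) \<and> integrable lborel (\<lambda>x. (v \<alpha> x)\<^sup>2) \<and>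
       (\<forall>\<psi>\<in>test_functions U. (LBINT x. u x * pderivs (word \<alpha>) \<psi> x)
          = (-1) ^ mi_order \<alpha> * (LBINT x. v \<alpha> x * \<psi> x)))"

lemma sobolev_representatives:
  fixes u :: "real ^ 'n \<Rightarrow> real"
  assumes u: "u \<in> sobolev k U" and U: "open U" "bounded U"
  obtains u' v where "weak_derivs k U u' v" "AE x in lborel. x \<in> U \<longrightarrow> u x = u' x"
    "integrable lborel (\<lambda>x. (u' x)\<^sup>2)"
    "\<And>\<alpha>. mi_order \<alpha> \<le> k \<Longrightarrow> AE x in lborel. x \<in> U \<longrightarrow> weak_deriv U \<alpha> u x = v \<alpha> x"
    "(sobolev_norm k U u)\<^sup>2 = (\<Sum>\<alpha> | mi_order \<alpha> \<le> k. LBINT x. (v \<alpha> x)\<^sup>2)"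
proof -
  have bU: "U \<in> sets borel" using U by simp
  have uL2: "u \<in> L2_space U" using u by (simp add: sobolev_def)
  obtain u' where u': "u' \<in> borel_measurable borel" "\<And>x. x \<notin> U \<Longrightarrow> u' x = 0"
    "AE x in lborel. x \<in> U \<longrightarrow> u x = u' x" "integrable lborel (\<lambda>x. (u' x)\<^sup>2)" "integrable lborel u'"
    by (rule L2_representative[OF uL2 bU U(2)]) (rule that)
  define rep where "rep = (\<lambda>\<alpha> v. v \<in> borel_measurable borel \<and> integrable lborel v \<and> integrable lborel (\<lambda>x. (v x)\<^sup>2) \<and>
      (AE x in lborel. x \<in> U \<longrightarrow> weak_deriv U \<alpha> u x = v x) \<and>
      (L2_norm_on U (weak_deriv U \<alpha> u))\<^sup>2 = (LBINT x. (v x)\<^sup>2) \<and>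
      (\<forall>\<psi>\<in>test_functions U. (LBINT x. u' x * pderivs (word \<alpha>) \<psi> x)
          = (-1) ^ mi_order \<alpha> * (LBINT x. v x * \<psi> x)))"
  have "\<exists>v. rep \<alpha> v" if k: "mi_order \<alpha> \<le> k" for \<alpha>
  proof -
    obtain g where g: "g \<in> L2_space U" "has_weak_deriv U \<alpha> u g" using u k unfolding sobolev_def by blast
    obtain v where v: "v \<in> borel_measurable borel" "\<And>x. x \<notin> U \<Longrightarrow> v x = 0"
      "AE x in lborel. x \<in> U \<longrightarrow> g x = v x" "integrable lborel (\<lambda>x. (v x)\<^sup>2)" "integrable lborel v"
      by (rule L2_representative[OF g(1) bU U(2)]) (rule that)
    have ae: "AE x in lborel. x \<in> U \<longrightarrow> weak_deriv U \<alpha> u x = v x"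
      using weak_deriv_AE_eq[OF U(1) g(2)] v(3) by eventually_elim auto
    have "(LBINT x. u' x * pderivs (word \<alpha>) \<psi> x) = (-1) ^ mi_order \<alpha> * (LBINT x. v x * \<psi> x)"
      if \<psi>: "\<psi> \<in> test_functions U" for \<psi>
    proof -
      have "integral\<^sup>L (lebesgue_on U) (\<lambda>x. u x * pderivs (word \<alpha>) \<psi> x) = (LBINT x. u' x * pderivs (word \<alpha>) \<psi> x)"
        by (rule integral_on_test_product[OF bU u'(1,3)])
           (use \<psi> in \<open>auto intro: test_function_borel test_function_pderivs test_function_eq_0\<close>)
      moreover have "integral\<^sup>L (lebesgue_on U) (\<lambda>x. g x * \<psi> x) = (LBINT x. v x * \<psi> x)"
        by (rule integral_on_test_product[OF bU v(1,3)])
           (use \<psi> in \<open>auto intro: test_function_borel test_function_eq_0\<close>)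
      ultimately show ?thesis
        using g(2) \<psi> by (simp add: has_weak_deriv_def mi_deriv_eq_pderivs)
    qed
    then show ?thesis using v ae L2_spaceI(2)[OF bU v(1,2) ae v(4)] unfolding rep_def by blast
  qed
  then obtain v where "\<And>\<alpha>. mi_order \<alpha> \<le> k \<Longrightarrow> rep \<alpha> (v \<alpha>)" by metis
  note v = this[unfolded rep_def]
  show thesis
  proof (rule that[of u' v])
    show "weak_derivs k U u' v" using u' v by (auto simp: weak_derivs_def)
    show "AE x in lborel. x \<in> U \<longrightarrow> weak_deriv U \<alpha> u x = v \<alpha> x" if "mi_order \<alpha> \<le> k" for \<alpha>
      using v[OF that] by blast
    show "(sobolev_norm k U u)\<^sup>2 = (\<Sum>\<alpha> | mi_order \<alpha> \<le> k. LBINT x. (v \<alpha> x)\<^sup>2)"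
      using v by (simp add: sobolev_norm_def sum_nonneg)
  qed (use u' in auto)
qed

section \<open>Mollified weak solutions\<close>

text \<open>
  The function \<open>\<lambda>y. \<rho> (x - y)\<close> is a test function on \<open>U\<close>, against which the definition of the weak
  derivative can be evaluated.
\<close>

lemma pderivs_conv_weak_deriv:
  assumes wd: "weak_derivs k U u v" and m: "mollifier \<epsilon> \<rho>" and k: "mi_order \<alpha> \<le> k"
    and x: "cball x \<epsilon> \<subseteq> U"
  shows "pderivs (word \<alpha>) (conv \<rho> u) x = conv \<rho> (v \<alpha>) x"
proof -
  note t = mollifier_test[OF m]
  have iu: "integrable lborel u" using wd by (simp add: weak_derivs_def)
  define \<psi> where "\<psi> = (\<lambda>y. \<rho> (x + (-1) *\<^sub>R y))"
  have d: "pderivs (word \<alpha>) \<psi> y = (-1) ^ mi_order \<alpha> * pderivs (word \<alpha>) \<rho> (x - y)" for y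
    unfolding \<psi>_def using smooth_affine(2)[OF test_function_smooth[OF t], of "word \<alpha>" x "-1"]
    by (simp add: length_word)
  have \<psi>: "\<psi> \<in> test_functions U"
  proof (rule test_functionI[of _ "cball x \<epsilon>"])
    show "smooth \<psi>" unfolding \<psi>_def by (rule smooth_affine(1)[OF test_function_smooth[OF t]])
    show "\<psi> y = 0" if "y \<notin> cball x \<epsilon>" for y
      using that m by (auto simp: \<psi>_def mollifier_def dist_norm)
  qed (use x in auto)
  have "pderivs (word \<alpha>) (conv \<rho> u) x = (LBINT y. pderivs (word \<alpha>) \<rho> (x - y) * u y)"
    by (simp add: pderivs_conv[OF t iu] conv_def)
  also have "\<dots> = (LBINT y. (-1) ^ mi_order \<alpha> * (u y * pderivs (word \<alpha>) \<psi> y))"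
    by (intro Bochner_Integration.integral_cong) (simp_all add: d mult_ac power_mult_distrib[symmetric])
  also have "\<dots> = (-1) ^ mi_order \<alpha> * (LBINT y. u y * pderivs (word \<alpha>) \<psi> y)"
    by (rule integral_mult_right_zero)
  also have "(LBINT y. u y * pderivs (word \<alpha>) \<psi> y) = (-1) ^ mi_order \<alpha> * (LBINT y. v \<alpha> y * \<psi> y)"
    using wd k \<psi> unfolding weak_derivs_def by blast
  also have "(-1) ^ mi_order \<alpha> * \<dots> = (LBINT y. v \<alpha> y * \<psi> y)"
    by (simp add: mult.assoc[symmetric] power_mult_distrib[symmetric])
  also have "\<dots> = conv \<rho> (v \<alpha>) x" by (simp add: conv_def \<psi>_def mult.commute)
  finally show ?thesis .
qed

lemma mollified_jet_bound:
  fixes u :: "real ^ 'n \<Rightarrow> real"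
  assumes wd: "weak_derivs k U u v" and m: "mollifier \<epsilon> \<rho>"
    and sub: "\<And>x. x \<in> ball 0 R \<Longrightarrow> cball x \<epsilon> \<subseteq> U"
  shows "ball_int R (jet_sq (Suc k) (conv \<rho> u))
     \<le> real (card (words (Suc k) :: 'n list set)) * (\<Sum>\<alpha> | mi_order \<alpha> \<le> k. LBINT x. (v \<alpha> x)\<^sup>2)"
proof -
  note t = mollifier_test[OF m]
  have iu: "integrable lborel u" using wd by (simp add: weak_derivs_def)
  have s: "smooth (conv \<rho> u)" by (rule smooth_conv[OF t iu])
  have i: "integrable lborel (\<lambda>x. indicator (ball 0 R) x * (pderivs is (conv \<rho> u) x)\<^sup>2)" for "is"
    by (rule ball_integrable) (intro continuous_intros smooth_continuous_on smooth_pderivs s)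
  have "ball_int R (jet_sq (Suc k) (conv \<rho> u))
     = (\<Sum>is\<in>words (Suc k). LBINT x. indicator (ball 0 R) x * (pderivs is (conv \<rho> u) x)\<^sup>2)"
    unfolding ball_int_def jet_sq_def sum_distrib_left by (rule Bochner_Integration.integral_sum) (rule i)
  also have "\<dots> \<le> real (card (words (Suc k) :: 'n list set)) * (\<Sum>\<alpha> | mi_order \<alpha> \<le> k. LBINT x. (v \<alpha> x)\<^sup>2)"
  proof (rule sum_bounded_above)
    fix "is" :: "'n list" assume "is \<in> words (Suc k)"
    then have o: "mi_order (multi_index is) \<le> k" by (simp add: words_def mi_order_multi_index)
    define \<alpha> where "\<alpha> = multi_index is"
    have v: "integrable lborel (v \<alpha>)" "integrable lborel (\<lambda>x. (v \<alpha> x)\<^sup>2)"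
      using wd o by (auto simp: weak_derivs_def \<alpha>_def)
    have "(LBINT x. indicator (ball 0 R) x * (pderivs is (conv \<rho> u) x)\<^sup>2) \<le> (LBINT x. (conv \<rho> (v \<alpha>) x)\<^sup>2)"
    proof (rule integral_mono[OF i mollifier_conv_L2(1)[OF m v]])
      show "indicator (ball 0 R) x * (pderivs is (conv \<rho> u) x)\<^sup>2 \<le> (conv \<rho> (v \<alpha>) x)\<^sup>2" for x
      proof (cases "x \<in> ball 0 R")
        case True
        have "pderivs is (conv \<rho> u) x = pderivs (word \<alpha>) (conv \<rho> u) x"
          using pderivs_multi_index[OF s, of "is"] by (simp add: \<alpha>_def)
        also have "\<dots> = conv \<rho> (v \<alpha>) x"
          by (rule pderivs_conv_weak_deriv[OF wd m _ sub[OF True]]) (use o in \<open>simp add: \<alpha>_def\<close>)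
        finally show ?thesis by (simp add: indicator_def)
      qed simp
    qed
    also have "\<dots> \<le> (LBINT x. (v \<alpha> x)\<^sup>2)" by (rule mollifier_conv_L2(2)[OF m v])
    also have "\<dots> \<le> (\<Sum>\<alpha> | mi_order \<alpha> \<le> k. LBINT x. (v \<alpha> x)\<^sup>2)"
      by (rule member_le_sum) (use o in \<open>auto simp: \<alpha>_def\<close>)
    finally show "(LBINT x. indicator (ball 0 R) x * (pderivs is (conv \<rho> u) x)\<^sup>2)
        \<le> (\<Sum>\<alpha> | mi_order \<alpha> \<le> k. LBINT x. (v \<alpha> x)\<^sup>2)" .
  qed
  finally show ?thesis .
qed

lemma mollifier_conv_Fubini:
  assumes m: "mollifier \<epsilon> \<rho>" and "integrable lborel g" "integrable lborel h"
  shows "(LBINT x. conv \<rho> g x * h x) = (LBINT x. g x * conv \<rho> h x)"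
  using conv_Fubini(1)[of \<rho> g h] assms by (simp add: mollifier_def)

lemma pderivs_conv_test_function:
  assumes m: "mollifier \<epsilon> \<rho>" and \<psi>: "\<psi> \<in> test_functions UNIV"
  shows "pderivs is (conv \<rho> \<psi>) = conv \<rho> (pderivs is \<psi>)"
proof -
  note t = mollifier_test[OF m]
  have "conv \<rho> \<psi> = conv \<psi> \<rho>"
    by (rule conv_commute) (use t \<psi> in \<open>auto intro: test_function_borel\<close>)
  then have "pderivs is (conv \<rho> \<psi>) = conv (pderivs is \<psi>) \<rho>"
    using pderivs_conv[OF \<psi> test_function_integrable[OF t]] by simp
  also have "\<dots> = conv \<rho> (pderivs is \<psi>)"
    by (rule conv_commute) (use t \<psi> in \<open>auto intro: test_function_borel test_function_pderivs\<close>)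
  finally show ?thesis .
qed

text \<open>
  As the coefficients are constant and convolution with \<open>\<rho>\<close> is self-adjoint and commutes with
  derivatives, testing the mollified equation with \<open>\<psi>\<close> amounts to testing the original equation
  with the mollification of \<open>\<psi>\<close>.
\<close>

lemma mollified_solves_weakly:
  fixes u :: "real ^ 'n \<Rightarrow> real"
  assumes wd: "weak_derivs m U u v" and f: "integrable lborel f" and mol: "mollifier \<epsilon> \<rho>" "\<epsilon> > 0"
    and sub: "\<And>x. x \<in> ball 0 R \<Longrightarrow> cball x \<epsilon> \<subseteq> U"
    and sol: "\<And>\<psi>. \<psi> \<in> test_functions U \<Longrightarrow>
       (\<Sum>\<alpha> | mi_order \<alpha> = m. \<Sum>\<beta> | mi_order \<beta> = m. a \<alpha> \<beta> * (LBINT x. v \<alpha> x * pderivs (word \<beta>) \<psi> x))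
       = (LBINT x. f x * \<psi> x)"
  shows "solves_weakly m a R (conv \<rho> u) (conv \<rho> f)"
  unfolding solves_weakly_def
proof
  fix \<psi> :: "real ^ 'n \<Rightarrow> real" assume \<psi>: "\<psi> \<in> test_functions (ball 0 R)"
  then have \<psi>U: "\<psi> \<in> test_functions UNIV" using test_functions_mono by blast
  have c\<psi>: "conv \<rho> \<psi> \<in> test_functions U"
    by (rule mollifier_conv_test_function[OF mol(1) \<psi> mol(2)]) (use sub in \<open>auto simp: subset_iff\<close>)
  have *: "(LBINT x. pderivs (word \<alpha>) (conv \<rho> u) x * pderivs (word \<beta>) \<psi> x)
      = (LBINT x. v \<alpha> x * pderivs (word \<beta>) (conv \<rho> \<psi>) x)" if \<alpha>: "mi_order \<alpha> = m" for \<alpha> \<beta>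
  proof -
    have "(LBINT x. pderivs (word \<alpha>) (conv \<rho> u) x * pderivs (word \<beta>) \<psi> x)
        = (LBINT x. conv \<rho> (v \<alpha>) x * pderivs (word \<beta>) \<psi> x)"
    proof (intro Bochner_Integration.integral_cong refl)
      fix x
      show "pderivs (word \<alpha>) (conv \<rho> u) x * pderivs (word \<beta>) \<psi> x = conv \<rho> (v \<alpha>) x * pderivs (word \<beta>) \<psi> x"
      proof (cases "x \<in> ball 0 R")
        case True
        then show ?thesis using pderivs_conv_weak_deriv[OF wd mol(1) _ sub[OF True], of \<alpha>] \<alpha> by simp
      next
        case False
        then show ?thesis using test_function_eq_0[OF test_function_pderivs[OF \<psi>] False] by simp
      qed
    qed
    also have "\<dots> = (LBINT x. v \<alpha> x * conv \<rho> (pderivs (word \<beta>) \<psi>) x)"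
      by (rule mollifier_conv_Fubini[OF mol(1)])
         (use wd \<alpha> \<psi> in \<open>auto simp: weak_derivs_def intro: test_function_integrable test_function_pderivs\<close>)
    finally show ?thesis by (simp add: pderivs_conv_test_function[OF mol(1) \<psi>U])
  qed
  have "(\<Sum>\<alpha> | mi_order \<alpha> = m. \<Sum>\<beta> | mi_order \<beta> = m.
        a \<alpha> \<beta> * (LBINT x. pderivs (word \<alpha>) (conv \<rho> u) x * pderivs (word \<beta>) \<psi> x))
     = (\<Sum>\<alpha> | mi_order \<alpha> = m. \<Sum>\<beta> | mi_order \<beta> = m. a \<alpha> \<beta> * (LBINT x. v \<alpha> x * pderivs (word \<beta>) (conv \<rho> \<psi>) x))"
    by (intro sum.cong refl) (simp add: *)
  also have "\<dots> = (LBINT x. f x * conv \<rho> \<psi> x)" by (rule sol[OF c\<psi>])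
  also have "\<dots> = (LBINT x. conv \<rho> f x * \<psi> x)"
    by (rule mollifier_conv_Fubini[OF mol(1) f test_function_integrable[OF \<psi>], symmetric])
  finally show "(\<Sum>\<alpha> | mi_order \<alpha> = m. \<Sum>\<beta> | mi_order \<beta> = m.
        a \<alpha> \<beta> * (LBINT x. pderivs (word \<alpha>) (conv \<rho> u) x * pderivs (word \<beta>) \<psi> x))
     = (LBINT x. conv \<rho> f x * \<psi> x)" .
qed

section \<open>Interior regularity\<close>

text \<open>
  For the mollification of \<open>u\<close>, integrate by parts and apply Cauchy-Schwarz. Then let the scale tend
  to 0: in the integral of \<open>u\<close> against the derivative of \<open>\<psi>\<close>, the mollification can be moved to that
  derivative, and it converges uniformly there.
\<close>

lemma distributional_derivative_bound:
  fixes u :: "real ^ 'n \<Rightarrow> real"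
  assumes u: "integrable lborel u" and \<psi>: "\<psi> \<in> test_functions (ball 0 r)" and e0: "\<epsilon>0 > 0" and S: "S \<ge> 0"
    and b: "\<And>\<epsilon> \<rho>. 0 < \<epsilon> \<Longrightarrow> \<epsilon> < \<epsilon>0 \<Longrightarrow> mollifier \<epsilon> \<rho> \<Longrightarrow> ball_int r (jet_sq n (conv \<rho> u)) \<le> S"
    and len: "length is < n"
  shows "\<bar>LBINT x. u x * pderivs is \<psi> x\<bar> \<le> sqrt S * sqrt (LBINT x. (\<psi> x)\<^sup>2)"
proof -
  define \<theta> where "\<theta> = pderivs is \<psi>"
  have \<psi>U: "\<psi> \<in> test_functions UNIV" using \<psi> test_functions_mono by blast
  have \<theta>: "\<theta> \<in> test_functions UNIV" unfolding \<theta>_def by (rule test_function_pderivs[OF \<psi>U])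
  obtain L where L: "L > 0" "\<And>x y. \<bar>\<theta> x - \<theta> y\<bar> \<le> L * norm (x - y)" using test_function_Lipschitz[OF \<theta>] by metis
  define J where "J = (LBINT x. \<bar>u x\<bar>)"
  have J0: "J \<ge> 0" by (simp add: J_def)
  define T where "T = sqrt S * sqrt (LBINT x. (\<psi> x)\<^sup>2)"
  have close: "\<bar>LBINT x. u x * \<theta> x\<bar> \<le> T + L * \<epsilon> * J" if \<epsilon>: "0 < \<epsilon>" "\<epsilon> < \<epsilon>0" for \<epsilon>
  proof -
    obtain \<rho> :: "real ^ 'n \<Rightarrow> real" where m: "mollifier \<epsilon> \<rho>" using mollifier_exists[OF \<epsilon>(1)] .
    note t = mollifier_test[OF m]
    define w where "w = conv \<rho> u"
    have sw: "smooth w" unfolding w_def by (rule smooth_conv[OF t u])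
    have \<theta>i: "integrable lborel \<theta>" by (rule test_function_integrable[OF \<theta>])
    have near: "\<bar>conv \<rho> \<theta> x - \<theta> x\<bar> \<le> L * \<epsilon>" for x
      by (rule mollifier_conv_Lipschitz[OF m \<theta>i _ _ L(2)]) (use \<epsilon> L(1) in auto)
    have [measurable]: "u \<in> borel_measurable borel" "\<theta> \<in> borel_measurable borel" "conv \<rho> \<theta> \<in> borel_measurable borel"
      using u \<theta> smooth_conv[OF t \<theta>i] by (auto simp: smooth_borel_measurable intro: test_function_borel)
    have i1: "integrable lborel (\<lambda>x. u x * \<theta> x)" by (rule integrable_mult_test_function[OF u \<theta>])
    have i3: "integrable lborel (\<lambda>x. u x * (conv \<rho> \<theta> x - \<theta> x))"
      by (rule Bochner_Integration.integrable_bound[of _ "\<lambda>x. (L * \<epsilon>) * u x"])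
         (use u near L(1) \<epsilon> in \<open>auto simp: abs_mult mult.commute[of "\<bar>u _\<bar>"] intro!: AE_I2 mult_right_mono\<close>)
    have "(LBINT x. w x * \<theta> x) = (LBINT x. u x * conv \<rho> \<theta> x)"
      unfolding w_def by (rule mollifier_conv_Fubini[OF m u \<theta>i])
    also have "\<dots> = (LBINT x. u x * \<theta> x + u x * (conv \<rho> \<theta> x - \<theta> x))"
      by (intro Bochner_Integration.integral_cong) (auto simp: algebra_simps)
    finally have e: "(LBINT x. w x * \<theta> x) = (LBINT x. u x * \<theta> x) + (LBINT x. u x * (conv \<rho> \<theta> x - \<theta> x))"
      using i1 i3 by simp
    have "\<bar>LBINT x. u x * (conv \<rho> \<theta> x - \<theta> x)\<bar> \<le> (LBINT x. L * \<epsilon> * \<bar>u x\<bar>)"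
    proof (rule order_trans[OF integral_abs_bound integral_mono])
      show "\<bar>u x * (conv \<rho> \<theta> x - \<theta> x)\<bar> \<le> L * \<epsilon> * \<bar>u x\<bar>" for x
        unfolding abs_mult using mult_left_mono[OF near[of x], of "\<bar>u x\<bar>"] by (simp add: mult_ac)
    qed (use i3 u in auto)
    then have 2: "\<bar>LBINT x. u x * (conv \<rho> \<theta> x - \<theta> x)\<bar> \<le> L * \<epsilon> * J" by (simp add: J_def)
    have mw: "pderivs is w \<in> borel_measurable borel" "\<psi> \<in> borel_measurable borel"
      using sw \<psi> by (auto intro: smooth_borel_measurable smooth_pderivs test_function_borel)
    have "\<bar>LBINT x. w x * \<theta> x\<bar> = \<bar>LBINT x. pderivs is w x * \<psi> x\<bar>"
      using integral_by_parts[OF sw \<psi>U, of "is"] by (simp add: \<theta>_def abs_mult power_abs)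
    also have "\<dots> = \<bar>LBINT x. (indicator (ball 0 r) x * pderivs is w x) * \<psi> x\<bar>"
      by (intro arg_cong[where f = abs] Bochner_Integration.integral_cong refl)
         (auto simp: test_function_eq_0[OF \<psi>] indicator_def)
    also have "\<dots> \<le> sqrt (ball_int r (jet_sq n w) * (LBINT x. (\<psi> x)\<^sup>2))"
      unfolding ball_int_def
    proof (rule integral_product_le)
      show "(indicator (ball 0 r) x * pderivs is w x)\<^sup>2 \<le> indicator (ball 0 r) x * jet_sq n w x" for x
        using pderivs_sq_le_jet_sq[OF len, of w x] by (auto simp: indicator_def)
      show "integrable lborel (\<lambda>x. indicator (ball 0 r) x * jet_sq n w x)"
        by (rule ball_integrable[OF jet_sq_continuous[OF sw]])
      show "integrable lborel (\<lambda>x. (\<psi> x)\<^sup>2)" by (rule test_function_square_integrable[OF \<psi>])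
    qed (auto intro!: mw borel_measurable_times borel_measurable_indicator)
    also have "\<dots> \<le> sqrt (S * (LBINT x. (\<psi> x)\<^sup>2))"
      using b[OF \<epsilon> m] by (intro real_sqrt_le_mono mult_right_mono) (auto simp: w_def)
    also have "\<dots> = T" by (simp add: T_def real_sqrt_mult)
    finally show ?thesis using e 2 by linarith
  qed
  have "\<bar>LBINT x. u x * \<theta> x\<bar> \<le> T + L * 0 * J"
  proof (rule tendsto_lowerbound)
    show "((\<lambda>t. T + L * t * J) \<longlongrightarrow> T + L * 0 * J) (at_right 0)" by (intro tendsto_intros)
    show "\<forall>\<^sub>F t in at_right 0. \<bar>LBINT x. u x * \<theta> x\<bar> \<le> T + L * t * J"
      unfolding eventually_at_right_field by (rule exI[of _ \<epsilon>0]) (use e0 close in auto)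
  qed simp
  then show ?thesis by (simp add: T_def \<theta>_def)
qed

text \<open>
  The bound says that the distributional derivative is a functional that is bounded in the square norm,
  so it is represented by a square integrable function.
\<close>

lemma weak_deriv_from_bound:
  fixes u u' :: "real ^ 'n \<Rightarrow> real"
  assumes U: "open U" and u': "integrable lborel u'" "AE x in lborel. x \<in> U \<longrightarrow> u x = u' x"
    and b: "\<And>\<psi>. \<psi> \<in> test_functions U \<Longrightarrow>
       \<bar>LBINT x. u' x * pderivs (word \<alpha>) \<psi> x\<bar> \<le> K * sqrt (LBINT x. (\<psi> x)\<^sup>2)"
    and bounded: "bounded U"
  shows "\<exists>g\<in>L2_space U. has_weak_deriv U \<alpha> u g" "(L2_norm_on U (weak_deriv U \<alpha> u))\<^sup>2 \<le> K\<^sup>2"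
proof -
  have bU: "U \<in> sets borel" using U by simp
  define \<L> where "\<L> = (\<lambda>\<psi>. (-1) ^ mi_order \<alpha> * (LBINT x. u' x * pderivs (word \<alpha>) \<psi> x))"
  have mu: "u' \<in> borel_measurable borel" using u'(1) by auto
  note int = integrable_mult_test_function[OF u'(1)]
  obtain g where g: "g \<in> borel_measurable borel" "\<And>x. x \<notin> U \<Longrightarrow> g x = 0"
    "integrable lborel (\<lambda>x. (g x)\<^sup>2)" "(LBINT x. (g x)\<^sup>2) \<le> K\<^sup>2"
    "\<And>\<phi>. \<phi> \<in> test_functions U \<Longrightarrow> \<L> \<phi> = (LBINT x. g x * \<phi> x)"
  proof (rule Riesz_representation_test_functions[of U \<L> K])
    fix \<phi> \<psi> assume t: "\<phi> \<in> test_functions U" "\<psi> \<in> test_functions U"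
    show "\<L> (\<lambda>x. \<phi> x + \<psi> x) = \<L> \<phi> + \<L> \<psi>"
      using t int[OF test_function_pderivs[OF t(1)]] int[OF test_function_pderivs[OF t(2)]]
      by (simp add: \<L>_def pderivs_add test_function_smooth distrib_left)
  next
    fix \<phi> c assume t: "\<phi> \<in> test_functions U"
    show "\<L> (\<lambda>x. c * \<phi> x) = c * \<L> \<phi>"
      using t by (simp add: \<L>_def pderivs_cmult test_function_smooth mult.left_commute)
  next
    fix \<phi> assume t: "\<phi> \<in> test_functions U"
    show "\<bar>\<L> \<phi>\<bar> \<le> K * sqrt (LBINT x. (\<phi> x)\<^sup>2)"
      using b[OF t] by (simp add: \<L>_def abs_mult power_abs)
  qed (rule that)
  have L2: "g \<in> L2_space U" by (rule L2_spaceI(1)[OF bU g(1,2) _ g(3)]) auto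
  obtain g' where "integrable lborel g'" "AE x in lborel. x \<in> U \<longrightarrow> g x = g' x"
    by (rule L2_representative[OF L2 bU bounded]) (rule that)
  then have lg: "locally_integrable U g" by (rule integrable_imp_locally_integrable)
  have wd: "has_weak_deriv U \<alpha> u g"
    unfolding has_weak_deriv_def mi_deriv_eq_pderivs
  proof (intro conjI ballI)
    show "locally_integrable U u" by (rule integrable_imp_locally_integrable[OF u'])
    fix \<psi> assume \<psi>: "\<psi> \<in> test_functions U"
    have "integral\<^sup>L (lebesgue_on U) (\<lambda>x. u x * pderivs (word \<alpha>) \<psi> x) = (LBINT x. u' x * pderivs (word \<alpha>) \<psi> x)"
      by (rule integral_on_test_product[OF bU mu u'(2)])
         (use \<psi> in \<open>auto intro: test_function_borel test_function_pderivs test_function_eq_0\<close>)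
    moreover have "integral\<^sup>L (lebesgue_on U) (\<lambda>x. g x * \<psi> x) = (LBINT x. g x * \<psi> x)"
      by (rule integral_on_test_product[OF bU g(1)])
         (use \<psi> in \<open>auto intro: test_function_borel test_function_eq_0\<close>)
    ultimately show "integral\<^sup>L (lebesgue_on U) (\<lambda>x. u x * pderivs (word \<alpha>) \<psi> x) =
        (-1) ^ mi_order \<alpha> * integral\<^sup>L (lebesgue_on U) (\<lambda>x. g x * \<psi> x)"
      using g(5)[OF \<psi>] by (simp add: \<L>_def mult.assoc[symmetric] power_mult_distrib[symmetric] flip: g(5)[OF \<psi>])
  qed (rule lg)
  with L2 show "\<exists>g\<in>L2_space U. has_weak_deriv U \<alpha> u g" by blast
  show "(L2_norm_on U (weak_deriv U \<alpha> u))\<^sup>2 \<le> K\<^sup>2"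
    using L2_spaceI(2)[OF bU g(1,2) weak_deriv_AE_eq[OF U wd] g(3)] g(4) by simp
qed

lemma weak_solution_representatives:
  fixes u :: "real ^ 'n \<Rightarrow> real"
  assumes U: "open U" and sol: "weak_solution m a U f u"
    and v: "\<And>\<alpha>. mi_order \<alpha> = m \<Longrightarrow> AE x in lborel. x \<in> U \<longrightarrow> weak_deriv U \<alpha> u x = v \<alpha> x"
      "\<And>\<alpha>. mi_order \<alpha> = m \<Longrightarrow> integrable lborel (v \<alpha>)"
    and f': "integrable lborel f'" "AE x in lborel. x \<in> U \<longrightarrow> f x = f' x"
    and \<psi>: "\<psi> \<in> test_functions U"
  shows "(\<Sum>\<alpha> | mi_order \<alpha> = m. \<Sum>\<beta> | mi_order \<beta> = m. a \<alpha> \<beta> * (LBINT x. v \<alpha> x * pderivs (word \<beta>) \<psi> x))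
       = (LBINT x. f' x * \<psi> x)"
proof -
  have bU: "U \<in> sets borel" using U by simp
  define F where "F = (\<lambda>x. \<Sum>\<alpha> | mi_order \<alpha> = m. \<Sum>\<beta> | mi_order \<beta> = m. a \<alpha> \<beta> * (v \<alpha> x * pderivs (word \<beta>) \<psi> x))"
  have mv: "v \<alpha> \<in> borel_measurable borel" if "mi_order \<alpha> = m" for \<alpha> using v(2)[OF that] by auto
  have mp: "pderivs is \<psi> \<in> borel_measurable borel" for "is"
    by (rule test_function_borel[OF test_function_pderivs[OF \<psi>]])
  have int: "integrable lborel (\<lambda>x. v \<alpha> x * pderivs is \<psi> x)" if "mi_order \<alpha> = m" for \<alpha> "is"
    by (rule integrable_mult_test_function[OF v(2)[OF that] test_function_pderivs[OF \<psi>]])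
  have "integral\<^sup>L (lebesgue_on U) (\<lambda>x. \<Sum>\<alpha> | mi_order \<alpha> = m. \<Sum>\<beta> | mi_order \<beta> = m.
        a \<alpha> \<beta> * weak_deriv U \<alpha> u x * weak_deriv U \<beta> \<psi> x) = integral\<^sup>L (lebesgue_on U) (\<lambda>x. f x * \<psi> x)"
    using sol test_function_in_sobolev0[OF U \<psi>] unfolding weak_solution_def by blast
  moreover have "integral\<^sup>L (lebesgue_on U) (\<lambda>x. f x * \<psi> x) = (LBINT x. f' x * \<psi> x)"
    by (rule integral_on_test_product[OF bU]) (use f' \<psi> in \<open>auto intro: test_function_borel test_function_eq_0\<close>)
  moreover have "integral\<^sup>L (lebesgue_on U) (\<lambda>x. \<Sum>\<alpha> | mi_order \<alpha> = m. \<Sum>\<beta> | mi_order \<beta> = m.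
        a \<alpha> \<beta> * weak_deriv U \<alpha> u x * weak_deriv U \<beta> \<psi> x) = (LBINT x. F x)"
  proof (rule lebesgue_on_transfer(2)[OF bU])
    show "F \<in> borel_measurable borel"
      unfolding F_def by (intro borel_measurable_sum borel_measurable_times borel_measurable_const mp mv) auto
    show "F x = 0" if "x \<notin> U" for x
      unfolding F_def by (simp add: test_function_eq_0[OF test_function_pderivs[OF \<psi>] that])
    have "AE x in lborel. \<forall>\<alpha>\<in>{\<alpha>. mi_order \<alpha> = m}. x \<in> U \<longrightarrow> weak_deriv U \<alpha> u x = v \<alpha> x"
      using v(1) by (intro AE_finite_allI) auto
    moreover have "AE x in lborel. \<forall>\<beta>\<in>{\<beta>. mi_order \<beta> = m}. x \<in> U \<longrightarrow> weak_deriv U \<beta> \<psi> x = pderivs (word \<beta>) \<psi> x"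
      by (intro AE_finite_allI weak_deriv_AE_eq[OF U has_weak_deriv_test_function[OF U \<psi>]]) auto
    ultimately show "AE x in lborel. x \<in> U \<longrightarrow> (\<Sum>\<alpha> | mi_order \<alpha> = m. \<Sum>\<beta> | mi_order \<beta> = m.
        a \<alpha> \<beta> * weak_deriv U \<alpha> u x * weak_deriv U \<beta> \<psi> x) = F x"
      by eventually_elim (auto simp: F_def mult.assoc intro!: sum.cong)
  qed
  moreover have "(LBINT x. F x) = (\<Sum>\<alpha> | mi_order \<alpha> = m. \<Sum>\<beta> | mi_order \<beta> = m. a \<alpha> \<beta> * (LBINT x. v \<alpha> x * pderivs (word \<beta>) \<psi> x))"
    unfolding F_def using int by (simp add: Bochner_Integration.integral_sum)
  ultimately show ?thesis by simp
qed

lemma abs_coeff_le_max_coeff: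
  fixes a :: "nat ^ 'n \<Rightarrow> nat ^ 'n \<Rightarrow> real"
  assumes "mi_order \<alpha> = m" "mi_order \<beta> = m"
  shows "\<bar>a \<alpha> \<beta>\<bar> \<le> max_coeff m a"
proof -
  have "{\<bar>a \<alpha> \<beta>\<bar> | \<alpha> \<beta>. mi_order \<alpha> = m \<and> mi_order \<beta> = m}
     = (\<lambda>(\<alpha>, \<beta>). \<bar>a \<alpha> \<beta>\<bar>) ` ({\<alpha>. mi_order \<alpha> = m} \<times> {\<beta>. mi_order \<beta> = m})" by auto
  then have "finite {\<bar>a \<alpha> \<beta>\<bar> | \<alpha> \<beta>. mi_order \<alpha> = m \<and> mi_order \<beta> = m}" by simp
  then show ?thesis unfolding max_coeff_def by (rule Max_ge) (use assms in blast)
qed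

theorem theorem3p1:
  fixes m l :: nat and c M :: real
  assumes "m \<ge> 1" and "c > 0"
  shows "\<exists>C>0. \<forall>a :: nat ^ 'n \<Rightarrow> nat ^ 'n \<Rightarrow> real.
    symmetric_coeffs m a \<and> elliptic_coeffs m c a \<and> max_coeff m a = M \<longrightarrow>
    (\<forall>u f. u \<in> sobolev m (ball 0 1) \<and> f \<in> sobolev l (ball 0 1) \<and>
           weak_solution m a (ball 0 1) f u \<longrightarrow>
       u \<in> sobolev (2 * m + l) (ball 0 (1/2)) \<and>
       sobolev_norm (2 * m + l) (ball 0 (1/2)) u
         \<le> C * (sobolev_norm m (ball 0 1) u + sobolev_norm l (ball 0 1) f))"
proof -
  \<comment> \<open>The absolute value provides a nonnegative bound before any coefficients are given.\<close>
  obtain C1 where C1: "C1 \<ge> 0" "\<And>(a :: nat ^ 'n \<Rightarrow> nat ^ 'n \<Rightarrow> real) w g. smooth_solution m c \<bar>M\<bar> (3/4) a w g \<Longrightarrow>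
      ball_int (1/2) (jet_sq (Suc (m + (m + l))) w)
        \<le> C1 * (ball_int (3/4) (jet_sq (Suc m) w) + ball_int (3/4) (jet_sq (Suc l) g))"
    using interior_estimate[OF assms, of "\<bar>M\<bar>" "1/2" "3/4" "m + l" l] by auto
  define N where "N = real (card (words (Suc m) :: 'n list set)) + real (card (words (Suc l) :: 'n list set))"
  define N2 where "N2 = real (card {\<alpha> :: nat ^ 'n. mi_order \<alpha> \<le> 2 * m + l})"
  \<comment> \<open>The summand 1 makes the constant positive.\<close>
  define C where "C = sqrt (N2 * (C1 * N)) + 1"
  have N0: "N \<ge> 0" "N2 \<ge> 0" by (auto simp: N_def N2_def)
  let ?B = "ball 0 1 :: (real ^ 'n) set" and ?H = "ball 0 (1/2) :: (real ^ 'n) set"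
  show ?thesis
  proof (rule exI[of _ C], intro conjI allI impI)
    show "C > 0" using N0 C1(1) by (simp add: C_def add_nonneg_pos)
  next
    fix a :: "nat ^ 'n \<Rightarrow> nat ^ 'n \<Rightarrow> real" and u f
    assume a: "symmetric_coeffs m a \<and> elliptic_coeffs m c a \<and> max_coeff m a = M"
    assume uf: "u \<in> sobolev m ?B \<and> f \<in> sobolev l ?B \<and> weak_solution m a ?B f u"
    from uf have uS: "u \<in> sobolev m ?B" and fS: "f \<in> sobolev l ?B" and sol: "weak_solution m a ?B f u" by auto
    obtain u' v where u': "weak_derivs m ?B u' v" "AE x in lborel. x \<in> ?B \<longrightarrow> u x = u' x"
      "integrable lborel (\<lambda>x. (u' x)\<^sup>2)"
      "\<And>\<alpha>. mi_order \<alpha> \<le> m \<Longrightarrow> AE x in lborel. x \<in> ?B \<longrightarrow> weak_deriv ?B \<alpha> u x = v \<alpha> x"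
      "(sobolev_norm m ?B u)\<^sup>2 = (\<Sum>\<alpha> | mi_order \<alpha> \<le> m. LBINT x. (v \<alpha> x)\<^sup>2)"
      by (rule sobolev_representatives[OF uS open_ball bounded_ball]) (rule that)
    obtain f' p where f': "weak_derivs l ?B f' p" "AE x in lborel. x \<in> ?B \<longrightarrow> f x = f' x"
      "(sobolev_norm l ?B f)\<^sup>2 = (\<Sum>\<alpha> | mi_order \<alpha> \<le> l. LBINT x. (p \<alpha> x)\<^sup>2)"
      by (rule sobolev_representatives[OF fS open_ball bounded_ball]) (rule that)
    have iu: "integrable lborel u'" and i_f: "integrable lborel f'"
      using u'(1) f'(1) by (auto simp: weak_derivs_def)
    define S where "S = C1 * (N * ((sobolev_norm m ?B u)\<^sup>2 + (sobolev_norm l ?B f)\<^sup>2))"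
    have S0: "S \<ge> 0" using C1(1) N0 by (simp add: S_def)
    \<comment> \<open>The scale is less than 1/4, so that on the ball of radius 3/4 the mollifications only see values
      in the unit ball.\<close>
    have moll: "ball_int (1/2) (jet_sq (Suc (m + (m + l))) (conv \<rho> u')) \<le> S"
      if \<epsilon>: "0 < \<epsilon>" "\<epsilon> < 1/4" and mol: "mollifier \<epsilon> \<rho>" for \<epsilon> \<rho>
    proof -
      note t = mollifier_test[OF mol]
      have sub: "cball x \<epsilon> \<subseteq> ?B" if "x \<in> ball 0 (3/4)" for x :: "real ^ 'n"
      proof
        fix y assume "y \<in> cball x \<epsilon>"
        then show "y \<in> ?B" using that \<epsilon> norm_triangle_ineq2[of y x] by (simp add: dist_norm norm_minus_commute)
      qed
      have sw: "solves_weakly m a (3/4) (conv \<rho> u') (conv \<rho> f')"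
      proof (rule mollified_solves_weakly[OF u'(1) i_f mol \<epsilon>(1) sub])
        show "(\<Sum>\<alpha> | mi_order \<alpha> = m. \<Sum>\<beta> | mi_order \<beta> = m. a \<alpha> \<beta> * (LBINT x. v \<alpha> x * pderivs (word \<beta>) \<psi> x))
            = (LBINT x. f' x * \<psi> x)" if "\<psi> \<in> test_functions ?B" for \<psi>
          by (rule weak_solution_representatives[OF open_ball _ _ _ i_f f'(2) that])
             (use sol u'(1,4) in \<open>auto simp: weak_derivs_def\<close>)
      qed
      have "ball_int (1/2) (jet_sq (Suc (m + (m + l))) (conv \<rho> u'))
        \<le> C1 * (ball_int (3/4) (jet_sq (Suc m) (conv \<rho> u')) + ball_int (3/4) (jet_sq (Suc l) (conv \<rho> f')))"
      proof (rule C1(2))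
        have "\<bar>a \<alpha> \<beta>\<bar> \<le> \<bar>M\<bar>" if "mi_order \<alpha> = m" "mi_order \<beta> = m" for \<alpha> \<beta>
          using abs_coeff_le_max_coeff[OF that, of a] a by simp
        then show "smooth_solution m c \<bar>M\<bar> (3/4) a (conv \<rho> u') (conv \<rho> f')"
          using a sw smooth_conv[OF t iu] smooth_conv[OF t i_f] by (simp add: smooth_solution_def)
      qed
      also have "\<dots> \<le> S"
        unfolding S_def
      proof (rule mult_left_mono[OF _ C1(1)])
        let ?Nm = "real (card (words (Suc m) :: 'n list set))" and ?Nl = "real (card (words (Suc l) :: 'n list set))"
        have "ball_int (3/4) (jet_sq (Suc m) (conv \<rho> u')) \<le> ?Nm * (sobolev_norm m ?B u)\<^sup>2"
          unfolding u'(5) by (rule mollified_jet_bound[OF u'(1) mol sub])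
        also have "\<dots> \<le> N * (sobolev_norm m ?B u)\<^sup>2" by (rule mult_right_mono) (auto simp: N_def)
        finally have 1: "ball_int (3/4) (jet_sq (Suc m) (conv \<rho> u')) \<le> N * (sobolev_norm m ?B u)\<^sup>2" .
        have "ball_int (3/4) (jet_sq (Suc l) (conv \<rho> f')) \<le> ?Nl * (sobolev_norm l ?B f)\<^sup>2"
          unfolding f'(3) by (rule mollified_jet_bound[OF f'(1) mol sub])
        also have "\<dots> \<le> N * (sobolev_norm l ?B f)\<^sup>2" by (rule mult_right_mono) (auto simp: N_def)
        finally show "ball_int (3/4) (jet_sq (Suc m) (conv \<rho> u')) + ball_int (3/4) (jet_sq (Suc l) (conv \<rho> f'))
            \<le> N * ((sobolev_norm m ?B u)\<^sup>2 + (sobolev_norm l ?B f)\<^sup>2)"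
          using 1 by (simp add: distrib_left)
      qed
      finally show ?thesis .
    qed
    have aeH: "AE x in lborel. x \<in> ?H \<longrightarrow> u x = u' x"
      using u'(2) by eventually_elim auto
    have wd: "(\<exists>g\<in>L2_space ?H. has_weak_deriv ?H \<alpha> u g) \<and> (L2_norm_on ?H (weak_deriv ?H \<alpha> u))\<^sup>2 \<le> S"
      if \<alpha>: "mi_order \<alpha> \<le> 2 * m + l" for \<alpha>
    proof -
      have b: "\<bar>LBINT x. u' x * pderivs (word \<alpha>) \<psi> x\<bar> \<le> sqrt S * sqrt (LBINT x. (\<psi> x)\<^sup>2)"
        if "\<psi> \<in> test_functions ?H" for \<psi>
        by (rule distributional_derivative_bound[OF iu that _ S0 moll, of "1/4"])
           (use \<alpha> in \<open>auto simp: length_word\<close>)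
      show ?thesis
        using weak_deriv_from_bound[OF open_ball iu aeH b bounded_ball] S0 by simp
    qed
    have "u \<in> L2_space ?H"
    proof (rule L2_spaceI(1)[of ?H "\<lambda>x. indicator ?H x * u' x"])
      show "AE x in lborel. x \<in> ?H \<longrightarrow> u x = indicator ?H x * u' x"
        using aeH by eventually_elim auto
      have "integrable lborel (\<lambda>x. indicator ?H x *\<^sub>R (u' x)\<^sup>2)"
        by (rule integrable_mult_indicator) (use u'(3) in auto)
      moreover have "(\<lambda>x. indicator ?H x *\<^sub>R (u' x)\<^sup>2) = (\<lambda>x. (indicator ?H x * u' x)\<^sup>2)"
        by (auto simp: fun_eq_iff indicator_def)
      ultimately show "integrable lborel (\<lambda>x. (indicator ?H x * u' x)\<^sup>2)" by simp
    qed (use iu in \<open>auto intro!: borel_measurable_times borel_measurable_indicator\<close>)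
    with wd show "u \<in> sobolev (2 * m + l) ?H" by (simp add: sobolev_def)
    have "(\<Sum>\<alpha> | mi_order \<alpha> \<le> 2 * m + l. (L2_norm_on ?H (weak_deriv ?H \<alpha> u))\<^sup>2) \<le> N2 * S"
      unfolding N2_def by (rule sum_bounded_above) (use wd in auto)
    then have "sobolev_norm (2 * m + l) ?H u \<le> sqrt (N2 * S)"
      unfolding sobolev_norm_def by (rule real_sqrt_le_mono)
    also have "N2 * S = (N2 * (C1 * N)) * ((sobolev_norm m ?B u)\<^sup>2 + (sobolev_norm l ?B f)\<^sup>2)"
      by (simp add: S_def)
    also have "sqrt \<dots> = sqrt (N2 * (C1 * N)) * sqrt ((sobolev_norm m ?B u)\<^sup>2 + (sobolev_norm l ?B f)\<^sup>2)"
      by (rule real_sqrt_mult)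
    also have "\<dots> \<le> C * (sobolev_norm m ?B u + sobolev_norm l ?B f)"
    proof (rule mult_mono)
      show "sqrt ((sobolev_norm m ?B u)\<^sup>2 + (sobolev_norm l ?B f)\<^sup>2) \<le> sobolev_norm m ?B u + sobolev_norm l ?B f"
        by (rule sqrt_sum_squares_le_sum) (auto simp: sobolev_norm_def sum_nonneg)
    qed (use C1(1) N0 in \<open>auto simp: C_def\<close>)
    finally show "sobolev_norm (2 * m + l) ?H u \<le> C * (sobolev_norm m ?B u + sobolev_norm l ?B f)" .
  qed
qed

end
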